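(* For every $m\ge1$ and $N_1,N_2\ge0$, the space of conjugate polynomials in $\mathbb{C}[x_f,\overline{x_f}:f\in\mathbb{F}_2^m]$ that are homogeneous of degree $(N_1,N_2)$ and invariant under the complex Clifford group $\mathcal{X}_m$ is spanned by the polynomials $\mathrm{ccwe}(C(m))$, where $C$ ranges over all binary doubly-even self-dual codes of length $(N_1,N_2)$. If moreover $m+1\ge (N_1+N_2)/2$, then the polynomials $\mathrm{ccwe}(C(m))$, with $C$ ranging over a set of representatives of the equivalence classes of such codes, form a basis of this space.
   Context: A binary code of length $(N_1,N_2)$ is an $\mathbb{F}_2$-subspace $C\le\mathbb{F}_2^{N_1+N_2}$. $\beta(x,y)=\sum_{j\le N_1}x_jy_j-\sum_{j>N_1}x_jy_j\in\mathbb{F}_2$, $C^\perp=\{y:\beta(c,y)=0\ \forall c\in C\}$, $C$ self-dual if $C=C^\perp$. $\mathrm{wt}(c)=\sum_{j\le N_1}c_j-\sum_{j>N_1}c_j\in\mathbb{Z}$ (entries read as integers $0,1$); $C$ doubly-even if all weights are divisible by $4$. Two codes are equivalent if one is obtained from the other by permuting the first $N_1$ coordinates among themselves and the last $N_2$ coordinates among themselves. The complex Clifford group $\mathcal{X}_m\le U(2^m)$: with $(e_v)_{v\in\mathbb{F}_2^m}$ an orthonormal basis of $\mathbb{C}^{2^m}$, $\mathcal{X}_m$ is generated by $d_S:e_v\mapsto i^{v^TSv}e_v$ ($S$ symmetric integral $m\times m$), $m_{g,v'}:e_v\mapsto e_{gv+v'}$ ($(g,v')\in\mathrm{GL}(m,2)\ltimes\mathbb{F}_2^m$),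 and $h\otimes I_2\otimes\cdots\otimes I_2$ with $h=\frac1{\sqrt2}\begin{bmatrix}1&1\\1&-1\end{bmatrix}$. $g=(g_{wv})\in U(2^m)$ acts on the polynomial ring $\mathbb{C}[x_f,\overline{x_f}:f\in\mathbb{F}_2^m]$ (independent indeterminates) by the ring automorphism $x_v\mapsto\sum_w g_{wv}x_w$, $\overline{x_v}\mapsto\sum_w\overline{g_{wv}}\,\overline{x_w}$; homogeneous of degree $(N_1,N_2)$ means degree $N_1$ in the $x_f$ and $N_2$ in the $\overline{x_f}$. For an $m\times(N_1+N_2)$ matrix $M$ over $\mathbb{F}_2$ with columns $M_j\in\mathbb{F}_2^m$, $\nu_M=\prod_{j\le N_1}x_{M_j}\prod_{j>N_1}\overline{x_{M_j}}$; $\mathrm{ccwe}(C(m))=\sum\nu_M$ over all such $M$ all of whose rows lie in $C$. *)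

theory Defs
  imports "HOL-Analysis.Analysis" "HOL-Library.Function_Algebras" "HOL-Combinatorics.Permutations"
begin

definition F2vecs :: "nat \<Rightarrow> bool list set" where
  "F2vecs n = {v. length v = n}"

definition vadd :: "bool list \<Rightarrow> bool list \<Rightarrow> bool list" where
  "vadd u v = map (\<lambda>(a, b). a \<noteq> b) (zip u v)"

definition is_code :: "nat \<Rightarrow> nat \<Rightarrow> bool list set \<Rightarrow> bool" where
  "is_code N1 N2 C \<longleftrightarrow> C \<subseteq> F2vecs (N1 + N2) \<and> replicate (N1 + N2) False \<in> C
     \<and> (\<forall>u\<in>C. \<forall>v\<in>C. vadd u v \<in> C)"

definition beta :: "nat \<Rightarrow> nat \<Rightarrow> bool list \<Rightarrow> bool list \<Rightarrow> int" where
  "beta N1 N2 x y = (\<Sum>j<N1. of_bool (x ! j \<and> y ! j))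
                    - (\<Sum>j\<in>{N1..<N1+N2}. of_bool (x ! j \<and> y ! j))"

definition dual_code :: "nat \<Rightarrow> nat \<Rightarrow> bool list set \<Rightarrow> bool list set" where
  "dual_code N1 N2 C = {y \<in> F2vecs (N1 + N2). \<forall>c\<in>C. beta N1 N2 c y mod 2 = 0}"

definition self_dual :: "nat \<Rightarrow> nat \<Rightarrow> bool list set \<Rightarrow> bool" where
  "self_dual N1 N2 C \<longleftrightarrow> C = dual_code N1 N2 C"

definition wt :: "nat \<Rightarrow> nat \<Rightarrow> bool list \<Rightarrow> int" where
  "wt N1 N2 c = (\<Sum>j<N1. of_bool (c ! j)) - (\<Sum>j\<in>{N1..<N1+N2}. of_bool (c ! j))"

definition doubly_even :: "nat \<Rightarrow> nat \<Rightarrow> bool list set \<Rightarrow> bool" where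
  "doubly_even N1 N2 C \<longleftrightarrow> (\<forall>c\<in>C. (4::int) dvd wt N1 N2 c)"

definition DESD_codes :: "nat \<Rightarrow> nat \<Rightarrow> bool list set set" where
  "DESD_codes N1 N2 = {C. is_code N1 N2 C \<and> self_dual N1 N2 C \<and> doubly_even N1 N2 C}"

definition perm_word :: "(nat \<Rightarrow> nat) \<Rightarrow> bool list \<Rightarrow> bool list" where
  "perm_word \<pi> c = map (\<lambda>j. c ! \<pi> j) [0..<length c]"

definition codes_equiv :: "nat \<Rightarrow> nat \<Rightarrow> bool list set \<Rightarrow> bool list set \<Rightarrow> bool" where
  "codes_equiv N1 N2 C D \<longleftrightarrow> (\<exists>\<pi>. \<pi> permutes {..<N1 + N2} \<and> \<pi> ` {..<N1} = {..<N1}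
      \<and> D = perm_word \<pi> ` C)"

text \<open>A conjugate polynomial in C[x_f, conj x_f : f in F_2^m] (independent indeterminates) is
  represented by its polynomial function: a x b \<mapsto> p a b, where a gives the values of the
  x_f and b those of the conj x_f (only entries at f in F_2^m matter). Since C is infinite,
  this identifies the polynomial ring with the ring of polynomial functions.\<close>

type_synonym cpoly = "(bool list \<Rightarrow> complex) \<Rightarrow> (bool list \<Rightarrow> complex) \<Rightarrow> complex"

definition cscale :: "complex \<Rightarrow> cpoly \<Rightarrow> cpoly" where
  "cscale c p = (\<lambda>a b. c * p a b)"

abbreviation cspan :: "cpoly set \<Rightarrow> cpoly set" where
  "cspan \<equiv> module.span cscale"

abbreviation cindependent :: "cpoly set \<Rightarrow> bool" where
  "cindependent S \<equiv> \<not> module.dependent cscale S"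

definition monom :: "bool list list \<Rightarrow> bool list list \<Rightarrow> cpoly" where
  "monom fs gs = (\<lambda>a b. prod_list (map a fs) * prod_list (map b gs))"

definition homog_space :: "nat \<Rightarrow> nat \<Rightarrow> nat \<Rightarrow> cpoly set" where
  "homog_space m N1 N2 = cspan {monom fs gs | fs gs. length fs = N1 \<and> length gs = N2
       \<and> set fs \<subseteq> F2vecs m \<and> set gs \<subseteq> F2vecs m}"

text \<open>A 2^m x 2^m matrix is a function g with g w v the (w,v) entry, w,v in F_2^m
  (entries outside F_2^m x F_2^m are irrelevant and taken to be 0).\<close>
type_synonym cmat = "bool list \<Rightarrow> bool list \<Rightarrow> complex"

definition restr :: "nat \<Rightarrow> cmat \<Rightarrow> cmat" where
  "restr m g = (\<lambda>w v. if w \<in> F2vecs m \<and> v \<in> F2vecs m then g w v else 0)"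

definition mat_mult :: "nat \<Rightarrow> cmat \<Rightarrow> cmat \<Rightarrow> cmat" where
  "mat_mult m g h = restr m (\<lambda>w v. \<Sum>u\<in>F2vecs m. g w u * h u v)"

definition mat_adj :: "nat \<Rightarrow> cmat \<Rightarrow> cmat" where
  "mat_adj m g = restr m (\<lambda>w v. cnj (g v w))"

definition qform :: "nat \<Rightarrow> (nat \<Rightarrow> nat \<Rightarrow> int) \<Rightarrow> bool list \<Rightarrow> int" where
  "qform m S v = (\<Sum>i<m. \<Sum>j<m. of_bool (v ! i) * S i j * of_bool (v ! j))"

definition gen_d :: "nat \<Rightarrow> (nat \<Rightarrow> nat \<Rightarrow> int) \<Rightarrow> cmat" where
  "gen_d m S = restr m (\<lambda>w v. if w = v then \<i> powi (qform m S v) else 0)"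

definition f2matvec :: "nat \<Rightarrow> (nat \<Rightarrow> nat \<Rightarrow> bool) \<Rightarrow> bool list \<Rightarrow> bool list" where
  "f2matvec m A v = map (\<lambda>i. odd (card {j. j < m \<and> A i j \<and> v ! j})) [0..<m]"

definition GL2 :: "nat \<Rightarrow> (nat \<Rightarrow> nat \<Rightarrow> bool) set" where
  "GL2 m = {A. bij_betw (f2matvec m A) (F2vecs m) (F2vecs m)}"

definition gen_m :: "nat \<Rightarrow> (nat \<Rightarrow> nat \<Rightarrow> bool) \<Rightarrow> bool list \<Rightarrow> cmat" where
  "gen_m m A v' = restr m (\<lambda>w v. if w = vadd (f2matvec m A v) v' then 1 else 0)"

text \<open>h tensor I_2 tensor ... tensor I_2, with e_v = e_{v_1} tensor ... tensor e_{v_m};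
  the first tensor factor is coordinate 0 of v.\<close>
definition hadamard :: "bool \<Rightarrow> bool \<Rightarrow> complex" where
  "hadamard a b = (if a \<and> b then - 1 else 1) / complex_of_real (sqrt 2)"

definition gen_h :: "nat \<Rightarrow> cmat" where
  "gen_h m = restr m (\<lambda>w v. if tl w = tl v then hadamard (hd w) (hd v) else 0)"

inductive_set clifford_group :: "nat \<Rightarrow> cmat set" for m :: nat where
  gen_d: "(\<forall>i j. S i j = S j i) \<Longrightarrow> gen_d m S \<in> clifford_group m"
| gen_m: "A \<in> GL2 m \<Longrightarrow> v' \<in> F2vecs m \<Longrightarrow> gen_m m A v' \<in> clifford_group m"
| gen_h: "gen_h m \<in> clifford_group m"
| mult: "g \<in> clifford_group m \<Longrightarrow> h \<in> clifford_group m \<Longrightarrow> mat_mult m g h \<in> clifford_group m"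
| inv: "g \<in> clifford_group m \<Longrightarrow> mat_adj m g \<in> clifford_group m"

text \<open>Action: x_v \<mapsto> sum_w g_{wv} x_w, conj x_v \<mapsto> sum_w conj(g_{wv}) conj x_w,
  extended as a ring automorphism (i.e. substitution).\<close>
definition act :: "nat \<Rightarrow> cmat \<Rightarrow> cpoly \<Rightarrow> cpoly" where
  "act m g p = (\<lambda>a b. p (\<lambda>v. \<Sum>w\<in>F2vecs m. g w v * a w) (\<lambda>v. \<Sum>w\<in>F2vecs m. cnj (g w v) * b w))"

definition invariant_space :: "nat \<Rightarrow> nat \<Rightarrow> nat \<Rightarrow> cpoly set" where
  "invariant_space m N1 N2 = {p \<in> homog_space m N1 N2. \<forall>g\<in>clifford_group m. act m g p = p}"

definition col :: "bool list list \<Rightarrow> nat \<Rightarrow> bool list" where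
  "col M j = map (\<lambda>r. r ! j) M"

definition nu :: "nat \<Rightarrow> nat \<Rightarrow> bool list list \<Rightarrow> cpoly" where
  "nu N1 N2 M = (\<lambda>a b. (\<Prod>j<N1. a (col M j)) * (\<Prod>j\<in>{N1..<N1+N2}. b (col M j)))"

definition ccwe :: "nat \<Rightarrow> nat \<Rightarrow> nat \<Rightarrow> bool list set \<Rightarrow> cpoly" where
  "ccwe m N1 N2 C = (\<Sum>M\<in>{M. length M = m \<and> set M \<subseteq> C}. nu N1 N2 M)"

end

theory Submission
  imports Defs
begin

text \<open>
  Call a code good if it is linear, doubly-even and contains the all-ones word. Averaging over the
  diagonal matrices and over the affine permutation matrices of the Clifford group turns every
  monomial \<open>\<nu>\<^sub>M\<close> into 0 or into a multiple of the sum over an affine orbit, and these orbits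
  correspond to good codes; by inversion over subcodes, every invariant is a combination of
  \<open>ccwe(C)\<close> with \<open>C\<close> good. Following the Hadamard matrix by the same averages sends \<open>ccwe(C)\<close> to a
  multiple of itself plus terms \<open>ccwe(C')\<close> with \<open>C'\<close> good and strictly larger, and by
  \<open>|C| |C\<^sup>\<bottom>| = 2\<^sup>N\<close> the multiple is 1 only if \<open>C\<close> is self-dual. Since invariants are fixed, minimal
  non-self-dual codes can be eliminated one after another. Conversely, self-dual good codes give
  invariants by the MacWilliams identity. If \<open>m + 1 \<ge> N/2\<close>, some matrix \<open>M\<close> generates a given
  self-dual \<open>C\<close> together with the all-ones word, and then \<open>\<nu>\<^sub>M\<close> occurs in \<open>ccwe(D)\<close> only for codes
  \<open>D\<close> equivalent to \<open>C\<close>.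
\<close>

text \<open>The sign in \<open>beta\<close> comes from conjugation: a phase acts on a conjugate
  variable by its inverse. Diagonal matrices therefore see the rows of \<open>M\<close> only through
  \<open>wt\<close> modulo 4 and \<open>beta\<close> modulo 2. Affine maps act on the columns of
  \<open>M\<close> and so combine its rows, translations adding the all-ones word; this is why that
  word is built into good codes. The enumerators of good codes can be linearly dependent, so
  coefficients in an expansion of an invariant cannot be compared. Instead every step uses operators
  that are linear and fix each invariant (\<open>adm\<close>). A formula for such an operator
  \<open>T\<close> on generators turns into information on \<open>p\<close> through
  \<open>p = T p\<close>, and an eigenvalue different from 1 allows a generator to be solved away.
  For the operator built from the Hadamard matrix the eigenvalue at \<open>C\<close> is
  \<open>k (1 - t)\<close> with \<open>t >= 0\<close>, \<open>k >= 0\<close> and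
  \<open>k^2 = |C| / |C^perp|\<close>; the term \<open>t\<close> counts the one-step extensions of
  \<open>C\<close>, each of which gives back a negative multiple of the enumerator of
  \<open>C\<close>.\<close>

section \<open>Parities and binary words\<close>

definition par :: "'a set \<Rightarrow> ('a \<Rightarrow> bool) \<Rightarrow> bool" where
  "par K P \<longleftrightarrow> odd (card {k \<in> K. P k})"

lemma par_empty [simp]: "par {} P = False"
  by (simp add: par_def)

lemma par_insert [simp]:
  assumes "finite K" "k \<notin> K"
  shows "par (insert k K) P = (P k \<noteq> par K P)"
proof -
  have "{j \<in> insert k K. P j} = (if P k then insert k {j \<in> K. P j} else {j \<in> K. P j})"
    by auto
  then show ?thesis using assms by (simp add: par_def)
qed

lemma par_cong: "K = L \<Longrightarrow> (\<And>k. k \<in> L \<Longrightarrow> P k = Q k) \<Longrightarrow> par K P = par L Q"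
  unfolding par_def by (metis (mono_tags, lifting) Collect_cong)

lemma par_xor:
  assumes "finite K"
  shows "par K (\<lambda>k. P k \<noteq> Q k) = (par K P \<noteq> par K Q)"
  using assms by (induction K) auto

lemma par_False [simp]: "par K (\<lambda>k. False) = False"
  by (simp add: par_def)

lemma par_single:
  assumes "finite K" "k \<in> K"
  shows "par K (\<lambda>j. P j \<and> j = k) = P k"
proof -
  have "{j \<in> K. P j \<and> j = k} = (if P k then {k} else {})" using assms by auto
  then show ?thesis by (simp add: par_def)
qed

lemma par_Suc: "par {..<Suc n} P = (P 0 \<noteq> par {..<n} (\<lambda>k. P (Suc k)))"
proof -
  have "{k \<in> {..<Suc n}. P k} = (if P 0 then {0} else {}) \<union> Suc ` {k \<in> {..<n}. P (Suc k)}"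
    by (auto simp: image_iff less_Suc_eq_0_disj)
  moreover have "card ((if P 0 then {0} else {}) \<union> Suc ` {k \<in> {..<n}. P (Suc k)})
     = (if P 0 then 1 else 0) + card {k \<in> {..<n}. P (Suc k)}"
    by (subst card_Un_disjoint) (auto simp: card_image)
  ultimately show ?thesis by (simp add: par_def)
qed

text \<open>Odd factors are invisible modulo 2, so the signs in \<open>beta\<close> drop out of its
  parity.\<close>

lemma odd_sum_of_bool:
  fixes s :: "'a \<Rightarrow> int"
  assumes "finite K" "\<And>k. k \<in> K \<Longrightarrow> odd (s k)"
  shows "odd (\<Sum>k\<in>K. s k * of_bool (P k)) = par K P"
  using assms by (induction K) (auto simp del: sum_mult_of_bool_eq)

abbreviation zero_word :: "nat \<Rightarrow> bool list" where
  "zero_word n \<equiv> replicate n False"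

abbreviation one_word :: "nat \<Rightarrow> bool list" where
  "one_word n \<equiv> replicate n True"

lemma length_vadd [simp]: "length (vadd u v) = min (length u) (length v)"
  by (simp add: vadd_def)

lemma nth_vadd: "i < length u \<Longrightarrow> i < length v \<Longrightarrow> vadd u v ! i = (u ! i \<noteq> v ! i)"
  by (simp add: vadd_def)

lemma vadd_Cons [simp]: "vadd (x # u) (y # v) = (x \<noteq> y) # vadd u v"
  by (simp add: vadd_def)

interpretation vadd: abel_semigroup vadd
proof
  fix u v w :: "bool list"
  show "vadd (vadd u v) w = vadd u (vadd v w)"
    by (rule nth_equalityI) (auto simp: nth_vadd)
  show "vadd u v = vadd v u"
    by (rule nth_equalityI) (auto simp: nth_vadd)
qed

lemma vadd_self [simp]: "vadd u u = zero_word (length u)"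
  by (rule nth_equalityI) (auto simp: nth_vadd)

lemma vadd_zero [simp]: "length u = n \<Longrightarrow> vadd u (zero_word n) = u"
  by (rule nth_equalityI) (auto simp: nth_vadd)

lemma vadd_zero_left [simp]: "length u = n \<Longrightarrow> vadd (zero_word n) u = u"
  by (rule nth_equalityI) (auto simp: nth_vadd)

lemma vadd_cancel [simp]: "length u = length v \<Longrightarrow> vadd u (vadd u v) = v"
  by (simp flip: vadd.assoc)

lemma vadd_cancel_left [simp]:
  assumes "length u = length v" "length u = length w"
  shows "vadd u v = vadd u w \<longleftrightarrow> v = w"
  using assms by (metis vadd_cancel)

lemma vadd_eq_zero_iff:
  assumes "length u = n" "length v = n"
  shows "vadd u v = zero_word n \<longleftrightarrow> u = v"
  using assms by (metis vadd_cancel_left vadd_self)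

lemma in_F2vecs [simp]: "v \<in> F2vecs n \<longleftrightarrow> length v = n"
  by (simp add: F2vecs_def)

lemma finite_F2vecs [simp]: "finite (F2vecs n)"
  and card_F2vecs [simp]: "card (F2vecs n) = 2 ^ n"
  using card_lists_length_eq[of "UNIV :: bool set" n] finite_lists_length_eq[of "UNIV :: bool set" n]
  by (simp_all add: F2vecs_def)

lemma F2vecs_Suc: "F2vecs (Suc n) = case_prod Cons ` (UNIV \<times> F2vecs n)"
  by (auto simp: F2vecs_def length_Suc_conv image_iff)

lemma sum_F2vecs_Suc:
  "(\<Sum>v\<in>F2vecs (Suc n). f v) = (\<Sum>x\<in>UNIV. \<Sum>v\<in>F2vecs n. f (x # v))"
  unfolding F2vecs_Suc
  by (subst sum.reindex) (auto simp: inj_on_def sum.cartesian_product intro!: sum.cong)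

text \<open>Distributivity: choosing one summand in each of \<open>n\<close> factors is choosing a
  word of length \<open>n\<close>. For the Hadamard matrix this word becomes the new first
  row.\<close>

lemma prod_sum_bool:
  fixes g :: "nat \<Rightarrow> bool \<Rightarrow> 'a :: comm_semiring_1"
  shows "(\<Prod>j<n. \<Sum>x\<in>UNIV. g j x) = (\<Sum>c\<in>F2vecs n. \<Prod>j<n. g j (c ! j))"
proof (induction n arbitrary: g)
  case 0
  have "F2vecs 0 = {[]}" by (auto simp: F2vecs_def)
  then show ?case by simp
next
  case (Suc n)
  show ?case
    unfolding sum_F2vecs_Suc prod.lessThan_Suc_shift Suc
    by (simp add: sum_product)
qed

subsection \<open>Codes\<close>

context
  fixes N1 N2 :: nat
begin

text \<open>One signed sum over all coordinates is easier to manipulate than a difference over two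
  blocks.\<close>

definition sg :: "nat \<Rightarrow> int" where "sg j = (if j < N1 then 1 else - 1)"

lemma sum_split_N:
  fixes f :: "nat \<Rightarrow> int"
  shows "sum f {..<N1} - sum f {N1..<N1 + N2} = (\<Sum>j<(N1 + N2). sg j * f j)"
proof -
  have "{..<N1 + N2} = {..<N1} \<union> {N1..<N1 + N2}" by auto
  then have "(\<Sum>j<(N1 + N2). sg j * f j) = (\<Sum>j<N1. sg j * f j) + (\<Sum>j\<in>{N1..<N1 + N2}. sg j * f j)"
    by (simp only: sum.union_disjoint[OF finite_lessThan finite_atLeastLessThan ivl_disj_int_one(2)])
  also have "(\<Sum>j<N1. sg j * f j) = sum f {..<N1}" by (simp add: sg_def)
  also have "(\<Sum>j\<in>{N1..<N1 + N2}. sg j * f j) = - sum f {N1..<N1 + N2}"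
    by (simp add: sg_def flip: sum_negf)
  finally show ?thesis by simp
qed

lemma beta_alt: "beta N1 N2 x y = (\<Sum>j<(N1 + N2). sg j * of_bool (x ! j \<and> y ! j))"
  unfolding beta_def sum_split_N ..

lemma wt_eq_beta: "wt N1 N2 c = beta N1 N2 c c"
  by (simp add: wt_def beta_def)

lemma beta_commute: "beta N1 N2 x y = beta N1 N2 y x"
  by (simp add: beta_def conj_commute)

lemma odd_beta: "odd (beta N1 N2 x y) = par {..<N1 + N2} (\<lambda>j. x ! j \<and> y ! j)"
  unfolding beta_alt by (rule odd_sum_of_bool) (auto simp: sg_def)

lemma odd_beta_vadd:
  assumes "length u = N1 + N2" "length v = N1 + N2"
  shows "odd (beta N1 N2 (vadd u v) y) = (odd (beta N1 N2 u y) \<noteq> odd (beta N1 N2 v y))"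
proof -
  have "par {..<N1 + N2} (\<lambda>j. vadd u v ! j \<and> y ! j)
      = par {..<N1 + N2} (\<lambda>j. (u ! j \<and> y ! j) \<noteq> (v ! j \<and> y ! j))"
    using assms by (intro par_cong) (auto simp: nth_vadd)
  then show ?thesis unfolding odd_beta by (simp only: par_xor[OF finite_lessThan])
qed

text \<open>Entrywise \<open>x xor y = x + y - 2xy\<close>. Modulo 4 the cross term depends only on
  the parity of \<open>beta\<close>, which links double evenness to orthogonality.\<close>

lemma wt_vadd:
  assumes "length u = N1 + N2" "length v = N1 + N2"
  shows "wt N1 N2 (vadd u v) = wt N1 N2 u + wt N1 N2 v - 2 * beta N1 N2 u v"
  unfolding wt_eq_beta beta_alt sum_distrib_left sum.distrib[symmetric] sum_subtractf[symmetric]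
  using assms by (intro sum.cong) (auto simp: nth_vadd)

lemma beta_zero [simp]: "beta N1 N2 (zero_word (N1 + N2)) y = 0"
  unfolding beta_alt by simp

lemma beta_one: "length c = N1 + N2 \<Longrightarrow> beta N1 N2 c (one_word (N1 + N2)) = wt N1 N2 c"
  unfolding wt_eq_beta beta_alt by (auto intro!: sum.cong)

lemma dual_code_iff:
  "y \<in> dual_code N1 N2 C \<longleftrightarrow> length y = N1 + N2 \<and> (\<forall>c\<in>C. even (beta N1 N2 c y))"
  by (auto simp: dual_code_def even_iff_mod_2_eq_zero)

lemma is_codeD:
  assumes "is_code N1 N2 C"
  shows "c \<in> C \<Longrightarrow> length c = N1 + N2" "zero_word (N1 + N2) \<in> C" "u \<in> C \<Longrightarrow> v \<in> C \<Longrightarrow> vadd u v \<in> C"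
  using assms by (auto simp: is_code_def)

lemma is_code_finite: "is_code N1 N2 C \<Longrightarrow> finite C"
  by (auto simp: is_code_def intro: finite_subset[OF _ finite_F2vecs])

lemma is_code_dual:
  assumes "C \<subseteq> F2vecs (N1 + N2)"
  shows "is_code N1 N2 (dual_code N1 N2 C)"
  unfolding is_code_def
proof (intro conjI ballI)
  show "dual_code N1 N2 C \<subseteq> F2vecs (N1 + N2)" by (auto simp: dual_code_iff)
  show "zero_word (N1 + N2) \<in> dual_code N1 N2 C"
    by (simp add: dual_code_iff beta_commute[of _ "zero_word (N1 + N2)"])
  fix u v assume "u \<in> dual_code N1 N2 C" "v \<in> dual_code N1 N2 C"
  then show "vadd u v \<in> dual_code N1 N2 C"
    unfolding dual_code_iff by (metis beta_commute length_vadd min.idem odd_beta_vadd)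
qed

text \<open>The character of \<open>F_2^N\<close> attached to \<open>r\<close>, where
  \<open>N = N1 + N2\<close>; up to normalisation these are the entries of the \<open>N\<close>-th
  tensor power of the 2 x 2 Hadamard matrix.\<close>

definition chi :: "bool list \<Rightarrow> bool list \<Rightarrow> complex" where
  "chi c r = (if even (beta N1 N2 c r) then 1 else - 1)"

lemma chi_commute: "chi c r = chi r c"
  by (simp add: chi_def beta_commute)

lemma prod_sign: "finite K \<Longrightarrow> (\<Prod>k\<in>K. if P k then - 1 else 1 :: complex) = (if par K P then - 1 else 1)"
  by (induction K rule: finite_induct) auto

text \<open>Character orthogonality: if some \<open>d\<close> in \<open>C\<close> has odd product
  with \<open>r\<close>, translation by \<open>d\<close> permutes \<open>C\<close> and flips every
  sign, so the sum equals its negative.\<close>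

lemma sum_chi:
  assumes C: "is_code N1 N2 C" and r: "length r = N1 + N2"
  shows "(\<Sum>c\<in>C. chi c r) = (if r \<in> dual_code N1 N2 C then of_nat (card C) else 0)"
proof (cases "r \<in> dual_code N1 N2 C")
  case True
  then show ?thesis by (simp add: dual_code_iff chi_def)
next
  case False
  then obtain d where d: "d \<in> C" "odd (beta N1 N2 d r)" using r by (auto simp: dual_code_iff)
  have "(\<Sum>c\<in>C. chi c r) = (\<Sum>c\<in>C. chi (vadd d c) r)"
    by (rule sum.reindex_bij_witness[of _ "vadd d" "vadd d"]) (use C d in \<open>auto simp: is_codeD\<close>)
  also have "\<dots> = - (\<Sum>c\<in>C. chi c r)"
    unfolding sum_negf[symmetric]
    by (rule sum.cong) (use C d in \<open>auto simp: is_codeD chi_def odd_beta_vadd\<close>)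
  finally show ?thesis using False by simp
qed

lemma odd_beta_unit:
  assumes "length c = N1 + N2" "j < N1 + N2"
  shows "odd (beta N1 N2 c (map (\<lambda>k. k = j) [0..<N1 + N2])) = c ! j"
proof -
  have "par {..<N1 + N2} (\<lambda>k. c ! k \<and> map (\<lambda>k. k = j) [0..<N1 + N2] ! k) = par {..<N1 + N2} (\<lambda>k. c ! k \<and> k = j)"
    by (rule par_cong) auto
  then show ?thesis using assms by (simp add: odd_beta par_single)
qed

lemma dual_F2vecs: "dual_code N1 N2 (F2vecs (N1 + N2)) = {zero_word (N1 + N2)}"
proof (intro equalityI subsetI)
  fix y assume y: "y \<in> dual_code N1 N2 (F2vecs (N1 + N2))"
  have "\<not> y ! j" if "j < N1 + N2" for j
    using y odd_beta_unit[of y j] that by (auto simp: dual_code_iff beta_commute)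
  then show "y \<in> {zero_word (N1 + N2)}" using y by (auto simp: dual_code_iff intro!: nth_equalityI)
qed (auto simp: dual_code_iff beta_commute[of _ "zero_word (N1 + N2)"])

lemma is_code_F2vecs: "is_code N1 N2 (F2vecs (N1 + N2))"
  by (auto simp: is_code_def)

text \<open>Both sides evaluate the sum of \<open>chi c r\<close> over \<open>c\<close> in
  \<open>C\<close> and all words \<open>r\<close>: summing over \<open>c\<close> first leaves the
  dual code, summing over \<open>r\<close> first leaves only the zero word.\<close>

lemma card_dual_code:
  assumes C: "is_code N1 N2 C"
  shows "card C * card (dual_code N1 N2 C) = 2 ^ (N1 + N2)"
proof -
  have sub: "dual_code N1 N2 C \<subseteq> F2vecs (N1 + N2)" by (auto simp: dual_code_iff)
  have "(of_nat (card C * card (dual_code N1 N2 C)) :: complex)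
      = (\<Sum>r\<in>F2vecs (N1 + N2). if r \<in> dual_code N1 N2 C then of_nat (card C) else 0)"
    using sub by (simp add: Int_absorb1 flip: sum.inter_restrict)
  also have "\<dots> = (\<Sum>r\<in>F2vecs (N1 + N2). \<Sum>c\<in>C. chi c r)"
    by (rule sum.cong) (simp_all add: sum_chi[OF C])
  also have "\<dots> = (\<Sum>c\<in>C. \<Sum>r\<in>F2vecs (N1 + N2). chi r c)"
    by (subst sum.swap) (simp add: chi_commute)
  also have "\<dots> = (\<Sum>c\<in>C. if c = zero_word (N1 + N2) then 2 ^ (N1 + N2) else 0)"
    using C by (intro sum.cong) (auto simp: sum_chi[OF is_code_F2vecs] dual_F2vecs is_codeD)
  also have "\<dots> = of_nat (2 ^ (N1 + N2))"
    using C is_codeD(2)[OF C] by (simp add: is_code_finite)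
  finally show ?thesis by (simp only: of_nat_eq_iff)
qed

definition good_code :: "bool list set \<Rightarrow> bool" where
  "good_code C \<longleftrightarrow> is_code N1 N2 C \<and> one_word (N1 + N2) \<in> C \<and> doubly_even N1 N2 C"

lemma four_dvd_even: "(4::int) dvd x \<Longrightarrow> even x"
  by presburger

lemma four_dvd_polar: "(4::int) dvd x \<Longrightarrow> 4 dvd y \<Longrightarrow> 4 dvd (x + y - 2 * z) \<longleftrightarrow> even z"
  by presburger

text \<open>Polarisation: in \<open>wt_vadd\<close> all three weights are multiples of 4, so the
  cross term is one as well.\<close>

lemma doubly_even_self_orth:
  assumes "is_code N1 N2 C" "doubly_even N1 N2 C" "u \<in> C" "v \<in> C"
  shows "even (beta N1 N2 u v)"
proof -
  have "4 dvd wt N1 N2 u" "4 dvd wt N1 N2 v" "4 dvd wt N1 N2 (vadd u v)"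
    using assms by (auto simp: doubly_even_def is_codeD)
  moreover have "wt N1 N2 (vadd u v) = wt N1 N2 u + wt N1 N2 v - 2 * beta N1 N2 u v"
    using is_codeD(1)[OF assms(1)] assms(3,4) by (simp add: wt_vadd)
  ultimately show ?thesis by (simp add: four_dvd_polar)
qed

lemma good_code_sub_dual:
  assumes "good_code C"
  shows "C \<subseteq> dual_code N1 N2 C"
  using assms doubly_even_self_orth by (auto simp: good_code_def dual_code_iff is_codeD)

text \<open>Against the all-ones word \<open>beta\<close> is the weight, hence even on a doubly-even
  code. The all-ones word thus lies in the dual, which is the code itself.\<close>

lemma DESD_codes_iff: "C \<in> DESD_codes N1 N2 \<longleftrightarrow> good_code C \<and> C = dual_code N1 N2 C"
proof -
  have "one_word (N1 + N2) \<in> C" if "is_code N1 N2 C" "doubly_even N1 N2 C" "C = dual_code N1 N2 C"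
  proof -
    have "one_word (N1 + N2) \<in> dual_code N1 N2 C"
      unfolding dual_code_iff
    proof (intro conjI ballI)
      fix c assume "c \<in> C"
      then have "4 dvd wt N1 N2 c" "beta N1 N2 c (one_word (N1 + N2)) = wt N1 N2 c"
        using that(1,2) by (auto simp: beta_one is_codeD doubly_even_def)
      then show "even (beta N1 N2 c (one_word (N1 + N2)))" by (simp add: four_dvd_even)
    qed simp
    then show ?thesis using that(3) by simp
  qed
  then show ?thesis by (auto simp: DESD_codes_def good_code_def self_dual_def)
qed

text \<open>For a code \<open>C\<close> this is the code generated by \<open>C\<close> and
  \<open>x\<close>, written as its at most two cosets of \<open>C\<close>.\<close>

definition adjoin :: "bool list set \<Rightarrow> bool list \<Rightarrow> bool list set" where
  "adjoin C x = C \<union> vadd x ` C"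

lemma vadd_shift:
  assumes "length c = length x" "length d = length x"
  shows "vadd c (vadd x d) = vadd x (vadd c d)" "vadd (vadd x c) (vadd x d) = vadd c d"
proof -
  show "vadd c (vadd x d) = vadd x (vadd c d)" by (simp add: ac_simps)
  have "vadd (vadd x c) (vadd x d) = vadd c (vadd x (vadd x d))" by (simp only: ac_simps)
  then show "vadd (vadd x c) (vadd x d) = vadd c d" using assms by simp
qed

lemma is_code_adjoin:
  assumes C: "is_code N1 N2 C" and x: "length x = N1 + N2"
  shows "is_code N1 N2 (adjoin C x)"
  unfolding is_code_def
proof (intro conjI ballI)
  show "adjoin C x \<subseteq> F2vecs (N1 + N2)" using C x by (auto simp: adjoin_def is_codeD)
  show "zero_word (N1 + N2) \<in> adjoin C x" using C by (simp add: adjoin_def is_codeD)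
  fix u v assume uv: "u \<in> adjoin C x" "v \<in> adjoin C x"
  show "vadd u v \<in> adjoin C x"
    using uv x unfolding adjoin_def
    by (auto simp: is_codeD[OF C] vadd_shift[of _ x] vadd.assoc[of x])
qed

text \<open>Orthogonality of \<open>x\<close> to \<open>C\<close> makes the cross term in
  \<open>wt_vadd\<close> a multiple of 4, so both summands pass their divisibility on to the new
  coset.\<close>

lemma adjoin_good:
  assumes C: "good_code C" and x: "x \<in> dual_code N1 N2 C" "4 dvd wt N1 N2 x"
  shows "good_code (adjoin C x)"
proof -
  have c: "is_code N1 N2 C" and lx: "length x = N1 + N2" using C x by (auto simp: good_code_def dual_code_iff)
  have "4 dvd wt N1 N2 (vadd x c)" if "c \<in> C" for c
  proof -
    have "even (beta N1 N2 x c)" using x that by (auto simp: dual_code_iff beta_commute)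
    moreover have "4 dvd wt N1 N2 c" using C that by (auto simp: good_code_def doubly_even_def)
    ultimately show ?thesis using wt_vadd[OF lx is_codeD(1)[OF c that]] x(2) by (simp add: four_dvd_polar)
  qed
  then show ?thesis using is_code_adjoin[OF c lx] C
    by (auto simp: good_code_def doubly_even_def adjoin_def)
qed

lemma vadd_in_code_iff:
  assumes "is_code N1 N2 C" "c \<in> C" "length x = N1 + N2"
  shows "vadd c x \<in> C \<longleftrightarrow> x \<in> C" "vadd x c \<in> C \<longleftrightarrow> x \<in> C"
  using assms by (metis is_codeD(1,3) vadd_cancel vadd.commute)+

lemma card_adjoin:
  assumes C: "is_code N1 N2 C" and x: "length x = N1 + N2" "x \<notin> C"
  shows "card (adjoin C x) = 2 * card C"
proof -
  have "card (vadd x ` C) = card C"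
    using x is_codeD(1)[OF C] by (intro card_image) (auto simp: inj_on_def)
  moreover have "C \<inter> vadd x ` C = {}" using vadd_in_code_iff[OF C] x by auto
  ultimately show ?thesis using is_code_finite[OF C] by (simp add: adjoin_def card_Un_disjoint)
qed

text \<open>Not lying in \<open>C\<close> is the linear functional on \<open>adjoin C x\<close> with
  kernel \<open>C\<close>; it identifies the quotient with \<open>F_2\<close>.
  \<open>comb_notin_code\<close> extends this to longer sums.\<close>

lemma adjoin_xor:
  assumes C: "is_code N1 N2 C" and x: "length x = N1 + N2" "x \<notin> C"
    and uv: "u \<in> adjoin C x" "v \<in> adjoin C x"
  shows "vadd u v \<notin> C \<longleftrightarrow> (u \<notin> C) \<noteq> (v \<notin> C)"
proof -
  obtain c d where cd: "c \<in> C" "d \<in> C" "u = c \<or> u = vadd x c" "v = d \<or> v = vadd x d"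
    using uv by (auto simp: adjoin_def)
  have lens: "length c = length x" "length d = length x" using cd x is_codeD(1)[OF C] by auto
  have "vadd c d \<in> C" using cd C by (simp add: is_codeD)
  then show ?thesis
    using cd(3,4) cd(1,2) x lens
    by (elim disjE)
       (simp_all add: vadd_in_code_iff[OF C] vadd_shift[where x = x] vadd.assoc[of x])
qed

text \<open>The sum over \<open>F_2\<close> of the words \<open>w k\<close>, \<open>k\<close> in
  \<open>K\<close>; the rows of a linearly transformed matrix take this form.\<close>

definition comb :: "nat set \<Rightarrow> (nat \<Rightarrow> bool list) \<Rightarrow> bool list" where
  "comb K w = map (\<lambda>j. par K (\<lambda>k. w k ! j)) [0..<N1 + N2]"

lemma comb_empty: "comb {} w = zero_word (N1 + N2)"
  by (simp add: comb_def map_replicate_const)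

lemma comb_insert:
  assumes "finite K" "k \<notin> K" "length (w k) = N1 + N2"
  shows "comb (insert k K) w = vadd (w k) (comb K w)"
  by (rule nth_equalityI) (use assms in \<open>auto simp: comb_def nth_vadd\<close>)

lemma comb_in_code:
  assumes "is_code N1 N2 C" "finite K" "\<And>k. k \<in> K \<Longrightarrow> w k \<in> C"
  shows "comb K w \<in> C"
  using assms(2,3)
  by (induction K) (use assms(1) in \<open>auto simp: comb_empty comb_insert is_codeD\<close>)

lemma comb_notin_code:
  assumes C: "is_code N1 N2 C" and x: "length x = N1 + N2" "x \<notin> C"
    and K: "finite K" "\<And>k. k \<in> K \<Longrightarrow> w k \<in> adjoin C x"
  shows "comb K w \<notin> C \<longleftrightarrow> par K (\<lambda>k. w k \<notin> C)"
  using K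
proof (induction K)
  case (insert k K)
  then have "comb K w \<in> adjoin C x" "length (w k) = N1 + N2"
    using comb_in_code[OF is_code_adjoin[OF C x(1)]] is_codeD(1)[OF is_code_adjoin[OF C x(1)]] by auto
  then show ?case using insert by (simp add: comb_insert adjoin_xor[OF C x])
qed (use C in \<open>simp add: comb_empty is_codeD\<close>)

end

section \<open>Affine maps of \<open>F_2^m\<close>\<close>

lemma par_Collect: "par {k. k < n \<and> Q k} P = par {..<n} (\<lambda>k. Q k \<and> P k)"
proof -
  have "{k \<in> {k. k < n \<and> Q k}. P k} = {k \<in> {..<n}. Q k \<and> P k}" by auto
  then show ?thesis by (simp add: par_def)
qed

lemma nth_f2matvec: "i < m \<Longrightarrow> f2matvec m A v ! i = par {..<m} (\<lambda>k. A i k \<and> v ! k)"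
proof -
  have "{j. j < m \<and> A i j \<and> v ! j} = {k \<in> {..<m}. A i k \<and> v ! k}" by auto
  then show "i < m \<Longrightarrow> ?thesis" by (simp add: f2matvec_def par_def)
qed

lemma length_f2matvec [simp]: "length (f2matvec m A v) = m"
  by (simp add: f2matvec_def)

lemma f2matvec_vadd:
  assumes "length u = m" "length v = m"
  shows "f2matvec m A (vadd u v) = vadd (f2matvec m A u) (f2matvec m A v)"
proof (rule nth_equalityI)
  fix i assume "i < length (f2matvec m A (vadd u v))"
  then have i: "i < m" by simp
  have "par {..<m} (\<lambda>k. A i k \<and> vadd u v ! k) = par {..<m} (\<lambda>k. (A i k \<and> u ! k) \<noteq> (A i k \<and> v ! k))"
    using assms by (intro par_cong) (auto simp: nth_vadd)
  then show "f2matvec m A (vadd u v) ! i = vadd (f2matvec m A u) (f2matvec m A v) ! i"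
    unfolding par_xor[OF finite_lessThan] using i by (simp add: nth_f2matvec nth_vadd)
qed simp

text \<open>Induction on the number of coordinates: on words starting with \<open>False\<close> the
  induction hypothesis applies, and the first coordinate contributes one more coefficient.\<close>

lemma affine_functional:
  assumes "\<And>x y z. length x = m \<Longrightarrow> length y = m \<Longrightarrow> length z = m \<Longrightarrow>
    l (vadd x (vadd y z)) = (l x \<noteq> (l y \<noteq> l z))"
  shows "\<exists>a e. \<forall>x. length x = m \<longrightarrow> l x = (par {..<m} (\<lambda>k. a k \<and> x ! k) \<noteq> e)"
  using assms
proof (induction m arbitrary: l)
  case 0
  then show ?case by auto
next
  case (Suc m)
  have aff: "l (False # vadd x (vadd y z)) = (l (False # x) \<noteq> (l (False # y) \<noteq> l (False # z)))"
    if "length x = m" "length y = m" "length z = m" for x y z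
    using Suc.prems[of "False # x" "False # y" "False # z"] that by simp
  obtain a e where ae: "\<And>x. length x = m \<Longrightarrow> l (False # x) = (par {..<m} (\<lambda>k. a k \<and> x ! k) \<noteq> e)"
    using Suc.IH[of "\<lambda>x. l (False # x)", OF aff] by blast
  \<comment> \<open>The new coefficient is the change of \<open>l\<close> along the first unit
    vector, measured at 0; the three-term identity gives the same change at every
    \<open>t\<close>.\<close>
  define a' where "a' k = (case k of 0 \<Rightarrow> l (True # zero_word m) \<noteq> l (False # zero_word m) | Suc k \<Rightarrow> a k)" for k
  have "l x = (par {..<Suc m} (\<lambda>k. a' k \<and> x ! k) \<noteq> e)" if lx: "length x = Suc m" for x
  proof -
    obtain b t where x: "x = b # t" "length t = m" using lx by (cases x) simp_all
    have "l (True # t) = (l (False # t) \<noteq> (l (True # zero_word m) \<noteq> l (False # zero_word m)))"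
      using Suc.prems[of "False # t" "True # zero_word m" "False # zero_word m"] x by simp
    then show ?thesis
      using ae[OF x(2)] by (cases b; simp add: par_Suc x(1) a'_def) argo+
  qed
  then show ?case by blast
qed

lemma vadd4:
  "vadd (vadd a b) (vadd (vadd c d) (vadd e g)) = vadd (vadd a (vadd c e)) (vadd b (vadd d g))"
  by (simp only: vadd.left_commute vadd.assoc vadd.commute)

lemma length_col [simp]: "length (col M j) = length M"
  by (simp add: col_def)

lemma nth_col [simp]: "i < length M \<Longrightarrow> col M j ! i = M ! i ! j"
  by (simp add: col_def)

definition additive_on :: "nat \<Rightarrow> (bool list \<Rightarrow> bool list) \<Rightarrow> bool" where
  "additive_on m f \<longleftrightarrow> (\<forall>x\<in>F2vecs m. \<forall>y\<in>F2vecs m. f (vadd x y) = vadd (f x) (f y))"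

text \<open>Preserving sums of three vectors characterises affine maps over \<open>F_2\<close>
  without naming a linear part or an origin. Taking permutations of the whole type lets
  \<open>inv\<close> and composition serve as group operations.\<close>

definition affine_perms :: "nat \<Rightarrow> (bool list \<Rightarrow> bool list) set" where
  "affine_perms m = {f. f permutes F2vecs m \<and> (\<forall>x\<in>F2vecs m. \<forall>y\<in>F2vecs m. \<forall>z\<in>F2vecs m.
     f (vadd x (vadd y z)) = vadd (f x) (vadd (f y) (f z)))}"

lemma bij_betw_F2vecs:
  assumes "inj_on f (F2vecs m)" "\<And>x. length x = m \<Longrightarrow> length (f x) = m"
  shows "bij_betw f (F2vecs m) (F2vecs m)"
proof -
  have "f ` F2vecs m \<subseteq> F2vecs m" using assms(2) by auto
  then show ?thesis using assms(1) endo_inj_surj[OF finite_F2vecs] by (metis bij_betw_def)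
qed

lemma affine_permsD:
  assumes "f \<in> affine_perms m"
  shows "f permutes F2vecs m" "length x = m \<Longrightarrow> length (f x) = m"
    "length x = m \<Longrightarrow> length y = m \<Longrightarrow> length z = m \<Longrightarrow>
      f (vadd x (vadd y z)) = vadd (f x) (vadd (f y) (f z))"
  using assms permutes_in_image[of f "F2vecs m"] by (auto simp: affine_perms_def)

lemma finite_affine_perms: "finite (affine_perms m)"
  by (rule finite_subset[OF _ finite_permutations[OF finite_F2vecs, of m]]) (auto simp: affine_perms_def)

lemma id_affine: "id \<in> affine_perms m"
  by (simp add: affine_perms_def permutes_id)

lemma comp_affine:
  assumes "f \<in> affine_perms m" "g \<in> affine_perms m"
  shows "f \<circ> g \<in> affine_perms m"
  using assms permutes_compose[of g "F2vecs m" f]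
  by (auto simp: affine_perms_def permutes_in_image affine_permsD(2))

lemma inv_affine:
  assumes f: "f \<in> affine_perms m"
  shows "inv f \<in> affine_perms m"
proof -
  note p = affine_permsD(1)[OF f]
  note pinv = permutes_inv[OF p]
  have "inv f (vadd x (vadd y z)) = vadd (inv f x) (vadd (inv f y) (inv f z))"
    if "length x = m" "length y = m" "length z = m" for x y z
  proof -
    have l: "length (inv f x) = m" "length (inv f y) = m" "length (inv f z) = m"
      using permutes_in_image[OF pinv] that by auto
    have "f (vadd (inv f x) (vadd (inv f y) (inv f z))) = vadd x (vadd y z)"
      using affine_permsD(3)[OF f l] by (simp add: permutes_inverses(1)[OF p])
    then show ?thesis by (metis permutes_inverses(2)[OF p])
  qed
  then show ?thesis using pinv by (auto simp: affine_perms_def)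
qed

lemma additive_affine:
  assumes "f permutes F2vecs m" "additive_on m f"
  shows "f \<in> affine_perms m"
  using assms by (auto simp: affine_perms_def additive_on_def)

text \<open>The three copies of \<open>c\<close> add up to a single one, so the three-term identity
  survives a translation.\<close>

lemma translate_affine:
  assumes f: "f \<in> affine_perms m" and c: "length c = m"
  shows "(\<lambda>x. if x \<in> F2vecs m then vadd (f x) c else x) \<in> affine_perms m" (is "?g \<in> _")
proof -
  note p = affine_permsD(1)[OF f]
  have inj: "inj_on ?g (F2vecs m)"
  proof (rule inj_onI)
    fix x y assume xy: "x \<in> F2vecs m" "y \<in> F2vecs m" "?g x = ?g y"
    then have "vadd c (f x) = vadd c (f y)" by (simp add: vadd.commute)
    moreover have "length (f x) = m" "length (f y) = m"
      using xy affine_permsD(2)[OF f] by auto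
    ultimately have "f x = f y" using c by simp
    then show "x = y" using permutes_inj[OF p] by (simp add: inj_def)
  qed
  have "bij_betw ?g (F2vecs m) (F2vecs m)"
    by (rule bij_betw_F2vecs[OF inj]) (use c affine_permsD(2)[OF f] in auto)
  then have "?g permutes F2vecs m" by (rule bij_imp_permutes) auto
  moreover have "vadd (f (vadd x (vadd y z))) c = vadd (vadd (f x) c) (vadd (vadd (f y) c) (vadd (f z) c))"
    if "length x = m" "length y = m" "length z = m" for x y z
  proof -
    have "vadd (vadd (f x) c) (vadd (vadd (f y) c) (vadd (f z) c))
      = vadd (vadd (f x) (vadd (f y) (f z))) (vadd c (vadd c c))"
      by (rule vadd4)
    then show ?thesis using that c affine_permsD(3)[OF f, of x y z] by simp
  qed
  ultimately show ?thesis by (auto simp: affine_perms_def)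
qed

text \<open>Every coordinate of \<open>f\<close> is an affine functional; its coefficients form a
  row of \<open>A\<close>, its constant an entry of \<open>v'\<close>. The linear part inherits
  injectivity from \<open>f\<close>, and finiteness makes it bijective.\<close>

lemma affine_perm_matrix:
  assumes f: "f \<in> affine_perms m"
  obtains A v' where "A \<in> GL2 m" "length v' = m"
    "\<And>v. length v = m \<Longrightarrow> f v = vadd (f2matvec m A v) v'"
proof -
  note p = affine_permsD(1)[OF f]
  have "\<exists>a e. \<forall>x. length x = m \<longrightarrow> f x ! i = (par {..<m} (\<lambda>k. a k \<and> x ! k) \<noteq> e)" if "i < m" for i
  proof (rule affine_functional)
    fix x y z :: "bool list" assume l: "length x = m" "length y = m" "length z = m"
    then have "length (f x) = m" "length (f y) = m" "length (f z) = m"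
      using affine_permsD(2)[OF f] by auto
    then show "f (vadd x (vadd y z)) ! i = (f x ! i \<noteq> (f y ! i \<noteq> f z ! i))"
      unfolding affine_permsD(3)[OF f l] using that by (simp add: nth_vadd)
  qed
  then obtain A e where Ae: "\<And>i x. i < m \<Longrightarrow> length x = m \<Longrightarrow>
      f x ! i = (par {..<m} (\<lambda>k. A i k \<and> x ! k) \<noteq> e i)"
    by metis
  define v' where "v' = map e [0..<m]"
  have v': "length v' = m" by (simp add: v'_def)
  have fv: "f v = vadd (f2matvec m A v) v'" if "length v = m" for v
    by (rule nth_equalityI)
      (use that affine_permsD(2)[OF f] in \<open>auto simp: v'_def nth_vadd nth_f2matvec Ae\<close>)
  have fA: "f2matvec m A v = vadd v' (f v)" if "length v = m" for v
    using that v' by (simp add: fv vadd.commute)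
  have "inj_on (f2matvec m A) (F2vecs m)"
  proof (rule inj_onI)
    fix x y assume "x \<in> F2vecs m" "y \<in> F2vecs m" "f2matvec m A x = f2matvec m A y"
    then have "f x = f y" by (simp add: fv)
    then show "x = y" using permutes_inj[OF p] by (simp add: inj_def)
  qed
  then have "A \<in> GL2 m"
    unfolding GL2_def by (simp add: bij_betw_F2vecs)
  then show ?thesis using that v' fv by blast
qed

lemma GL2_affine_perm:
  assumes A: "A \<in> GL2 m" and v': "length v' = m"
  obtains f where "f \<in> affine_perms m" "\<And>v. length v = m \<Longrightarrow> f v = vadd (f2matvec m A v) v'"
proof -
  define g where "g x = (if x \<in> F2vecs m then f2matvec m A x else x)" for x
  have "bij_betw g (F2vecs m) (F2vecs m)"
    using A bij_betw_cong[of "F2vecs m" g "f2matvec m A" "F2vecs m"]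
    by (simp add: GL2_def g_def)
  then have "g permutes F2vecs m" by (rule bij_imp_permutes) (auto simp: g_def)
  then have "g \<in> affine_perms m"
    by (rule additive_affine) (auto simp: additive_on_def g_def f2matvec_vadd)
  from translate_affine[OF this v'] show ?thesis
    by (rule that) (auto simp: g_def)
qed

subsection \<open>Extending partial linear isomorphisms\<close>

text \<open>The graph of a linear isomorphism between two subspaces. For a set of pairs closed under
  sums, the last condition says at once that the relation is single-valued and injective.\<close>

definition partial_iso :: "nat \<Rightarrow> (bool list \<times> bool list) set \<Rightarrow> bool" where
  "partial_iso m G \<longleftrightarrow> G \<subseteq> F2vecs m \<times> F2vecs m \<and> (zero_word m, zero_word m) \<in> G
     \<and> (\<forall>(x, y)\<in>G. \<forall>(u, w)\<in>G. (vadd x u, vadd y w) \<in> G)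
     \<and> (\<forall>(x, y)\<in>G. x = zero_word m \<longleftrightarrow> y = zero_word m)"

lemma partial_isoD:
  assumes "partial_iso m G" "(x, y) \<in> G"
  shows "length x = m" "length y = m" "x = zero_word m \<longleftrightarrow> y = zero_word m"
    "(u, w) \<in> G \<Longrightarrow> (vadd x u, vadd y w) \<in> G"
proof -
  have "(x, y) \<in> F2vecs m \<times> F2vecs m" using assms unfolding partial_iso_def by blast
  then show "length x = m" "length y = m" by auto
qed (use assms in \<open>unfold partial_iso_def, blast+\<close>)

lemma partial_iso_eq_iff:
  assumes G: "partial_iso m G" and xy: "(x, y) \<in> G" "(u, w) \<in> G"
  shows "x = u \<longleftrightarrow> y = w"
  using partial_isoD(3)[OF G partial_isoD(4)[OF G xy]] partial_isoD(1,2)[OF G xy(1)]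
    partial_isoD(1,2)[OF G xy(2)] by (simp add: vadd_eq_zero_iff)

text \<open>A coset is added to the graph. A pair in this coset with a zero component would put
  \<open>x\<close> among the arguments or \<open>y\<close> among the values of
  \<open>G\<close>.\<close>

lemma partial_iso_extend_one:
  assumes G: "partial_iso m G" and x: "length x = m" "x \<notin> fst ` G" and y: "length y = m" "y \<notin> snd ` G"
  shows "partial_iso m (G \<union> (\<lambda>(u, w). (vadd x u, vadd y w)) ` G)" (is "partial_iso m ?H")
proof -
  \<comment> \<open>Translation by \<open>(x, y)\<close> is an involution, so membership in the new
    coset is tested by translating back.\<close>
  have mem: "(u, w) \<in> ?H \<longleftrightarrow> (u, w) \<in> G \<or> (vadd x u, vadd y w) \<in> G"
    if "length u = m" "length w = m" for u w
  proof
    assume "(u, w) \<in> ?H"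
    then show "(u, w) \<in> G \<or> (vadd x u, vadd y w) \<in> G"
      using x y partial_isoD(1,2)[OF G] by auto
  next
    assume "(u, w) \<in> G \<or> (vadd x u, vadd y w) \<in> G"
    then show "(u, w) \<in> ?H"
    proof
      assume "(vadd x u, vadd y w) \<in> G"
      then have "(vadd x (vadd x u), vadd y (vadd y w)) \<in> (\<lambda>(u, w). (vadd x u, vadd y w)) ` G"
        by (rule rev_image_eqI) simp
      then show ?thesis using that x y by simp
    qed simp
  qed
  have sub: "?H \<subseteq> F2vecs m \<times> F2vecs m" using x y partial_isoD(1,2)[OF G] by auto
  show ?thesis
    unfolding partial_iso_def
  proof (intro conjI sub)
    show "(zero_word m, zero_word m) \<in> ?H" using G by (auto simp: partial_iso_def)
    have "(vadd u u', vadd w w') \<in> ?H" if 1: "(u, w) \<in> ?H" and 2: "(u', w') \<in> ?H" for u w u' w'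
    proof -
      have l: "length u = m" "length w = m" "length u' = m" "length w' = m"
        using 1 2 sub by auto
      have "vadd (vadd x u) (vadd x u') = vadd u u'" "vadd (vadd y w) (vadd y w') = vadd w w'"
        using l x y by (simp_all add: vadd_shift(2))
      moreover have "vadd u (vadd x u') = vadd x (vadd u u')" "vadd w (vadd y w') = vadd y (vadd w w')"
        by (simp_all only: ac_simps)
      moreover have "vadd (vadd x u) u' = vadd x (vadd u u')" "vadd (vadd y w) w' = vadd y (vadd w w')"
        by (simp_all only: ac_simps)
      ultimately have "(vadd u u', vadd w w') \<in> G \<or> (vadd x (vadd u u'), vadd y (vadd w w')) \<in> G"
        using 1[unfolded mem[OF l(1,2)]] 2[unfolded mem[OF l(3,4)]] partial_isoD(4)[OF G] by metis
      then show "(vadd u u', vadd w w') \<in> ?H" using l by (subst mem) auto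
    qed
    then show "\<forall>(u, w)\<in>?H. \<forall>(u', w')\<in>?H. (vadd u u', vadd w w') \<in> ?H" by blast
    have "u = zero_word m \<longleftrightarrow> w = zero_word m" if 1: "(u, w) \<in> ?H" for u w
    proof -
      have l: "length u = m" "length w = m" using 1 sub by auto
      show "u = zero_word m \<longleftrightarrow> w = zero_word m"
        using 1[unfolded mem[OF l]]
      proof
        assume "(vadd x u, vadd y w) \<in> G"
        then have "vadd x u \<in> fst ` G" "vadd y w \<in> snd ` G" by force+
        then have "u \<noteq> zero_word m" "w \<noteq> zero_word m" using x y by (metis vadd_zero)+
        then show ?thesis by simp
      qed (use partial_isoD(3)[OF G] in auto)
    qed
    then show "\<forall>(u, w)\<in>?H. u = zero_word m \<longleftrightarrow> w = zero_word m" by blast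
  qed
qed

text \<open>A maximal extension has equally many missing arguments and missing values, so it is total:
  otherwise one more pair could be added.\<close>

lemma partial_iso_extend:
  assumes G0: "partial_iso m G0"
  obtains f where "f permutes F2vecs m" "additive_on m f" "\<And>x y. (x, y) \<in> G0 \<Longrightarrow> f x = y"
proof -
  let ?S = "{G. partial_iso m G}"
  have "finite ?S"
    by (rule finite_subset[of _ "Pow (F2vecs m \<times> F2vecs m)"]) (auto simp: partial_iso_def)
  then obtain G where G: "partial_iso m G" "G0 \<subseteq> G" and max: "\<And>H. partial_iso m H \<Longrightarrow> G \<subseteq> H \<Longrightarrow> G = H"
    using finite_has_maximal2[of ?S G0] G0 by auto
  have sub: "G \<subseteq> F2vecs m \<times> F2vecs m" using G(1) by (simp add: partial_iso_def)
  note eq = partial_iso_eq_iff[OF G(1)]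
  have inj: "inj_on fst G" "inj_on snd G" using eq by (auto simp: inj_on_def)
  have fs: "fst ` G \<subseteq> F2vecs m" "snd ` G \<subseteq> F2vecs m" using sub by auto
  have card: "card (fst ` G) = card (snd ` G)" using inj by (simp add: card_image)
  have full: "fst ` G = F2vecs m"
  proof (rule ccontr)
    assume ne: "fst ` G \<noteq> F2vecs m"
    then have "card (fst ` G) < card (F2vecs m)" using fs by (intro psubset_card_mono) auto
    then have "snd ` G \<noteq> F2vecs m" using card by auto
    then obtain x y where xy: "length x = m" "x \<notin> fst ` G" "length y = m" "y \<notin> snd ` G"
      using ne fs unfolding in_F2vecs[symmetric] by blast
    have "(vadd x (zero_word m), vadd y (zero_word m)) \<in> (\<lambda>(u, w). (vadd x u, vadd y w)) ` G"
      by (rule rev_image_eqI[of "(zero_word m, zero_word m)"]) (use G(1) in \<open>auto simp: partial_iso_def\<close>)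
    then have "(vadd x (zero_word m), vadd y (zero_word m)) \<in> G"
      using max[OF partial_iso_extend_one[OF G(1) xy]] by blast
    then show False using xy by force
  qed
  define f where "f x = (if x \<in> F2vecs m then THE y. (x, y) \<in> G else x)" for x
  have fx: "f x = y" if "(x, y) \<in> G" for x y
  proof -
    have "(THE y. (x, y) \<in> G) = y" using that eq by blast
    then show ?thesis using that sub by (auto simp: f_def)
  qed
  have fG: "(x, f x) \<in> G" if x: "length x = m" for x
  proof -
    have "x \<in> fst ` G" using x full by simp
    then show ?thesis using fx by auto
  qed
  have "inj_on f (F2vecs m)"
  proof (rule inj_onI)
    fix x y assume "x \<in> F2vecs m" "y \<in> F2vecs m" "f x = f y"
    then show "x = y" using eq[OF fG fG, of x y] by simp
  qed
  moreover have "length (f x) = m" if "length x = m" for x using fG[OF that] sub by auto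
  ultimately have "bij_betw f (F2vecs m) (F2vecs m)" by (rule bij_betw_F2vecs)
  then have perm: "f permutes F2vecs m" by (rule bij_imp_permutes) (auto simp: f_def)
  have "additive_on m f"
    using fG partial_isoD(4)[OF G(1)] fx by (auto simp: additive_on_def)
  then show ?thesis using that perm fx G(2) by blast
qed

subsection \<open>Matrices and the affine group\<close>

context
  fixes m N1 N2 :: nat
begin

definition mats :: "bool list list set" where
  "mats = {M. length M = m \<and> set M \<subseteq> F2vecs (N1 + N2)}"

lemma finite_mats: "finite mats"
  unfolding mats_def using finite_lists_length_eq[of "F2vecs (N1 + N2)" m] by (simp add: conj_commute)

lemma matsD: "M \<in> mats \<Longrightarrow> length M = m" "M \<in> mats \<Longrightarrow> i < m \<Longrightarrow> length (M ! i) = N1 + N2"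
  using nth_mem by (fastforce simp: mats_def)+

lemma mats_eqI:
  assumes M: "M \<in> mats" "M' \<in> mats" and eq: "\<And>j. j < N1 + N2 \<Longrightarrow> col M j = col M' j"
  shows "M = M'"
proof (rule nth_equalityI)
  fix i assume "i < length M"
  then have i: "i < m" using M matsD by simp
  show "M ! i = M' ! i"
  proof (rule nth_equalityI)
    fix j assume "j < length (M ! i)"
    then have "col M j ! i = col M' j ! i" using eq M i matsD by simp
    then show "M ! i ! j = M' ! i ! j" using M i matsD by simp
  qed (use M i matsD in auto)
qed (use M matsD in auto)

text \<open>The action of a map on columns, stored again as a list of rows because codes speak about
  rows.\<close>

definition colmap :: "(bool list \<Rightarrow> bool list) \<Rightarrow> bool list list \<Rightarrow> bool list list" where
  "colmap f M = map (\<lambda>i. map (\<lambda>j. f (col M j) ! i) [0..<N1 + N2]) [0..<m]"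

lemma colmap_mats: "colmap f M \<in> mats"
  by (auto simp: colmap_def mats_def)

lemma col_colmap:
  assumes "length (f (col M j)) = m" "j < N1 + N2"
  shows "col (colmap f M) j = f (col M j)"
  by (rule nth_equalityI) (use assms in \<open>auto simp: colmap_def\<close>)

lemma colmap_comp:
  assumes "M \<in> mats" "f \<in> affine_perms m" "g \<in> affine_perms m"
  shows "colmap g (colmap f M) = colmap (g \<circ> f) M"
  by (rule mats_eqI)
    (use assms matsD in \<open>auto simp: colmap_mats col_colmap affine_permsD comp_affine\<close>)

lemma colmap_id: "M \<in> mats \<Longrightarrow> colmap id M = M"
  by (rule mats_eqI) (auto simp: colmap_mats col_colmap matsD)

lemma colmap_inv:
  assumes "M \<in> mats" "f \<in> affine_perms m"
  shows "colmap (inv f) (colmap f M) = M" "colmap f (colmap (inv f) M) = M"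
  using assms affine_permsD(1)[OF assms(2)]
  by (simp_all add: colmap_comp inv_affine permutes_inv_o colmap_id)

text \<open>The linear part mixes rows, and a translation entry is added in every column alike,
  hence the all-ones word. This is the bridge from affine maps on columns to codes.\<close>

lemma row_colmap:
  assumes M: "M \<in> mats" and i: "i < m"
    and f: "\<And>v. length v = m \<Longrightarrow> f v = vadd (f2matvec m A v) v'" and v': "length v' = m"
  shows "colmap f M ! i = vadd (comb N1 N2 {k. k < m \<and> A i k} ((!) M)) (if v' ! i then one_word (N1 + N2) else zero_word (N1 + N2))"
proof (rule nth_equalityI)
  fix j assume "j < length (colmap f M ! i)"
  then have j: "j < N1 + N2" using i by (simp add: colmap_def)
  have "par {..<m} (\<lambda>k. A i k \<and> col M j ! k) = par {..<m} (\<lambda>k. A i k \<and> M ! k ! j)"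
    using M matsD by (intro par_cong) auto
  then show "colmap f M ! i ! j
    = vadd (comb N1 N2 {k. k < m \<and> A i k} ((!) M)) (if v' ! i then one_word (N1 + N2) else zero_word (N1 + N2)) ! j"
    using i j f[of "col M j"] matsD[OF M] v'
    by (simp add: colmap_def comb_def nth_vadd nth_f2matvec par_Collect)
qed (use i in \<open>simp add: colmap_def comb_def\<close>)

lemma colmap_rows_in_code:
  assumes M: "M \<in> mats" "set M \<subseteq> C" and C: "is_code N1 N2 C" "one_word (N1 + N2) \<in> C"
    and f: "f \<in> affine_perms m"
  shows "set (colmap f M) \<subseteq> C"
proof
  fix r assume "r \<in> set (colmap f M)"
  then obtain i where i: "i < m" "r = colmap f M ! i"
    by (auto simp: in_set_conv_nth colmap_def)
  obtain A v' where A: "length v' = m" "\<And>v. length v = m \<Longrightarrow> f v = vadd (f2matvec m A v) v'"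
    using affine_perm_matrix[OF f] by blast
  have "comb N1 N2 {k. k < m \<and> A i k} ((!) M) \<in> C"
    using M C(1) matsD(1)[OF M(1)] nth_mem by (intro comb_in_code) auto
  then show "r \<in> C"
    using C is_codeD(2,3)[OF C(1)] row_colmap[OF M(1) i(1) A(2) A(1)] i(2) by auto
qed

text \<open>As an intersection it is contained in every code with these generators, which replaces
  arguments about explicit combinations.\<close>

definition code_of :: "bool list list \<Rightarrow> bool list set" where
  "code_of M = \<Inter> {C. is_code N1 N2 C \<and> one_word (N1 + N2) \<in> C \<and> set M \<subseteq> C}"

lemma code_of_least:
  assumes "is_code N1 N2 C" "one_word (N1 + N2) \<in> C" "set M \<subseteq> C"
  shows "code_of M \<subseteq> C"
  using assms by (auto simp: code_of_def)

lemma code_of_code: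
  assumes "M \<in> mats"
  shows "is_code N1 N2 (code_of M)" "one_word (N1 + N2) \<in> code_of M" "set M \<subseteq> code_of M"
proof -
  have "code_of M \<subseteq> F2vecs (N1 + N2)"
    using assms by (intro code_of_least is_code_F2vecs) (auto simp: mats_def)
  then show "is_code N1 N2 (code_of M)" by (auto simp: code_of_def is_code_def)
qed (auto simp: code_of_def)

lemma code_of_subset_iff:
  assumes "M \<in> mats" "is_code N1 N2 C" "one_word (N1 + N2) \<in> C"
  shows "code_of M \<subseteq> C \<longleftrightarrow> set M \<subseteq> C"
  using assms code_of_code code_of_least by blast

lemma code_of_colmap:
  assumes M: "M \<in> mats" and f: "f \<in> affine_perms m"
  shows "code_of (colmap f M) = code_of M"
proof -
  have sub: "code_of (colmap f M) \<subseteq> code_of M" if "M \<in> mats" "f \<in> affine_perms m" for f M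
    using that code_of_code colmap_rows_in_code by (intro code_of_least) auto
  show ?thesis
    using sub[OF M f] sub[OF colmap_mats inv_affine[OF f], of f M] M f by (simp add: colmap_inv)
qed

text \<open>For \<open>M\<close> in \<open>mats\<close> this is the sum over \<open>F_2\<close> of
  the columns selected by \<open>y\<close>, since signs do not affect parity.\<close>

definition syn :: "bool list list \<Rightarrow> bool list \<Rightarrow> bool list" where
  "syn M y = map (\<lambda>r. odd (beta N1 N2 r y)) M"

lemma syn_vadd:
  assumes "length y = N1 + N2" "length z = N1 + N2"
  shows "syn M (vadd y z) = vadd (syn M y) (syn M z)"
  by (rule nth_equalityI)
    (use assms in \<open>auto simp: syn_def nth_vadd beta_commute[of _ _ _ "vadd y z"]
      beta_commute[of _ _ _ y] beta_commute[of _ _ _ z] odd_beta_vadd\<close>)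

lemma syn_unit:
  assumes "M \<in> mats" "j < N1 + N2"
  shows "syn M (map (\<lambda>k. k = j) [0..<N1 + N2]) = col M j"
proof -
  have "odd (beta N1 N2 r (map (\<lambda>k. k = j) [0..<N1 + N2])) = r ! j" if "r \<in> set M" for r
    using that assms by (intro odd_beta_unit) (auto simp: mats_def)
  then show ?thesis by (simp add: syn_def col_def)
qed

lemma syn_eq_zero_iff:
  assumes "M \<in> mats"
  shows "syn M y = zero_word m \<longleftrightarrow> (\<forall>r\<in>set M. even (beta N1 N2 r y))"
  using matsD(1)[OF assms]
  by (auto simp: syn_def list_eq_iff_nth_eq all_set_conv_all_nth)

text \<open>The code generated by the rows and the all-ones word determines which even sets of columns
  sum to zero, that is, the affine dependencies of the columns.\<close>

lemma affine_transitive: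
  assumes M: "M \<in> mats" "M' \<in> mats" and eq: "code_of M = code_of M'"
  obtains f where "f \<in> affine_perms m" "colmap f M = M'"
proof (cases "(N1 + N2) = 0")
  \<comment> \<open>Without columns there is no column 0 to serve as base point below.\<close>
  case True
  then have "M = M'" using M by (intro mats_eqI) auto
  then show ?thesis using that[OF id_affine] M colmap_id by simp
next
  case False
  \<comment> \<open>Selections of evenly many columns: against the all-ones word \<open>beta\<close>
    has the parity of the number of selected positions.\<close>
  let ?E = "{y. length y = N1 + N2 \<and> even (beta N1 N2 (one_word (N1 + N2)) y)}"
  define G where "G = (\<lambda>y. (syn M y, syn M' y)) ` ?E"
  \<comment> \<open>If the selected columns of \<open>P'\<close> sum to zero, \<open>y\<close> is
    orthogonal to the generators of \<open>code_of P'\<close>, hence to the whole code, which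
    contains the rows of \<open>P\<close>.\<close>
  have zero: "syn P y = zero_word m" if "P \<in> mats" "P' \<in> mats" "code_of P' = code_of P"
      "y \<in> ?E" "syn P' y = zero_word m" for P P' y
  proof -
    have "code_of P' \<subseteq> dual_code N1 N2 {y}"
      using that by (intro code_of_least is_code_dual)
        (auto simp: dual_code_iff syn_eq_zero_iff mats_def beta_commute[of _ _ y])
    then have "set P \<subseteq> dual_code N1 N2 {y}" using that code_of_code(3)[of P] by auto
    then show ?thesis using that by (auto simp: syn_eq_zero_iff dual_code_iff beta_commute[of _ _ y])
  qed
  have len: "length (syn M y) = m" "length (syn M' y) = m" for y
    using M matsD by (simp_all add: syn_def)
  have "partial_iso m G"
    unfolding partial_iso_def
  proof (intro conjI)
    show "G \<subseteq> F2vecs m \<times> F2vecs m" using len by (auto simp: G_def)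
    have "(syn M (zero_word (N1 + N2)), syn M' (zero_word (N1 + N2))) \<in> G"
      unfolding G_def by (rule imageI) (simp add: beta_commute[of _ _ _ "zero_word (N1 + N2)"])
    then show "(zero_word m, zero_word m) \<in> G"
      using M matsD by (simp add: syn_def beta_commute[of _ _ _ "zero_word (N1 + N2)"] map_replicate_const)
    show "\<forall>(x, y)\<in>G. \<forall>(u, w)\<in>G. (vadd x u, vadd y w) \<in> G"
    proof (intro ballI, clarify)
      fix x y u w assume "(x, y) \<in> G" "(u, w) \<in> G"
      then obtain a b where ab: "a \<in> ?E" "b \<in> ?E" "x = syn M a" "y = syn M' a" "u = syn M b" "w = syn M' b"
        by (auto simp: G_def)
      then have "vadd a b \<in> ?E" using odd_beta_vadd[of a N1 N2 b "one_word (N1 + N2)"]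
        by (auto simp: beta_commute[of _ _ "one_word (N1 + N2)"])
      moreover have "vadd x u = syn M (vadd a b)" "vadd y w = syn M' (vadd a b)"
        using ab by (simp_all add: syn_vadd)
      ultimately show "(vadd x u, vadd y w) \<in> G" by (auto simp: G_def)
    qed
    show "\<forall>(x, y)\<in>G. x = zero_word m \<longleftrightarrow> y = zero_word m"
      unfolding G_def using zero[OF M] zero[OF M(2,1)] eq by auto
  qed
  then obtain f where f: "f permutes F2vecs m" "additive_on m f" "\<And>x y. (x, y) \<in> G \<Longrightarrow> f x = y"
    using partial_iso_extend by blast
  \<comment> \<open>\<open>f\<close> controls only sums of evenly many columns, so a translation is
    still needed; this one carries column 0 of \<open>M\<close> to column 0 of
    \<open>M'\<close>.\<close>
  define g where "g x = (if x \<in> F2vecs m then vadd (f x) (vadd (f (col M 0)) (col M' 0)) else x)" for x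
  have fa: "f \<in> affine_perms m" by (rule additive_affine[OF f(1,2)])
  have lc: "length (col M j) = m" "length (col M' j) = m" for j using M matsD by simp_all
  have "g \<in> affine_perms m"
    unfolding g_def using fa lc by (intro translate_affine) (auto simp: affine_permsD)
  moreover have "colmap g M = M'"
  proof (rule mats_eqI[OF colmap_mats M(2)])
    fix j assume j: "j < N1 + N2"
    let ?u = "\<lambda>j. map (\<lambda>k. k = j) [0..<N1 + N2]"
    \<comment> \<open>A unit word selects one column, so the sum of two of them is an even
      selection, namely columns \<open>j\<close> and 0.\<close>
    have "odd (beta N1 N2 (one_word (N1 + N2)) (?u i))" if "i < N1 + N2" for i
      using that odd_beta_unit[of "one_word (N1 + N2)" N1 N2 i] by simp
    then have "even (beta N1 N2 (one_word (N1 + N2)) (vadd (?u j) (?u 0)))"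
      using j False odd_beta_vadd[of "?u j" N1 N2 "?u 0" "one_word (N1 + N2)"]
      by (simp add: beta_commute[of _ _ "one_word (N1 + N2)"])
    then have "(syn M (vadd (?u j) (?u 0)), syn M' (vadd (?u j) (?u 0))) \<in> G"
      unfolding G_def by (intro imageI) simp
    then have "(vadd (col M j) (col M 0), vadd (col M' j) (col M' 0)) \<in> G"
      using M j False by (simp add: syn_vadd syn_unit)
    then have "f (vadd (col M j) (col M 0)) = vadd (col M' j) (col M' 0)" by (rule f(3))
    then have "vadd (f (col M j)) (f (col M 0)) = vadd (col M' j) (col M' 0)"
      using f(2) lc by (simp add: additive_on_def)
    then have "vadd (vadd (f (col M j)) (f (col M 0))) (col M' 0) = col M' j"
      using lc by (simp add: vadd.assoc)
    moreover have "length (g (col M j)) = m" using \<open>g \<in> affine_perms m\<close> lc by (simp add: affine_permsD)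
    ultimately show "col (colmap g M) j = col M' j"
      using j lc by (simp add: col_colmap) (simp add: g_def vadd.assoc)
  qed
  ultimately show ?thesis by (rule that)
qed

end

subsection \<open>The Clifford action on polynomials\<close>

interpretation cm: module cscale
  by unfold_locales (auto simp: cscale_def fun_eq_iff algebra_simps)

abbreviation linear_op :: "(cpoly \<Rightarrow> cpoly) \<Rightarrow> bool" where
  "linear_op \<equiv> module_hom cscale cscale"

lemma linear_opI:
  assumes "\<And>p q. f (p + q) = f p + f q" "\<And>c p. f (cscale c p) = cscale c (f p)"
  shows "linear_op f"
  using assms by unfold_locales

lemma sum_fun_apply2:
  fixes F :: "'i \<Rightarrow> 'a \<Rightarrow> 'b \<Rightarrow> 'c :: comm_monoid_add"
  shows "sum F A a b = (\<Sum>i\<in>A. F i a b)"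
  by (induction A rule: infinite_finite_induct) auto

lemma cscale_apply: "cscale c p a b = c * p a b"
  by (simp add: cscale_def)

lemma linear_op_act: "linear_op (act m g)"
  by (rule linear_opI) (auto simp: act_def cscale_def fun_eq_iff)

lemma linear_op_zero: "linear_op f \<Longrightarrow> f 0 = 0"
  by (rule module_hom.zero[of cscale cscale f])

lemma linear_op_comp: "linear_op f \<Longrightarrow> linear_op g \<Longrightarrow> linear_op (\<lambda>p. f (g p))"
  by (rule linear_opI) (simp_all add: module_hom.add module_hom.scale)

lemma linear_op_scale: "linear_op f \<Longrightarrow> linear_op (\<lambda>p. cscale c (f p))"
  by (rule linear_opI) (simp_all add: module_hom.add module_hom.scale cm.scale_right_distrib mult.commute)

lemma linear_op_sum:
  assumes "\<And>i. i \<in> I \<Longrightarrow> linear_op (f i)"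
  shows "linear_op (\<lambda>p. \<Sum>i\<in>I. f i p)"
proof (rule linear_opI)
  show "(\<Sum>i\<in>I. f i (p + q)) = (\<Sum>i\<in>I. f i p) + (\<Sum>i\<in>I. f i q)" for p q
    unfolding sum.distrib[symmetric] by (rule sum.cong[OF refl]) (rule module_hom.add[OF assms])
  show "(\<Sum>i\<in>I. f i (cscale c p)) = cscale c (\<Sum>i\<in>I. f i p)" for c p
    unfolding cm.scale_sum_right by (rule sum.cong[OF refl]) (rule module_hom.scale[OF assms])
qed

lemma powi_i_eq:
  "\<i> powi k = (if k mod 4 = 0 then 1 else if k mod 4 = 1 then \<i> else if k mod 4 = 2 then - 1 else - \<i>)"
proof -
  have "\<i> powi k = \<i> powi (4 * (k div 4) + k mod 4)" by simp
  also have "\<dots> = (\<i> powi 4) powi (k div 4) * \<i> powi (k mod 4)"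
    by (subst power_int_add) (simp_all add: power_int_mult)
  also have "\<i> powi 4 = 1" by (simp add: power_int_def numeral_eq_Suc)
  finally have *: "\<i> powi k = \<i> powi (k mod 4)" by simp
  have "0 \<le> k mod 4" "k mod 4 < 4" by auto
  then have "k mod 4 = 0 \<or> k mod 4 = 1 \<or> k mod 4 = 2 \<or> k mod 4 = 3" by arith
  then show ?thesis unfolding * by (elim disjE) (simp_all add: power_int_def numeral_eq_Suc)
qed

text \<open>The terms are the powers of a fourth root of unity, so they cancel unless the root is
  1.\<close>

lemma avg_powi_i: "(\<Sum>s<4::nat. \<i> powi (int s * k)) = (if 4 dvd k then 4 else 0)"
proof -
  have "\<i> powi (int s * k) = (\<i> powi k) ^ s" for s
    by (subst mult.commute) (simp only: power_int_mult power_int_of_nat)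
  then have "(\<Sum>s<4::nat. \<i> powi (int s * k)) = (\<Sum>s<4::nat. (\<i> powi k) ^ s)" by (simp only:)
  also have "\<dots> = 1 + \<i> powi k + (\<i> powi k) ^ 2 + (\<i> powi k) ^ 3"
    by (simp add: eval_nat_numeral lessThan_Suc)
  also have "\<dots> = (if 4 dvd k then 4 else 0)"
    unfolding powi_i_eq[of k] dvd_eq_mod_eq_0 by (simp add: eval_nat_numeral)
  finally show ?thesis .
qed

context
  fixes m N1 N2 :: nat
begin

lemma prod_split_N:
  fixes f g :: "nat \<Rightarrow> 'a :: comm_monoid_mult"
  shows "prod f {..<N1} * prod g {N1..<N1 + N2} = (\<Prod>j<(N1 + N2). if j < N1 then f j else g j)"
proof -
  have "{..<N1 + N2} = {..<N1} \<union> {N1..<N1 + N2}" by auto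
  then have "(\<Prod>j<(N1 + N2). if j < N1 then f j else g j)
    = (\<Prod>j<N1. if j < N1 then f j else g j) * (\<Prod>j\<in>{N1..<N1 + N2}. if j < N1 then f j else g j)"
    by (simp only: prod.union_disjoint[OF finite_lessThan finite_atLeastLessThan ivl_disj_int_one(2)])
  then show ?thesis by simp
qed

lemma nu_alt: "nu N1 N2 M a b = (\<Prod>j<(N1 + N2). (if j < N1 then a else b) (col M j))"
  unfolding nu_def prod_split_N by (rule prod.cong) auto

lemma act_nu: "act m g (nu N1 N2 M) a b =
    (\<Prod>j<(N1 + N2). if j < N1 then \<Sum>w\<in>F2vecs m. g w (col M j) * a w
       else \<Sum>w\<in>F2vecs m. cnj (g w (col M j)) * b w)"
  unfolding act_def nu_alt by (rule prod.cong) auto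

text \<open>Only the entries of \<open>g\<close> on \<open>F_2^m\<close> are prescribed, so
  generators and their adjoints are covered alike; \<open>act_diag_matrix\<close> and
  \<open>act_hadamard_matrix\<close> have the same form.\<close>

lemma act_perm_matrix:
  assumes M: "M \<in> mats m N1 N2" and f: "f \<in> affine_perms m"
    and g: "\<And>v w. length v = m \<Longrightarrow> length w = m \<Longrightarrow> g w v = (if w = f v then 1 else 0)"
  shows "act m g (nu N1 N2 M) = nu N1 N2 (colmap m N1 N2 f M)"
proof (intro ext)
  fix a b
  have l: "length (col M j) = m" "length (f (col M j)) = m" for j
    using matsD[OF M] affine_permsD(2)[OF f] by simp_all
  have s: "(\<Sum>w\<in>F2vecs m. g w (col M j) * x w) = x (f (col M j))"
    "(\<Sum>w\<in>F2vecs m. cnj (g w (col M j)) * x w) = x (f (col M j))" for x j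
  proof -
    have "(\<Sum>w\<in>F2vecs m. g w (col M j) * x w) = (\<Sum>w\<in>F2vecs m. if w = f (col M j) then x w else 0)"
      by (rule sum.cong) (use l g in auto)
    then show "(\<Sum>w\<in>F2vecs m. g w (col M j) * x w) = x (f (col M j))" using l by simp
    have "(\<Sum>w\<in>F2vecs m. cnj (g w (col M j)) * x w) = (\<Sum>w\<in>F2vecs m. if w = f (col M j) then x w else 0)"
      by (rule sum.cong) (use l g in auto)
    then show "(\<Sum>w\<in>F2vecs m. cnj (g w (col M j)) * x w) = x (f (col M j))" using l by simp
  qed
  show "act m g (nu N1 N2 M) a b = nu N1 N2 (colmap m N1 N2 f M) a b"
    unfolding act_nu nu_alt s by (rule prod.cong) (use l in \<open>auto simp: col_colmap\<close>)
qed

lemma clifford_affine: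
  assumes f: "f \<in> affine_perms m"
  obtains g where "g \<in> clifford_group m"
    "\<And>M. M \<in> mats m N1 N2 \<Longrightarrow> act m g (nu N1 N2 M) = nu N1 N2 (colmap m N1 N2 f M)"
proof -
  obtain A v' where A: "A \<in> GL2 m" "length v' = m"
    "\<And>v. length v = m \<Longrightarrow> f v = vadd (f2matvec m A v) v'"
    using affine_perm_matrix[OF f] by blast
  show ?thesis
  proof (rule that)
    show "gen_m m A v' \<in> clifford_group m" using A by (intro clifford_group.gen_m) auto
    fix M assume "M \<in> mats m N1 N2"
    then show "act m (gen_m m A v') (nu N1 N2 M) = nu N1 N2 (colmap m N1 N2 f M)"
      by (rule act_perm_matrix[OF _ f]) (auto simp: gen_m_def restr_def A(3))
  qed
qed

text \<open>The exponent of i picked up by \<open>nu N1 N2 M\<close> under a diagonal matrix.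
  Exchanging the sum over columns with the quadratic form expresses it through products of rows;
  conjugation inverts i and accounts for the signs in \<open>beta\<close>.\<close>

definition phase :: "(nat \<Rightarrow> nat \<Rightarrow> int) \<Rightarrow> bool list list \<Rightarrow> int" where
  "phase S M = (\<Sum>i<m. \<Sum>k<m. S i k * beta N1 N2 (M ! i) (M ! k))"

lemma phase_eq:
  assumes M: "M \<in> mats m N1 N2"
  shows "phase S M = (\<Sum>j<(N1 + N2). sg N1 j * qform m S (col M j))"
proof -
  have "(\<Sum>j<(N1 + N2). sg N1 j * qform m S (col M j))
    = (\<Sum>j<(N1 + N2). \<Sum>i<m. \<Sum>k<m. S i k * (sg N1 j * of_bool (M ! i ! j \<and> M ! k ! j)))"
    unfolding qform_def sum_distrib_left using matsD(1)[OF M]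
    by (intro sum.cong) (auto simp: of_bool_conj)
  also have "\<dots> = (\<Sum>i<m. \<Sum>k<m. \<Sum>j<(N1 + N2). S i k * (sg N1 j * of_bool (M ! i ! j \<and> M ! k ! j)))"
    by (subst sum.swap) (intro sum.cong refl sum.swap)
  also have "\<dots> = phase S M"
    unfolding phase_def beta_alt by (simp only: sum_distrib_left)
  finally show ?thesis ..
qed

lemma act_diag_matrix:
  assumes M: "M \<in> mats m N1 N2"
    and g: "\<And>v w. length v = m \<Longrightarrow> length w = m \<Longrightarrow> g w v = (if w = v then \<i> powi qform m S v else 0)"
  shows "act m g (nu N1 N2 M) = cscale (\<i> powi phase S M) (nu N1 N2 M)"
proof (intro ext)
  fix a b
  let ?q = "\<lambda>j. qform m S (col M j)"
  have l: "length (col M j) = m" for j using matsD[OF M] by simp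
  have cnj_powi: "cnj (\<i> powi q) = \<i> powi (- q)" for q
    by (simp add: power_int_minus flip: power_int_inverse)
  have s: "(\<Sum>w\<in>F2vecs m. g w (col M j) * x w) = \<i> powi ?q j * x (col M j)"
    "(\<Sum>w\<in>F2vecs m. cnj (g w (col M j)) * x w) = \<i> powi (- ?q j) * x (col M j)" for x j
  proof -
    have "(\<Sum>w\<in>F2vecs m. g w (col M j) * x w)
        = (\<Sum>w\<in>F2vecs m. if w = col M j then \<i> powi ?q j * x w else 0)"
      by (rule sum.cong) (use l g in auto)
    then show "(\<Sum>w\<in>F2vecs m. g w (col M j) * x w) = \<i> powi ?q j * x (col M j)" using l by simp
    have "(\<Sum>w\<in>F2vecs m. cnj (g w (col M j)) * x w)
        = (\<Sum>w\<in>F2vecs m. if w = col M j then \<i> powi (- ?q j) * x w else 0)"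
      unfolding cnj_powi[symmetric] by (rule sum.cong) (use l g in auto)
    then show "(\<Sum>w\<in>F2vecs m. cnj (g w (col M j)) * x w) = \<i> powi (- ?q j) * x (col M j)"
      using l by simp
  qed
  have powi_sum: "\<i> powi (\<Sum>j\<in>J. h j) = (\<Prod>j\<in>J. \<i> powi h j)" for h and J :: "nat set"
    by (induction J rule: infinite_finite_induct) (auto simp: power_int_add)
  have "act m g (nu N1 N2 M) a b
    = (\<Prod>j<(N1 + N2). \<i> powi (sg N1 j * ?q j) * (if j < N1 then a else b) (col M j))"
    unfolding act_nu s by (rule prod.cong) (auto simp: sg_def)
  then show "act m g (nu N1 N2 M) a b = cscale (\<i> powi phase S M) (nu N1 N2 M) a b"
    by (simp add: phase_eq[OF M] powi_sum prod.distrib nu_alt cscale_apply)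
qed

text \<open>The matrix acts on the first tensor factor, so only the first row changes. Expanding the
  product over columns chooses a new first entry in each, that is a word \<open>c\<close>, and the
  signs multiply up to \<open>chi\<close>.\<close>

lemma act_hadamard_matrix:
  assumes r: "length r = N1 + N2" and R: "set R \<subseteq> F2vecs (N1 + N2)" and m: "m = Suc (length R)"
    and g: "\<And>v w. length v = m \<Longrightarrow> length w = m \<Longrightarrow>
      g w v = (if tl w = tl v then hadamard (hd w) (hd v) else 0)"
  shows "act m g (nu N1 N2 (r # R))
    = cscale (1 / of_real (sqrt 2) ^ (N1 + N2)) (\<Sum>c\<in>F2vecs (N1 + N2). cscale (chi N1 N2 c r) (nu N1 N2 (c # R)))"
proof (intro ext)
  fix a b
  have col: "col (c # R) j = (c ! j) # col R j" for c j by (simp add: col_def)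
  have cnj_h: "cnj (hadamard x y) = hadamard x y" for x y by (simp add: hadamard_def)
  have s: "(\<Sum>w\<in>F2vecs m. g w (y # t) * x w) = (\<Sum>z\<in>UNIV. hadamard z y * x (z # t))"
    "(\<Sum>w\<in>F2vecs m. cnj (g w (y # t)) * x w) = (\<Sum>z\<in>UNIV. hadamard z y * x (z # t))"
    if t: "length t = length R" for x y t
  proof -
    have delta: "(\<Sum>v\<in>F2vecs (length R). (if v = t then h v else 0)) = h t" for h :: "bool list \<Rightarrow> complex"
      using t by simp
    have 1: "g (z # v) (y # t) * x (z # v) = (if v = t then hadamard z y * x (z # v) else 0)"
      "cnj (g (z # v) (y # t)) * x (z # v) = (if v = t then hadamard z y * x (z # v) else 0)"
      if "v \<in> F2vecs (length R)" for z v
      using g[of "y # t" "z # v"] that t by (simp_all add: m cnj_h)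
    show "(\<Sum>w\<in>F2vecs m. g w (y # t) * x w) = (\<Sum>z\<in>UNIV. hadamard z y * x (z # t))"
      unfolding m sum_F2vecs_Suc by (simp only: 1 delta cong: sum.cong)
    show "(\<Sum>w\<in>F2vecs m. cnj (g w (y # t)) * x w) = (\<Sum>z\<in>UNIV. hadamard z y * x (z # t))"
      unfolding m sum_F2vecs_Suc by (simp only: 1 delta cong: sum.cong)
  qed
  have had: "(\<Prod>j<(N1 + N2). hadamard (c ! j) (r ! j)) = chi N1 N2 c r / of_real (sqrt 2) ^ (N1 + N2)" for c
    unfolding hadamard_def prod_dividef chi_def odd_beta prod_sign[OF finite_lessThan]
    by (simp add: odd_beta[symmetric])
  have "act m g (nu N1 N2 (r # R)) a b
    = (\<Prod>j<(N1 + N2). \<Sum>z\<in>UNIV. hadamard z (r ! j) * (if j < N1 then a else b) (z # col R j))"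
    unfolding act_nu col by (rule prod.cong) (auto simp: s)
  also have "\<dots> = (\<Sum>c\<in>F2vecs (N1 + N2). \<Prod>j<(N1 + N2). hadamard (c ! j) (r ! j) * (if j < N1 then a else b) (c ! j # col R j))"
    by (rule prod_sum_bool)
  also have "\<dots> = (\<Sum>c\<in>F2vecs (N1 + N2). chi N1 N2 c r / of_real (sqrt 2) ^ (N1 + N2) * nu N1 N2 (c # R) a b)"
    unfolding prod.distrib had nu_alt col ..
  finally show "act m g (nu N1 N2 (r # R)) a b = cscale (1 / of_real (sqrt 2) ^ (N1 + N2))
      (\<Sum>c\<in>F2vecs (N1 + N2). cscale (chi N1 N2 c r) (nu N1 N2 (c # R))) a b"
    by (simp add: cscale_apply sum_fun_apply2 sum_distrib_left)
qed

subsection \<open>Operators fixing the invariants\<close>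

text \<open>Since such an operator does not move an invariant \<open>p\<close>, showing that its
  image of \<open>p\<close> lies in a subspace places \<open>p\<close> itself there. Compositions
  and averages of Clifford elements are of this kind.\<close>

definition adm :: "(cpoly \<Rightarrow> cpoly) \<Rightarrow> bool" where
  "adm \<Omega> \<longleftrightarrow> linear_op \<Omega> \<and> (\<forall>p\<in>invariant_space m N1 N2. \<Omega> p = p)"

lemma adm_id: "adm (\<lambda>p. p)"
  by (auto simp: adm_def intro: linear_opI)

lemma adm_comp: "adm f \<Longrightarrow> adm g \<Longrightarrow> adm (\<lambda>p. f (g p))"
  unfolding adm_def using linear_op_comp[of f g] by simp

lemma adm_act: "g \<in> clifford_group m \<Longrightarrow> adm (act m g)"
  by (auto simp: adm_def invariant_space_def linear_op_act)

lemma average_const: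
  assumes "finite I" "I \<noteq> {}"
  shows "cscale (1 / of_nat (card I)) (\<Sum>i\<in>I. p) = p"
  using assms by (intro ext) (simp add: cscale_apply sum_fun_apply2)

lemma adm_avg:
  assumes "finite I" "I \<noteq> {}" "\<And>i. i \<in> I \<Longrightarrow> adm (f i)"
  shows "adm (\<lambda>p. cscale (1 / of_nat (card I)) (\<Sum>i\<in>I. f i p))"
  using assms average_const[OF assms(1,2)] unfolding adm_def
  by (auto intro!: linear_op_scale linear_op_sum)

text \<open>The average over the forms \<open>s S\<close> with \<open>s = 0, 1, 2, 3\<close> cancels
  every phase that is not a multiple of 4.\<close>

lemma adm_phase_projection:
  assumes S: "\<forall>i j. S i j = S j i"
  obtains \<Omega> where "adm \<Omega>"
    "\<And>M. M \<in> mats m N1 N2 \<Longrightarrow> \<Omega> (nu N1 N2 M) = (if 4 dvd phase S M then nu N1 N2 M else 0)"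
proof -
  let ?S = "\<lambda>s i j. int s * S i j"
  let ?\<Omega> = "\<lambda>p. cscale (1 / of_nat (card {..<4::nat})) (\<Sum>s<4. act m (gen_d m (?S s)) p)"
  have "adm ?\<Omega>"
    by (rule adm_avg) (use S in \<open>auto intro!: adm_act clifford_group.gen_d simp: lessThan_empty_iff\<close>)
  moreover have "?\<Omega> (nu N1 N2 M) = (if 4 dvd phase S M then nu N1 N2 M else 0)"
    if M: "M \<in> mats m N1 N2" for M
  proof -
    have "phase (?S s) M = int s * phase S M" for s
      by (simp add: phase_def sum_distrib_left mult.assoc)
    then have "act m (gen_d m (?S s)) (nu N1 N2 M) = cscale (\<i> powi (int s * phase S M)) (nu N1 N2 M)" for s
      using act_diag_matrix[OF M, of "gen_d m (?S s)" "?S s"] by (simp add: gen_d_def restr_def)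
    then have "?\<Omega> (nu N1 N2 M) = cscale (1 / 4 * (\<Sum>s<4::nat. \<i> powi (int s * phase S M))) (nu N1 N2 M)"
      by (intro ext) (simp add: cscale_apply sum_fun_apply2 sum_distrib_right)
    then show ?thesis by (simp add: avg_powi_i)
  qed
  ultimately show ?thesis by (rule that)
qed

lemma adm_phase_projections:
  assumes "finite \<S>" "\<And>S. S \<in> \<S> \<Longrightarrow> \<forall>i j. S i j = S j i"
  shows "\<exists>\<Omega>. adm \<Omega> \<and> (\<forall>M\<in>mats m N1 N2. \<Omega> (nu N1 N2 M) =
    (if \<forall>S\<in>\<S>. 4 dvd phase S M then nu N1 N2 M else 0))"
  using assms
proof (induction \<S>)
  case empty
  then show ?case using adm_id by auto
next
  case (insert S \<S>)
  obtain \<Omega> where 1: "adm \<Omega>" "\<forall>M\<in>mats m N1 N2. \<Omega> (nu N1 N2 M) =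
    (if \<forall>S\<in>\<S>. 4 dvd phase S M then nu N1 N2 M else 0)" using insert by auto
  obtain \<Omega>' where 2: "adm \<Omega>'"
    "\<And>M. M \<in> mats m N1 N2 \<Longrightarrow> \<Omega>' (nu N1 N2 M) = (if 4 dvd phase S M then nu N1 N2 M else 0)"
    using adm_phase_projection[of S] insert.prems by auto
  have "\<Omega>' 0 = 0" using 2(1) linear_op_zero unfolding adm_def by blast
  then have "\<forall>M\<in>mats m N1 N2. \<Omega>' (\<Omega> (nu N1 N2 M)) =
    (if \<forall>S\<in>insert S \<S>. 4 dvd phase S M then nu N1 N2 M else 0)"
    using 1(2) 2(2) by auto
  then show ?case using adm_comp[OF 2(1) 1(1)] by blast
qed

text \<open>The condition on the rows under which every symmetric \<open>S\<close> gives a phase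
  divisible by 4; the matrices \<open>elem_sym\<close> suffice to detect it.\<close>

definition dgood :: "bool list list \<Rightarrow> bool" where
  "dgood M \<longleftrightarrow> (\<forall>r\<in>set M. 4 dvd wt N1 N2 r) \<and> (\<forall>r\<in>set M. \<forall>s\<in>set M. even (beta N1 N2 r s))"

text \<open>The matrices \<open>E_xx\<close> and \<open>E_xy + E_yx\<close>. The first has the
  weight of a row as phase; in the second \<open>beta\<close> occurs twice, so divisibility by 4
  becomes evenness.\<close>

definition elem_sym :: "nat \<times> nat \<Rightarrow> nat \<Rightarrow> nat \<Rightarrow> int" where
  "elem_sym = (\<lambda>(x, y) i k. (if i = x \<and> k = y then 1 else 0) + (if x \<noteq> y \<and> i = y \<and> k = x then 1 else 0))"

lemma phase_elem_sym:
  assumes "x < m" "y < m"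
  shows "phase (elem_sym (x, y)) M = (if x = y then wt N1 N2 (M ! x) else 2 * beta N1 N2 (M ! x) (M ! y))"
proof -
  have single: "(\<Sum>i<m. \<Sum>k<m. (if i = x \<and> k = y then 1 else 0) * f i k) = (f x y :: int)"
    if "x < m" "y < m" for x y f
  proof -
    have "(\<Sum>i<m. \<Sum>k<m. (if i = x \<and> k = y then 1 else 0) * f i k)
        = (\<Sum>i<m. if i = x then \<Sum>k<m. if k = y then f i k else 0 else 0)"
      by (intro sum.cong) (auto intro!: sum.cong simp del: sum.delta sum.delta')
    then show ?thesis using that by simp
  qed
  show ?thesis
  proof (cases "x = y")
    case True
    then show ?thesis using assms single[of x x "\<lambda>i k. beta N1 N2 (M ! i) (M ! k)"]
      by (simp add: phase_def elem_sym_def wt_eq_beta)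
  next
    case False
    then show ?thesis using assms single[of x y "\<lambda>i k. beta N1 N2 (M ! i) (M ! k)"]
        single[of y x "\<lambda>i k. beta N1 N2 (M ! i) (M ! k)"]
      by (simp add: phase_def elem_sym_def distrib_right sum.distrib beta_commute[of _ _ "M ! y"])
  qed
qed

lemma adm_diag_projection:
  obtains \<Omega> where "adm \<Omega>"
    "\<And>M. M \<in> mats m N1 N2 \<Longrightarrow> \<Omega> (nu N1 N2 M) = (if dgood M then nu N1 N2 M else 0)"
proof -
  let ?\<S> = "elem_sym ` ({..<m} \<times> {..<m})"
  have sym: "\<forall>i j. S i j = S j i" if S: "S \<in> ?\<S>" for S
  proof -
    obtain x y where "S = elem_sym (x, y)" using S by blast
    then show ?thesis by (cases "x = y") (simp_all add: elem_sym_def conj_commute add.commute)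
  qed
  have iff: "(\<forall>S\<in>?\<S>. 4 dvd phase S M) \<longleftrightarrow> dgood M" if M: "M \<in> mats m N1 N2" for M
  proof -
    have "(\<forall>S\<in>?\<S>. 4 dvd phase S M)
      \<longleftrightarrow> (\<forall>x<m. \<forall>y<m. 4 dvd (if x = y then wt N1 N2 (M ! x) else 2 * beta N1 N2 (M ! x) (M ! y)))"
      by (auto simp: phase_elem_sym)
    also have "\<dots> \<longleftrightarrow> (\<forall>x<m. 4 dvd wt N1 N2 (M ! x)) \<and> (\<forall>x<m. \<forall>y<m. even (beta N1 N2 (M ! x) (M ! y)))"
    proof -
      have "4 dvd 2 * z \<longleftrightarrow> even z" for z :: int by presburger
      then show ?thesis using four_dvd_even[of "wt N1 N2 (M ! x)" for x]
        unfolding wt_eq_beta by (smt (verit, best))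
    qed
    finally show ?thesis using matsD(1)[OF M] by (auto simp: dgood_def all_set_conv_all_nth)
  qed
  obtain \<Omega> where "adm \<Omega>" "\<forall>M\<in>mats m N1 N2. \<Omega> (nu N1 N2 M) =
    (if \<forall>S\<in>?\<S>. 4 dvd phase S M then nu N1 N2 M else 0)"
    using adm_phase_projections[OF _ sym, of ?\<S>] by auto
  then show ?thesis using that[of \<Omega>] iff by simp
qed

text \<open>By \<open>affine_transitive\<close> and \<open>code_of_colmap\<close> the matrices with
  a given code form one orbit, so averaging over the group yields a multiple of the orbit
  sum.\<close>

lemma adm_affine_average:
  obtains \<Omega> where "adm \<Omega>"
    "\<And>M. M \<in> mats m N1 N2 \<Longrightarrow> \<exists>c. \<Omega> (nu N1 N2 M)
      = cscale c (\<Sum>M'\<in>{M'\<in>mats m N1 N2. code_of N1 N2 M' = code_of N1 N2 M}. nu N1 N2 M')"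
proof -
  let ?A = "affine_perms m"
  have "\<forall>f\<in>?A. \<exists>g. g \<in> clifford_group m \<and>
    (\<forall>M\<in>mats m N1 N2. act m g (nu N1 N2 M) = nu N1 N2 (colmap m N1 N2 f M))"
    using clifford_affine by metis
  then obtain g where g: "\<And>f. f \<in> ?A \<Longrightarrow> g f \<in> clifford_group m"
    "\<And>f M. f \<in> ?A \<Longrightarrow> M \<in> mats m N1 N2 \<Longrightarrow> act m (g f) (nu N1 N2 M) = nu N1 N2 (colmap m N1 N2 f M)"
    by metis
  let ?\<Omega> = "\<lambda>p. cscale (1 / of_nat (card ?A)) (\<Sum>f\<in>?A. act m (g f) p)"
  have "adm ?\<Omega>"
  proof (rule adm_avg)
    show "?A \<noteq> {}" using id_affine by blast
  qed (use finite_affine_perms g in \<open>auto intro!: adm_act\<close>)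
  moreover have "\<exists>c. ?\<Omega> (nu N1 N2 M)
      = cscale c (\<Sum>M'\<in>{M'\<in>mats m N1 N2. code_of N1 N2 M' = code_of N1 N2 M}. nu N1 N2 M')"
    if M: "M \<in> mats m N1 N2" for M
  proof -
    let ?O = "{M'\<in>mats m N1 N2. code_of N1 N2 M' = code_of N1 N2 M}"
    define s where "s M = (\<Sum>f\<in>?A. nu N1 N2 (colmap m N1 N2 f M))" for M
    have s_orbit: "s M' = s M" if M': "M' \<in> ?O" for M'
    proof -
      obtain f0 where f0: "f0 \<in> ?A" "colmap m N1 N2 f0 M = M'"
        using affine_transitive[OF M, of M'] M' by auto
      have "s M' = (\<Sum>f\<in>?A. nu N1 N2 (colmap m N1 N2 (f \<circ> f0) M))"
        unfolding s_def f0(2)[symmetric] using M f0(1) by (simp add: colmap_comp)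
      also have "\<dots> = s M"
        unfolding s_def
        by (rule sum.reindex_bij_witness[of _ "\<lambda>f. f \<circ> inv f0" "\<lambda>f. f \<circ> f0"])
          (use f0(1) affine_permsD(1)[OF f0(1)] in
            \<open>auto simp: comp_affine inv_affine comp_assoc permutes_inv_o\<close>)
      finally show ?thesis .
    qed
    have perm: "(\<Sum>M'\<in>?O. nu N1 N2 (colmap m N1 N2 f M')) = (\<Sum>M'\<in>?O. nu N1 N2 M')" if "f \<in> ?A" for f
      by (rule sum.reindex_bij_witness[of _ "colmap m N1 N2 (inv f)" "colmap m N1 N2 f"])
        (use that in \<open>auto simp: colmap_inv colmap_mats code_of_colmap inv_affine\<close>)
    have fin: "finite ?O" "?O \<noteq> {}" using finite_mats M by auto
    \<comment> \<open>Double counting in place of stabilisers: \<open>s\<close> is constant on the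
      orbit \<open>?O\<close>, and each \<open>f\<close> permutes \<open>?O\<close>.\<close>
    have "cscale (of_nat (card ?O)) (s M) = (\<Sum>M'\<in>?O. s M')"
      using s_orbit by (intro ext) (simp add: cscale_apply sum_fun_apply2)
    also have "\<dots> = (\<Sum>f\<in>?A. \<Sum>M'\<in>?O. nu N1 N2 (colmap m N1 N2 f M'))"
      unfolding s_def by (rule sum.swap)
    also have "\<dots> = cscale (of_nat (card ?A)) (\<Sum>M'\<in>?O. nu N1 N2 M')"
      using perm by (intro ext) (simp add: cscale_apply sum_fun_apply2)
    finally have eq: "cscale (of_nat (card ?O)) (s M) = cscale (of_nat (card ?A)) (\<Sum>M'\<in>?O. nu N1 N2 M')" .
    have "card ?O \<noteq> 0" using fin by simp
    then have "s M = cscale (1 / of_nat (card ?O)) (cscale (of_nat (card ?O)) (s M))" by simp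
    also have "\<dots> = cscale (of_nat (card ?A) / of_nat (card ?O)) (\<Sum>M'\<in>?O. nu N1 N2 M')"
      unfolding eq by simp
    finally have sM: "s M = cscale (of_nat (card ?A) / of_nat (card ?O)) (\<Sum>M'\<in>?O. nu N1 N2 M')" .
    have "(\<Sum>f\<in>?A. act m (g f) (nu N1 N2 M)) = s M"
      unfolding s_def by (rule sum.cong) (use g(2)[OF _ M] in auto)
    then show ?thesis
      by (intro exI[of _ "1 / of_nat (card ?A) * (of_nat (card ?A) / of_nat (card ?O))"])
        (simp only: sM cm.scale_scale)
  qed
  ultimately show ?thesis by (rule that)
qed

end

subsection \<open>Invariants are spanned by weight enumerators of doubly-even codes\<close>

context
  fixes m N1 N2 :: nat
begin

lemma ccwe_eq:
  assumes "is_code N1 N2 C"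
  shows "ccwe m N1 N2 C = (\<Sum>M\<in>{M \<in> mats m N1 N2. set M \<subseteq> C}. nu N1 N2 M)"
proof -
  have "{M. length M = m \<and> set M \<subseteq> C} = {M \<in> mats m N1 N2. set M \<subseteq> C}"
    using is_codeD(1)[OF assms] by (auto simp: mats_def)
  then show ?thesis by (simp add: ccwe_def)
qed

text \<open>The value is 0 when \<open>m\<close> rows and the all-ones word cannot generate
  \<open>C\<close>.\<close>

definition orbit_sum :: "bool list set \<Rightarrow> cpoly" where
  "orbit_sum C = (\<Sum>M\<in>{M \<in> mats m N1 N2. code_of N1 N2 M = C}. nu N1 N2 M)"

lemma good_subcode: "good_code N1 N2 C \<Longrightarrow> is_code N1 N2 D \<Longrightarrow> one_word (N1 + N2) \<in> D \<Longrightarrow> D \<subseteq> C \<Longrightarrow> good_code N1 N2 D"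
  by (auto simp: good_code_def doubly_even_def)

lemma finite_good_codes: "finite {C. good_code N1 N2 C}"
  by (rule finite_subset[of _ "Pow (F2vecs (N1 + N2))"]) (auto simp: good_code_def is_codeD)

text \<open>Matrices with rows in \<open>C\<close> are sorted by the code they generate, which is
  good as a subcode of \<open>C\<close> containing the all-ones word.\<close>

lemma ccwe_orbit_sums:
  assumes C: "good_code N1 N2 C"
  shows "ccwe m N1 N2 C = (\<Sum>D\<in>{D. good_code N1 N2 D \<and> D \<subseteq> C}. orbit_sum D)"
proof -
  have c: "is_code N1 N2 C" "one_word (N1 + N2) \<in> C" using C by (auto simp: good_code_def)
  let ?S = "{M \<in> mats m N1 N2. set M \<subseteq> C}" and ?T = "{D. good_code N1 N2 D \<and> D \<subseteq> C}"
  have sub: "code_of N1 N2 M \<subseteq> C \<longleftrightarrow> set M \<subseteq> C" if "M \<in> mats m N1 N2" for M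
    using code_of_subset_iff[OF that c] .
  have "(\<Sum>M\<in>?S. nu N1 N2 M) = (\<Sum>D\<in>?T. \<Sum>M\<in>{M\<in>?S. code_of N1 N2 M = D}. nu N1 N2 M)"
  proof (rule sum.group[symmetric])
    show "finite ?S" using finite_mats by auto
    show "finite ?T" using finite_good_codes by auto
    show "code_of N1 N2 ` ?S \<subseteq> ?T"
      using sub code_of_code good_subcode[OF C] by auto
  qed
  also have "\<dots> = (\<Sum>D\<in>?T. orbit_sum D)"
    unfolding orbit_sum_def using sub by (intro sum.cong) auto
  finally show ?thesis by (simp add: ccwe_eq[OF c(1)])
qed

text \<open>The relation \<open>ccwe_orbit_sums\<close> is triangular for inclusion with diagonal 1,
  so induction on the size of \<open>C\<close> inverts it.\<close>

lemma orbit_sum_in_span: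
  assumes "good_code N1 N2 C"
  shows "orbit_sum C \<in> cspan (ccwe m N1 N2 ` {D. good_code N1 N2 D})"
  using assms
proof (induction "card C" arbitrary: C rule: less_induct)
  case less
  let ?T = "{D. good_code N1 N2 D \<and> D \<subseteq> C}"
  have finC: "finite C" using less.prems is_code_finite by (auto simp: good_code_def)
  have finT: "finite ?T" using finite_good_codes by auto
  have "ccwe m N1 N2 C = orbit_sum C + (\<Sum>D\<in>?T - {C}. orbit_sum D)"
    unfolding ccwe_orbit_sums[OF less.prems] using less.prems finT by (subst sum.remove[of _ C]) auto
  then have "orbit_sum C = ccwe m N1 N2 C - (\<Sum>D\<in>?T - {C}. orbit_sum D)" by simp
  also have "\<dots> \<in> cspan (ccwe m N1 N2 ` {D. good_code N1 N2 D})"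
  proof (intro cm.span_diff cm.span_sum)
    show "ccwe m N1 N2 C \<in> cspan (ccwe m N1 N2 ` {D. good_code N1 N2 D})"
      using less.prems by (intro cm.span_base) auto
    fix D assume "D \<in> ?T - {C}"
    then have "card D < card C" "good_code N1 N2 D" using finC by (auto intro!: psubset_card_mono)
    then show "orbit_sum D \<in> cspan (ccwe m N1 N2 ` {D. good_code N1 N2 D})" by (rule less.hyps)
  qed
  finally show ?case .
qed

text \<open>Minimality of \<open>code_of\<close> is used three times: the code lies in the dual of
  its generators, therefore in its own dual, and finally in the set of its words of weight divisible
  by 4.\<close>

lemma code_of_good:
  assumes M: "M \<in> mats m N1 N2" and d: "dgood N1 N2 M" and one: "4 dvd wt N1 N2 (one_word (N1 + N2))"
  shows "good_code N1 N2 (code_of N1 N2 M)"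
proof -
  let ?C = "code_of N1 N2 M" and ?R = "insert (one_word (N1 + N2)) (set M)"
  note C = code_of_code[OF M]
  have R: "?R \<subseteq> F2vecs (N1 + N2)" using M by (auto simp: mats_def)
  have orth: "even (beta N1 N2 r s)" if "r \<in> ?R" "s \<in> ?R" for r s
  proof -
    have "4 dvd wt N1 N2 t" "length t = N1 + N2" if "t \<in> ?R" for t
      using that d one R by (auto simp: dgood_def)
    then have "even (beta N1 N2 t (one_word (N1 + N2)))" if "t \<in> ?R" for t
      using that by (simp add: beta_one four_dvd_even)
    then show ?thesis using that d by (auto simp: dgood_def beta_commute[of _ _ "one_word (N1 + N2)"])
  qed
  have "?C \<subseteq> dual_code N1 N2 ?R"
    using orth R by (intro code_of_least is_code_dual) (auto simp: dual_code_iff)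
  then have RC: "?R \<subseteq> dual_code N1 N2 ?C"
    using R unfolding dual_code_iff subset_eq by (metis beta_commute in_F2vecs dual_code_iff)
  have "?C \<subseteq> dual_code N1 N2 ?C"
  proof (rule code_of_least)
    show "is_code N1 N2 (dual_code N1 N2 ?C)" by (rule is_code_dual) (use is_codeD(1)[OF C(1)] in auto)
  qed (use RC in auto)
  then have so: "even (beta N1 N2 u v)" if "u \<in> ?C" "v \<in> ?C" for u v
    using that by (auto simp: dual_code_iff)
  \<comment> \<open>On a self-orthogonal code weights are additive modulo 4, so this set is closed
    under addition.\<close>
  let ?D = "{c \<in> ?C. 4 dvd wt N1 N2 c}"
  have "is_code N1 N2 ?D"
    unfolding is_code_def
  proof (intro conjI ballI)
    show "?D \<subseteq> F2vecs (N1 + N2)" using is_codeD(1)[OF C(1)] by auto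
    show "zero_word (N1 + N2) \<in> ?D" using is_codeD(2)[OF C(1)] by (simp add: wt_eq_beta)
    fix u v assume "u \<in> ?D" "v \<in> ?D"
    then show "vadd u v \<in> ?D"
      using so[of u v] is_codeD[OF C(1)] by (simp add: wt_vadd four_dvd_polar)
  qed
  then have "?C \<subseteq> ?D" using C one d by (intro code_of_least) (auto simp: dgood_def)
  then show ?thesis using C by (auto simp: good_code_def doubly_even_def)
qed

lemma homog_space_eq: "homog_space m N1 N2 = cspan (nu N1 N2 ` mats m N1 N2)"
proof -
  have prods: "prod_list (map a fs) = (\<Prod>j<length fs. a (fs ! j))" for a :: "bool list \<Rightarrow> complex" and fs
    by (simp add: prod.list_conv_set_nth atLeast0LessThan)
  have "{monom fs gs | fs gs. length fs = N1 \<and> length gs = N2 \<and> set fs \<subseteq> F2vecs m \<and> set gs \<subseteq> F2vecs m}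
    = nu N1 N2 ` mats m N1 N2" (is "?L = ?R")
  proof (intro equalityI subsetI)
    fix p assume "p \<in> ?L"
    then obtain fs gs where fg: "p = monom fs gs" "length fs = N1" "length gs = N2"
      "set fs \<subseteq> F2vecs m" "set gs \<subseteq> F2vecs m" by blast
    define M where "M = map (\<lambda>i. map (\<lambda>j. (fs @ gs) ! j ! i) [0..<N1 + N2]) [0..<m]"
    have "length ((fs @ gs) ! j) = m" if "j < N1 + N2" for j
    proof -
      have "(fs @ gs) ! j \<in> set (fs @ gs)" using that fg by (intro nth_mem) simp
      then show ?thesis using fg by auto
    qed
    then have col: "col M j = (fs @ gs) ! j" if "j < N1 + N2" for j
      by (intro nth_equalityI) (use that in \<open>auto simp: M_def\<close>)
    have "p a b = nu N1 N2 M a b" for a b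
    proof -
      have "(\<Prod>j\<in>{N1..<N1 + N2}. b (col M j)) = (\<Prod>j<N2. b (gs ! j))"
        using fg by (intro prod.reindex_bij_witness[of _ "\<lambda>j. N1 + j" "\<lambda>j. j - N1"])
          (auto simp: col nth_append)
      moreover have "(\<Prod>j<N1. a (col M j)) = (\<Prod>j<N1. a (fs ! j))"
        using fg by (intro prod.cong) (auto simp: col nth_append)
      ultimately show ?thesis using fg by (simp add: monom_def prods nu_def)
    qed
    then have "p = nu N1 N2 M" by (intro ext)
    moreover have "M \<in> mats m N1 N2" by (auto simp: M_def mats_def)
    ultimately show "p \<in> ?R" by blast
  next
    fix p assume "p \<in> ?R"
    then obtain M where M: "M \<in> mats m N1 N2" "p = nu N1 N2 M" by blast
    let ?fs = "map (col M) [0..<N1]" and ?gs = "map (col M) [N1..<N1 + N2]"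
    have "nu N1 N2 M = monom ?fs ?gs"
    proof (intro ext)
      fix a b :: "bool list \<Rightarrow> complex"
      have "(\<Prod>j\<in>{N1..<N1 + N2}. b (col M j)) = (\<Prod>j<N2. b (col M (N1 + j)))"
        by (intro prod.reindex_bij_witness[of _ "\<lambda>j. N1 + j" "\<lambda>j. j - N1"]) auto
      then show "nu N1 N2 M a b = monom ?fs ?gs a b"
        by (simp only: nu_def monom_def prods) simp
    qed
    moreover have "length (col M j) = m" for j using matsD[OF M(1)] by simp
    ultimately show "p \<in> ?L" using M(2)
      by (intro CollectI exI[of _ ?fs] exI[of _ ?gs]) auto
  qed
  then show ?thesis by (simp add: homog_space_def)
qed

text \<open>The diagonal projection does not test the all-ones word. Translation by the first unit
  vector adds that word to the first row \<open>r\<close>, whose weight becomes the weight of the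
  all-ones word minus \<open>wt r\<close>; if both matrices survive, the all-ones word has weight
  divisible by 4.\<close>

lemma invariant_in_good_span:
  assumes m: "m \<ge> 1" and p: "p \<in> invariant_space m N1 N2"
  shows "p \<in> cspan (ccwe m N1 N2 ` {D. good_code N1 N2 D})" (is "_ \<in> ?V")
proof -
  obtain D where D: "adm m N1 N2 D" "\<And>M. M \<in> mats m N1 N2 \<Longrightarrow>
      D (nu N1 N2 M) = (if dgood N1 N2 M then nu N1 N2 M else 0)"
    by (rule adm_diag_projection[of m N1 N2]) blast
  obtain A where A: "adm m N1 N2 A" "\<And>M. M \<in> mats m N1 N2 \<Longrightarrow> \<exists>c. A (nu N1 N2 M) = cscale c
      (\<Sum>M'\<in>{M'\<in>mats m N1 N2. code_of N1 N2 M' = code_of N1 N2 M}. nu N1 N2 M')"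
    by (rule adm_affine_average[of m N1 N2]) blast
  let ?e = "True # zero_word (m - 1)"
  define t where "t = (\<lambda>x. if x \<in> F2vecs m then vadd (id x) ?e else x)"
  have t: "t \<in> affine_perms m" unfolding t_def by (rule translate_affine[OF id_affine]) (use m in simp)
  obtain g where g: "g \<in> clifford_group m"
    "\<And>M. M \<in> mats m N1 N2 \<Longrightarrow> act m g (nu N1 N2 M) = nu N1 N2 (colmap m N1 N2 t M)"
    using clifford_affine[OF t] by blast
  \<comment> \<open>The inner \<open>D\<close> tests \<open>M\<close>, the outer one its
    translate.\<close>
  define \<Omega> where "\<Omega> = (\<lambda>p. A (D (act m g (D p))))"
  have adm: "adm m N1 N2 \<Omega>"
    unfolding \<Omega>_def by (intro adm_comp[OF A(1)] adm_comp[OF D(1)] adm_comp[OF adm_act[OF g(1)]] D(1))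
  have lin: "linear_op A" "linear_op D" "linear_op \<Omega>" using A D adm by (auto simp: adm_def)
  have "\<Omega> (nu N1 N2 M) \<in> ?V" if M: "M \<in> mats m N1 N2" for M
  proof -
    let ?M = "colmap m N1 N2 t M"
    have zeros: "act m g 0 = 0" "D 0 = 0" "A 0 = 0"
      using lin linear_op_act by (blast intro: linear_op_zero)+
    show ?thesis
    proof (cases "dgood N1 N2 M \<and> dgood N1 N2 ?M")
      case True
      have "M ! 0 \<in> set M" "?M ! 0 \<in> set ?M"
        using m matsD(1)[OF M] matsD(1)[OF colmap_mats] by (auto intro!: nth_mem)
      then have w: "4 dvd wt N1 N2 (M ! 0)" "4 dvd wt N1 N2 (?M ! 0)"
        using True by (auto simp: dgood_def)
      have lM: "length (M ! 0) = N1 + N2" using matsD(2)[OF M, of 0] m by simp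
      have "?M ! 0 = vadd (M ! 0) (one_word (N1 + N2))"
      proof (rule nth_equalityI)
        fix j assume "j < length (?M ! 0)"
        then have "j < N1 + N2" using m by (simp add: colmap_def)
        then show "?M ! 0 ! j = vadd (M ! 0) (one_word (N1 + N2)) ! j"
          using m lM matsD(1)[OF M] by (simp add: colmap_def t_def nth_vadd)
      qed (use m lM in \<open>simp add: colmap_def\<close>)
      then have "wt N1 N2 (?M ! 0) = wt N1 N2 (one_word (N1 + N2)) - wt N1 N2 (M ! 0)"
        using lM by (simp add: wt_vadd beta_one)
      then have "4 dvd wt N1 N2 (one_word (N1 + N2))" using w by presburger
      then have "good_code N1 N2 (code_of N1 N2 ?M)"
        using True colmap_mats by (intro code_of_good) auto
      then have "orbit_sum (code_of N1 N2 ?M) \<in> ?V" by (rule orbit_sum_in_span)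
      moreover have "\<Omega> (nu N1 N2 M) = A (nu N1 N2 ?M)"
        using True by (simp add: \<Omega>_def D(2)[OF M] g(2)[OF M] D(2)[OF colmap_mats])
      ultimately show ?thesis
        using A(2)[OF colmap_mats, of t M] cm.span_scale by (auto simp: orbit_sum_def)
    next
      case False
      then have "\<Omega> (nu N1 N2 M) = 0"
        using zeros by (auto simp: \<Omega>_def D(2)[OF M] g(2)[OF M] D(2)[OF colmap_mats])
      then show ?thesis using cm.span_zero by simp
    qed
  qed
  then have "cspan (\<Omega> ` nu N1 N2 ` mats m N1 N2) \<subseteq> ?V"
    by (intro cm.span_minimal cm.subspace_span) auto
  moreover have "p \<in> cspan (nu N1 N2 ` mats m N1 N2)"
    using p homog_space_eq by (auto simp: invariant_space_def)
  then have "\<Omega> p \<in> cspan (\<Omega> ` nu N1 N2 ` mats m N1 N2)"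
    unfolding module_hom.span_image[OF lin(3)] by blast
  moreover have "\<Omega> p = p" using adm p by (auto simp: adm_def)
  ultimately show ?thesis by auto
qed

subsection \<open>The Hadamard transform of a weight enumerator\<close>

definition rests :: "bool list set \<Rightarrow> bool list list set" where
  "rests C = {R. length R = m - 1 \<and> set R \<subseteq> C}"

lemma sum_mats_Cons:
  assumes "m \<ge> 1"
  shows "(\<Sum>M\<in>{M. length M = m \<and> M \<noteq> [] \<and> hd M \<in> X \<and> set (tl M) \<subseteq> C}. f M)
    = (\<Sum>r\<in>X. \<Sum>R\<in>rests C. f (r # R))"
  unfolding sum.cartesian_product
  by (rule sum.reindex_bij_witness[of _ "\<lambda>(r, R). r # R" "\<lambda>M. (hd M, tl M)"])
    (use assms in \<open>auto simp: rests_def\<close>)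

lemma ccwe_Cons:
  assumes "m \<ge> 1"
  shows "ccwe m N1 N2 C = (\<Sum>r\<in>C. \<Sum>R\<in>rests C. nu N1 N2 (r # R))"
proof -
  have "{M. length M = m \<and> set M \<subseteq> C} = {M. length M = m \<and> M \<noteq> [] \<and> hd M \<in> C \<and> set (tl M) \<subseteq> C}"
    (is "?L = ?R")
  proof (intro set_eqI)
    fix M :: "bool list list"
    show "M \<in> ?L \<longleftrightarrow> M \<in> ?R" using assms by (cases M) auto
  qed
  then show ?thesis by (simp add: ccwe_def sum_mats_Cons[OF assms])
qed

text \<open>A MacWilliams identity in one row: only the first row is transformed, and summing the
  characters over all first rows in \<open>C\<close> leaves those in the dual code.\<close>

lemma hadamard_ccwe:
  assumes m: "m \<ge> 1" and C: "is_code N1 N2 C"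
    and g: "\<And>v w. length v = m \<Longrightarrow> length w = m \<Longrightarrow>
      g w v = (if tl w = tl v then hadamard (hd w) (hd v) else 0)"
  shows "act m g (ccwe m N1 N2 C) = cscale (of_nat (card C) / of_real (sqrt 2) ^ (N1 + N2))
    (\<Sum>c\<in>dual_code N1 N2 C. \<Sum>R\<in>rests C. nu N1 N2 (c # R))"
proof -
  let ?s = "1 / of_real (sqrt 2) ^ (N1 + N2) :: complex"
  have one: "act m g (nu N1 N2 (r # R))
      = cscale ?s (\<Sum>c\<in>F2vecs (N1 + N2). cscale (chi N1 N2 c r) (nu N1 N2 (c # R)))"
    if "r \<in> C" "R \<in> rests C" for r R
  proof (rule act_hadamard_matrix)
    show "length r = N1 + N2" "set R \<subseteq> F2vecs (N1 + N2)" "m = Suc (length R)"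
      using that is_codeD(1)[OF C] m by (auto simp: rests_def)
  qed (use g in auto)
  have "act m g (ccwe m N1 N2 C) = (\<Sum>r\<in>C. \<Sum>R\<in>rests C. act m g (nu N1 N2 (r # R)))"
    unfolding ccwe_Cons[OF m] by (simp only: module_hom.sum[OF linear_op_act])
  also have "\<dots> = (\<Sum>r\<in>C. \<Sum>R\<in>rests C. cscale ?s (\<Sum>c\<in>F2vecs (N1 + N2). cscale (chi N1 N2 c r) (nu N1 N2 (c # R))))"
    by (intro sum.cong refl one)
  also have "\<dots> = cscale ?s (\<Sum>c\<in>F2vecs (N1 + N2). \<Sum>R\<in>rests C. cscale (\<Sum>r\<in>C. chi N1 N2 c r) (nu N1 N2 (c # R)))"
  proof (intro ext)
    fix a b
    have "(\<Sum>r\<in>C. \<Sum>R\<in>rests C. \<Sum>c\<in>F2vecs (N1 + N2). chi N1 N2 c r * nu N1 N2 (c # R) a b)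
      = (\<Sum>c\<in>F2vecs (N1 + N2). \<Sum>R\<in>rests C. \<Sum>r\<in>C. chi N1 N2 c r * nu N1 N2 (c # R) a b)"
      by (subst sum.swap, subst (2) sum.swap, subst sum.swap) (rule refl)
    then show "(\<Sum>r\<in>C. \<Sum>R\<in>rests C. cscale ?s (\<Sum>c\<in>F2vecs (N1 + N2). cscale (chi N1 N2 c r) (nu N1 N2 (c # R)))) a b
      = cscale ?s (\<Sum>c\<in>F2vecs (N1 + N2). \<Sum>R\<in>rests C. cscale (\<Sum>r\<in>C. chi N1 N2 c r) (nu N1 N2 (c # R))) a b"
      by (simp add: cscale_apply sum_fun_apply2 sum_distrib_right flip: sum_distrib_left sum_divide_distrib)
  qed
  also have "(\<Sum>c\<in>F2vecs (N1 + N2). \<Sum>R\<in>rests C. cscale (\<Sum>r\<in>C. chi N1 N2 c r) (nu N1 N2 (c # R)))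
      = (\<Sum>c\<in>F2vecs (N1 + N2). if c \<in> dual_code N1 N2 C
          then cscale (of_nat (card C)) (\<Sum>R\<in>rests C. nu N1 N2 (c # R)) else 0)"
  proof (rule sum.cong[OF refl])
    fix c assume "c \<in> F2vecs (N1 + N2)"
    then have "(\<Sum>r\<in>C. chi N1 N2 c r) = (if c \<in> dual_code N1 N2 C then of_nat (card C) else 0)"
      using sum_chi[OF C, of c] by (simp add: chi_commute)
    then show "(\<Sum>R\<in>rests C. cscale (\<Sum>r\<in>C. chi N1 N2 c r) (nu N1 N2 (c # R)))
      = (if c \<in> dual_code N1 N2 C then cscale (of_nat (card C)) (\<Sum>R\<in>rests C. nu N1 N2 (c # R)) else 0)"
      by (simp add: cm.scale_sum_right)
  qed
  also have "\<dots> = (\<Sum>c\<in>dual_code N1 N2 C. cscale (of_nat (card C)) (\<Sum>R\<in>rests C. nu N1 N2 (c # R)))"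
  proof -
    have "F2vecs (N1 + N2) \<inter> dual_code N1 N2 C = dual_code N1 N2 C" by (auto simp: dual_code_iff)
    then show ?thesis by (simp flip: sum.inter_restrict)
  qed
  finally show ?thesis by (simp add: flip: cm.scale_sum_right)
qed

end

section \<open>A triangular operator on weight enumerators\<close>

lemma power_commutes_exp: "((x :: 'a :: monoid_mult) ^ n) ^ k = (x ^ k) ^ n"
  by (simp add: mult.commute flip: power_mult)

text \<open>The square of the factor in \<open>hadamard_ccwe\<close>. It is 1 for a self-dual code
  and below 1 for every other good code, since a good code lies in its dual.\<close>

lemma sqrt_power_dual:
  assumes "is_code N1 N2 C"
  shows "(of_nat (card C) / sqrt 2 ^ (N1 + N2))\<^sup>2 = card C / card (dual_code N1 N2 C)"
proof -
  have c: "card C * card (dual_code N1 N2 C) = 2 ^ (N1 + N2)" by (rule card_dual_code[OF assms])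
  have pos: "card C > 0" "card (dual_code N1 N2 C) > 0" using c by (auto intro: Nat.gr0I)
  have "(sqrt 2 ^ (N1 + N2))\<^sup>2 = (2 :: real) ^ (N1 + N2)"
    by (subst power_commutes_exp) simp
  also have "\<dots> = real (card C * card (dual_code N1 N2 C))" unfolding c by simp
  finally have "(sqrt 2 ^ (N1 + N2))\<^sup>2 = real (card C) * real (card (dual_code N1 N2 C))" by simp
  then show ?thesis using pos by (simp add: power_divide power2_eq_square)
qed

context
  fixes m N1 N2 :: nat
begin

text \<open>The words that can be adjoined to a good \<open>C\<close> to obtain a larger good code,
  see \<open>adjoin_good\<close>.\<close>

definition ext_words :: "bool list set \<Rightarrow> bool list set" where
  "ext_words C = {r \<in> dual_code N1 N2 C. 4 dvd wt N1 N2 r} - C"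

text \<open>When the rows lie in \<open>adjoin C x\<close> with \<open>x\<close> outside
  \<open>C\<close>, this is the class of \<open>M\<close> modulo \<open>C\<close>: the quotient has
  two elements, so the class is a vector over \<open>F_2\<close>.\<close>

definition cls :: "bool list set \<Rightarrow> bool list list \<Rightarrow> bool list" where
  "cls C M = map (\<lambda>r. r \<notin> C) M"

definition class_mats :: "bool list set \<Rightarrow> bool list \<Rightarrow> bool list \<Rightarrow> bool list list set" where
  "class_mats C x u = {M \<in> mats m N1 N2. set M \<subseteq> adjoin C x \<and> cls C M = u}"

lemma additive_perm_matrix:
  assumes f: "f permutes F2vecs m" "additive_on m f"
  obtains A where "\<And>v. length v = m \<Longrightarrow> f v = f2matvec m A v"
proof -
  obtain A v' where A: "length v' = m" "\<And>v. length v = m \<Longrightarrow> f v = vadd (f2matvec m A v) v'"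
    by (rule affine_perm_matrix[OF additive_affine[OF f]]) auto
  have z: "length (zero_word m) = m" by simp
  have "f (vadd (zero_word m) (zero_word m)) = vadd (f (zero_word m)) (f (zero_word m))"
    using f(2) z by (simp only: additive_on_def in_F2vecs)
  then have "f (zero_word m) = zero_word m"
    using affine_permsD(2)[OF additive_affine[OF f] z] unfolding vadd_self by simp
  moreover have "f2matvec m A (zero_word m) = zero_word m"
    using f2matvec_vadd[OF z z, of A] by simp
  ultimately have "v' = zero_word m" using A(2)[OF z] A(1) by simp
  then show ?thesis using that A(2) by simp
qed

text \<open>Row combinations commute with reduction modulo \<open>C\<close>
  (\<open>comb_notin_code\<close>), so a linear map acts on the class vector as it does on a
  column.\<close>

lemma cls_colmap:
  assumes C: "is_code N1 N2 C" and x: "length x = N1 + N2" "x \<notin> C"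
    and M: "M \<in> mats m N1 N2" "set M \<subseteq> adjoin C x" and f: "f permutes F2vecs m" "additive_on m f"
  shows "cls C (colmap m N1 N2 f M) = f (cls C M)" "set (colmap m N1 N2 f M) \<subseteq> adjoin C x"
proof -
  obtain A where A: "\<And>v. length v = m \<Longrightarrow> f v = f2matvec m A v"
    using additive_perm_matrix[OF f] by blast
  have A': "f v = vadd (f2matvec m A v) (zero_word m)" if "length v = m" for v using A[OF that] by simp
  have row: "colmap m N1 N2 f M ! i = comb N1 N2 {k. k < m \<and> A i k} ((!) M)" if "i < m" for i
    using row_colmap[OF M(1) that A'] that by (simp add: comb_def)
  have Mk: "M ! k \<in> adjoin C x" if "k < m" for k using M matsD(1)[OF M(1)] that nth_mem by blast
  have lc: "length (cls C M) = m" using matsD(1)[OF M(1)] by (simp add: cls_def)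
  have len: "length (colmap m N1 N2 f M) = m" by (simp add: colmap_def)
  show "cls C (colmap m N1 N2 f M) = f (cls C M)"
  proof (rule nth_equalityI)
    show "length (cls C (colmap m N1 N2 f M)) = length (f (cls C M))"
      using A[OF lc] len by (simp add: cls_def)
    fix i assume "i < length (cls C (colmap m N1 N2 f M))"
    then have i: "i < m" using len by (simp add: cls_def)
    have "cls C (colmap m N1 N2 f M) ! i \<longleftrightarrow> par {k. k < m \<and> A i k} (\<lambda>k. M ! k \<notin> C)"
      using i len Mk row[OF i] comb_notin_code[OF C x, of "{k. k < m \<and> A i k}" "(!) M"]
      by (simp add: cls_def)
    also have "\<dots> \<longleftrightarrow> par {..<m} (\<lambda>k. A i k \<and> cls C M ! k)"
      unfolding par_Collect using matsD(1)[OF M(1)] by (intro par_cong) (auto simp: cls_def)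
    also have "\<dots> \<longleftrightarrow> f (cls C M) ! i" using A[OF lc] i by (simp add: nth_f2matvec)
    finally show "cls C (colmap m N1 N2 f M) ! i = f (cls C M) ! i" .
  qed
  show "set (colmap m N1 N2 f M) \<subseteq> adjoin C x"
  proof
    fix r assume "r \<in> set (colmap m N1 N2 f M)"
    then obtain i where "i < m" "r = colmap m N1 N2 f M ! i" using len by (auto simp: in_set_conv_nth)
    then show "r \<in> adjoin C x"
      using row comb_in_code[OF is_code_adjoin[OF C x(1)], of "{k. k < m \<and> A i k}" "(!) M"] Mk by simp
  qed
qed

lemma additive_inv:
  assumes f: "f permutes F2vecs m" "additive_on m f"
  shows "additive_on m (inv f)"
  unfolding additive_on_def
proof (intro ballI)
  fix x y assume "x \<in> F2vecs m" "y \<in> F2vecs m"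
  then have l: "inv f x \<in> F2vecs m" "inv f y \<in> F2vecs m"
    using permutes_in_image[OF permutes_inv[OF f(1)]] by auto
  then have "f (vadd (inv f x) (inv f y)) = vadd x y"
    using f(2) permutes_inverses(1)[OF f(1)] by (simp add: additive_on_def)
  then show "inv f (vadd x y) = vadd (inv f x) (inv f y)"
    by (metis permutes_inverses(2)[OF f(1)])
qed

lemma sum_class_mats_colmap:
  assumes C: "is_code N1 N2 C" and x: "length x = N1 + N2" "x \<notin> C"
    and f: "f permutes F2vecs m" "additive_on m f"
  shows "(\<Sum>M\<in>class_mats C x u. h (colmap m N1 N2 f M)) = (\<Sum>M\<in>class_mats C x (f u). h M)"
proof (rule sum.reindex_bij_witness[of _ "colmap m N1 N2 (inv f)" "colmap m N1 N2 f"])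
  note af = additive_affine[OF f]
  fix M assume "M \<in> class_mats C x u"
  then show "colmap m N1 N2 (inv f) (colmap m N1 N2 f M) = M"
    "colmap m N1 N2 f M \<in> class_mats C x (f u)" "h (colmap m N1 N2 f M) = h (colmap m N1 N2 f M)"
    using cls_colmap[OF C x _ _ f] af by (auto simp: class_mats_def colmap_inv colmap_mats)
next
  note fi = permutes_inv[OF f(1)] additive_inv[OF f]
  note af = additive_affine[OF f]
  fix M assume "M \<in> class_mats C x (f u)"
  then show "colmap m N1 N2 f (colmap m N1 N2 (inv f) M) = M"
    "colmap m N1 N2 (inv f) M \<in> class_mats C x u"
    using cls_colmap[OF C x _ _ fi] af permutes_inverses(2)[OF f(1)]
    by (auto simp: class_mats_def colmap_inv colmap_mats)
qed

text \<open>Class zero means that all rows lie in \<open>C\<close>, so the nonzero classes make up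
  the difference of the two enumerators.\<close>

lemma sum_class_mats:
  assumes C: "is_code N1 N2 C" and x: "length x = N1 + N2"
  shows "(\<Sum>u\<in>F2vecs m - {zero_word m}. \<Sum>M\<in>class_mats C x u. nu N1 N2 M)
    = ccwe m N1 N2 (adjoin C x) - ccwe m N1 N2 C"
proof -
  let ?S = "{M \<in> mats m N1 N2. set M \<subseteq> adjoin C x}"
  have fin: "finite ?S" using finite_mats by auto
  have "(\<Sum>M\<in>?S. nu N1 N2 M) = (\<Sum>u\<in>F2vecs m. \<Sum>M\<in>{M\<in>?S. cls C M = u}. nu N1 N2 M)"
    by (rule sum.group[symmetric]) (use fin matsD(1) in \<open>auto simp: cls_def\<close>)
  also have "\<dots> = (\<Sum>u\<in>F2vecs m. \<Sum>M\<in>class_mats C x u. nu N1 N2 M)"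
    by (intro sum.cong) (auto simp: class_mats_def)
  also have "\<dots> = (\<Sum>M\<in>class_mats C x (zero_word m). nu N1 N2 M)
      + (\<Sum>u\<in>F2vecs m - {zero_word m}. \<Sum>M\<in>class_mats C x u. nu N1 N2 M)"
    by (rule sum.remove) auto
  also have "class_mats C x (zero_word m) = {M \<in> mats m N1 N2. set M \<subseteq> C}"
  proof -
    have "cls C M = zero_word m \<longleftrightarrow> set M \<subseteq> C" if "M \<in> mats m N1 N2" for M
      using matsD(1)[OF that] by (auto simp: cls_def list_eq_iff_nth_eq all_set_conv_all_nth subset_eq)
    then show ?thesis by (auto simp: class_mats_def adjoin_def)
  qed
  finally show ?thesis
    unfolding ccwe_eq[OF C] ccwe_eq[OF is_code_adjoin[OF C x]] eq_diff_eq by (simp only: add.commute)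
qed

text \<open>A column map permutes the matrices with rows in \<open>C\<close>, because the all-ones
  word in \<open>C\<close> absorbs translations.\<close>

lemma act_colmap_ccwe:
  assumes C: "is_code N1 N2 C" "one_word (N1 + N2) \<in> C" and f: "f \<in> affine_perms m"
    and g: "\<And>M. M \<in> mats m N1 N2 \<Longrightarrow> act m g (nu N1 N2 M) = nu N1 N2 (colmap m N1 N2 f M)"
  shows "act m g (ccwe m N1 N2 C) = ccwe m N1 N2 C"
proof -
  let ?S = "{M \<in> mats m N1 N2. set M \<subseteq> C}"
  have "act m g (ccwe m N1 N2 C) = (\<Sum>M\<in>?S. nu N1 N2 (colmap m N1 N2 f M))"
    unfolding ccwe_eq[OF C(1)] module_hom.sum[OF linear_op_act] by (rule sum.cong) (use g in auto)
  also have "\<dots> = ccwe m N1 N2 C"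
    unfolding ccwe_eq[OF C(1)]
  proof (rule sum.reindex_bij_witness[of _ "colmap m N1 N2 (inv f)" "colmap m N1 N2 f"])
    fix M assume "M \<in> ?S"
    then show "colmap m N1 N2 (inv f) (colmap m N1 N2 f M) = M"
      "colmap m N1 N2 f (colmap m N1 N2 (inv f) M) = M"
      "colmap m N1 N2 f M \<in> ?S" "colmap m N1 N2 (inv f) M \<in> ?S"
      using colmap_inv[OF _ f] colmap_mats colmap_rows_in_code[OF _ _ C f]
        colmap_rows_in_code[OF _ _ C inv_affine[OF f]] by blast+
  qed simp
  finally show ?thesis .
qed

text \<open>Turns a sum over new first rows into a sum over one-step extensions.
  \<open>ext_words C\<close> is a union of cosets of \<open>C\<close>, and the factor
  \<open>card C\<close> accounts for the words of a coset that lead to the same extension.\<close>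

lemma sum_ext_words:
  assumes m: "m \<ge> 1" and C: "good_code N1 N2 C"
  shows "cscale (of_nat (card C)) (\<Sum>r\<in>ext_words C. \<Sum>R\<in>rests m C. nu N1 N2 (r # R))
    = (\<Sum>x\<in>ext_words C. \<Sum>M\<in>class_mats C x (True # zero_word (m - 1)). nu N1 N2 M)"
proof -
  have c: "is_code N1 N2 C" "doubly_even N1 N2 C" using C by (auto simp: good_code_def)
  let ?B = "\<lambda>r. \<Sum>R\<in>rests m C. nu N1 N2 (r # R)" and ?e = "True # zero_word (m - 1)"
  have ext_len: "length x = N1 + N2" if "x \<in> ext_words C" for x using that by (auto simp: ext_words_def dual_code_iff)
  have ext_add: "vadd c x \<in> ext_words C" if "c \<in> C" "x \<in> ext_words C" for c x
  proof -
    have "c \<in> dual_code N1 N2 C" "4 dvd wt N1 N2 c" "even (beta N1 N2 c x)"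
      using that good_code_sub_dual[OF C] c(2) by (auto simp: ext_words_def dual_code_iff doubly_even_def)
    moreover have "C \<subseteq> F2vecs (N1 + N2)" using is_codeD(1)[OF c(1)] by auto
    ultimately show ?thesis
      using that c(1) is_codeD(1)[OF c(1)] ext_len[OF that(2)]
        is_codeD(3)[OF is_code_dual[of C N1 N2]]
      by (auto simp: ext_words_def wt_vadd four_dvd_polar vadd_in_code_iff[OF c(1)])
  qed
  \<comment> \<open>Translation by a word of \<open>C\<close> permutes \<open>ext_words C\<close>,
    so inserting an extra sum over \<open>C\<close> only multiplies by
    \<open>card C\<close>.\<close>
  have shift: "(\<Sum>x\<in>ext_words C. ?B (vadd c x)) = (\<Sum>x\<in>ext_words C. ?B x)" if cC: "c \<in> C" for c
    by (rule sum.reindex_bij_witness[of _ "vadd c" "vadd c"])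
      (use cC ext_add ext_len is_codeD(1)[OF c(1)] in auto)
  have coset: "(\<Sum>c\<in>C. ?B (vadd c x)) = (\<Sum>M\<in>class_mats C x ?e. nu N1 N2 M)"
    if x: "x \<in> ext_words C" for x
  proof -
    have lx: "length x = N1 + N2" "x \<notin> C" using x ext_len by (auto simp: ext_words_def)
    have "(\<Sum>c\<in>C. ?B (vadd c x)) = (\<Sum>r\<in>vadd x ` C. ?B r)"
    proof (subst sum.reindex)
      show "inj_on (vadd x) C" using lx is_codeD(1)[OF c(1)] by (auto simp: inj_on_def)
    qed (simp add: vadd.commute[of x])
    also have "\<dots> = (\<Sum>M\<in>{M. length M = m \<and> M \<noteq> [] \<and> hd M \<in> vadd x ` C \<and> set (tl M) \<subseteq> C}. nu N1 N2 M)"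
      by (rule sum_mats_Cons[OF m, symmetric])
    also have "{M. length M = m \<and> M \<noteq> [] \<and> hd M \<in> vadd x ` C \<and> set (tl M) \<subseteq> C} = class_mats C x ?e"
      (is "?L = ?R")
    proof (intro set_eqI)
      fix M
      show "M \<in> ?L \<longleftrightarrow> M \<in> ?R"
      proof (cases M)
        case Nil
        then show ?thesis using m by (auto simp: class_mats_def mats_def)
      next
        case (Cons r R)
        have r: "r \<in> vadd x ` C \<longleftrightarrow> r \<in> adjoin C x \<and> r \<notin> C"
          using lx by (auto simp: adjoin_def vadd_in_code_iff[OF c(1)])
        have R: "set R \<subseteq> C \<longleftrightarrow> set R \<subseteq> adjoin C x \<and> map (\<lambda>r. r \<notin> C) R = zero_word (length R)"
          by (auto simp: adjoin_def list_eq_iff_nth_eq all_set_conv_all_nth subset_eq)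
        have sub: "adjoin C x \<subseteq> F2vecs (N1 + N2)" using is_codeD(1)[OF is_code_adjoin[OF c(1) lx(1)]] by auto
        show ?thesis
          unfolding Cons using m sub by (auto simp: class_mats_def mats_def cls_def r R)
      qed
    qed
    finally show ?thesis .
  qed
  have "(\<Sum>x\<in>ext_words C. \<Sum>M\<in>class_mats C x ?e. nu N1 N2 M) = (\<Sum>x\<in>ext_words C. \<Sum>c\<in>C. ?B (vadd c x))"
    by (rule sum.cong) (simp_all add: coset)
  also have "\<dots> = (\<Sum>c\<in>C. \<Sum>x\<in>ext_words C. ?B (vadd c x))" by (rule sum.swap)
  also have "\<dots> = (\<Sum>c\<in>C. \<Sum>x\<in>ext_words C. ?B x)" by (rule sum.cong) (simp_all add: shift)
  also have "\<dots> = cscale (of_nat (card C)) (\<Sum>x\<in>ext_words C. ?B x)"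
    by (intro ext) (simp add: cscale_apply sum_fun_apply2)
  finally show ?thesis ..
qed

text \<open>\<open>GL(m,2)\<close> is transitive on nonzero vectors: the two-element graph sending 0
  to 0 and the first unit vector to \<open>u\<close> extends to a full isomorphism.\<close>

lemma transvection:
  assumes "m \<ge> 1" "u \<in> F2vecs m - {zero_word m}"
  obtains f where "f permutes F2vecs m" "additive_on m f" "f (True # zero_word (m - 1)) = u"
proof -
  let ?e = "True # zero_word (m - 1)"
  have ne: "?e \<noteq> zero_word m" using assms(1) by (cases m) auto
  have "partial_iso m {(zero_word m, zero_word m), (?e, u)}"
    using assms ne by (auto simp: partial_iso_def)
  from partial_iso_extend[OF this] obtain f where f: "f permutes F2vecs m" "additive_on m f"
    "\<And>x y. (x, y) \<in> {(zero_word m, zero_word m), (?e, u)} \<Longrightarrow> f x = y"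
    by blast
  show ?thesis by (rule that[OF f(1,2)]) (simp add: f(3))
qed

text \<open>\<open>T\<close> applies the Hadamard transform, projects back with the diagonal matrices and then
  averages over linear maps moving the first coordinate to every nonzero vector. It is triangular
  with respect to inclusion of codes, and only self-dual codes give the eigenvalue 1.\<close>

lemma triangular_operator:
  assumes m: "m \<ge> 1"
  obtains T where "adm m N1 N2 T"
    "\<And>C. good_code N1 N2 C \<Longrightarrow> \<exists>c y. T (ccwe m N1 N2 C) = cscale c (ccwe m N1 N2 C) + y
      \<and> y \<in> cspan (ccwe m N1 N2 ` {D. good_code N1 N2 D \<and> C \<subset> D})
      \<and> (C \<noteq> dual_code N1 N2 C \<longrightarrow> c \<noteq> 1)"
proof -
  let ?e = "True # zero_word (m - 1)" and ?U = "F2vecs m - {zero_word m}"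
  have e: "?e \<in> ?U" using m by (cases m) auto
  obtain D where D: "adm m N1 N2 D" "\<And>M. M \<in> mats m N1 N2 \<Longrightarrow>
      D (nu N1 N2 M) = (if dgood N1 N2 M then nu N1 N2 M else 0)"
    by (rule adm_diag_projection[of m N1 N2]) blast
  have "\<forall>u\<in>?U. \<exists>f. f permutes F2vecs m \<and> additive_on m f \<and> f ?e = u"
    using transvection[OF m] by metis
  then obtain f where f: "\<And>u. u \<in> ?U \<Longrightarrow> f u permutes F2vecs m"
    "\<And>u. u \<in> ?U \<Longrightarrow> additive_on m (f u)" "\<And>u. u \<in> ?U \<Longrightarrow> f u ?e = u"
    by metis
  have "\<forall>u\<in>?U. \<exists>g. g \<in> clifford_group m \<and>
      (\<forall>M\<in>mats m N1 N2. act m g (nu N1 N2 M) = nu N1 N2 (colmap m N1 N2 (f u) M))"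
    using clifford_affine[OF additive_affine] f by metis
  then obtain g where g: "\<And>u. u \<in> ?U \<Longrightarrow> g u \<in> clifford_group m"
    "\<And>u M. u \<in> ?U \<Longrightarrow> M \<in> mats m N1 N2 \<Longrightarrow>
      act m (g u) (nu N1 N2 M) = nu N1 N2 (colmap m N1 N2 (f u) M)"
    by metis
  define n where "n = card ?U"
  define Av where "Av = (\<lambda>p. cscale (1 / of_nat n) (\<Sum>u\<in>?U. act m (g u) p))"
  define T where "T = (\<lambda>p. Av (D (act m (gen_h m) p)))"
  have Av: "adm m N1 N2 Av"
    unfolding Av_def n_def
  proof (rule adm_avg)
    show "?U \<noteq> {}" using e by blast
    show "finite ?U" by simp
    show "adm m N1 N2 (act m (g u))" if "u \<in> ?U" for u by (rule adm_act[OF g(1)[OF that]])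
  qed
  have lin: "linear_op D" "linear_op Av" using D(1) Av by (auto simp: adm_def)
  have "adm m N1 N2 (act m (gen_h m))" by (intro adm_act clifford_group.gen_h)
  then have admT: "adm m N1 N2 T" unfolding T_def by (intro adm_comp[OF Av] adm_comp[OF D(1)])
  have Upos: "n > 0" unfolding n_def using e card_gt_0_iff[of ?U] finite_F2vecs by (metis empty_iff finite_Diff)
  have "\<exists>c y. T (ccwe m N1 N2 C) = cscale c (ccwe m N1 N2 C) + y
      \<and> y \<in> cspan (ccwe m N1 N2 ` {D. good_code N1 N2 D \<and> C \<subset> D})
      \<and> (C \<noteq> dual_code N1 N2 C \<longrightarrow> c \<noteq> 1)" if C: "good_code N1 N2 C" for C
  proof -
    have c: "is_code N1 N2 C" "doubly_even N1 N2 C" "one_word (N1 + N2) \<in> C" using C by (auto simp: good_code_def)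
    define E where "E = ccwe m N1 N2"
    define B where "B r = (\<Sum>R\<in>rests m C. nu N1 N2 (r # R))" for r
    define k where "k = real (card C) / sqrt 2 ^ (N1 + N2)"
    define X where "X = ext_words C"
    have inX: "x \<notin> C" "length x = N1 + N2" "x \<in> dual_code N1 N2 C" "4 dvd wt N1 N2 x" if "x \<in> X" for x
      using that by (auto simp: X_def ext_words_def dual_code_iff)
    have finX: "finite X"
      by (rule finite_subset[of _ "F2vecs (N1 + N2)"]) (auto simp: inX)
    have Cpos: "card C > 0" using is_code_finite[OF c(1)] c(3) by (auto simp: card_gt_0_iff)
    have kC: "of_nat (card C) / of_real (sqrt 2) ^ (N1 + N2) = complex_of_real k" by (simp add: k_def)
    have h: "act m (gen_h m) (E C) = cscale (of_real k) (\<Sum>r\<in>dual_code N1 N2 C. B r)"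
      unfolding E_def B_def kC[symmetric]
      by (rule hadamard_ccwe[OF m c(1)]) (simp add: gen_h_def restr_def)
    \<comment> \<open>The rows of \<open>R\<close> lie in \<open>C\<close> and \<open>r\<close> is
      orthogonal to \<open>C\<close>, so only the weight of \<open>r\<close> decides whether the
      monomial survives.\<close>
    have DB: "D (B r) = (if r \<in> C \<union> X then B r else 0)" if r: "r \<in> dual_code N1 N2 C" for r
    proof -
      have "dgood N1 N2 (r # R) \<longleftrightarrow> r \<in> C \<union> X" if R: "R \<in> rests m C" for R
      proof -
        have "r \<in> C \<union> X \<longleftrightarrow> 4 dvd wt N1 N2 r"
          using r c(2) by (auto simp: X_def ext_words_def doubly_even_def)
        moreover have "4 dvd wt N1 N2 s" "even (beta N1 N2 s r)" "even (beta N1 N2 r s)" if "s \<in> set R" for s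
          using that R r c(2) by (auto simp: rests_def doubly_even_def dual_code_iff beta_commute[of _ _ r])
        moreover have "even (beta N1 N2 s t)" if "s \<in> set R" "t \<in> set R" for s t
          using that R doubly_even_self_orth[OF c(1,2)] by (auto simp: rests_def)
        ultimately show ?thesis
          by (auto simp: dgood_def four_dvd_even simp flip: wt_eq_beta)
      qed
      moreover have "r # R \<in> mats m N1 N2" if "R \<in> rests m C" for R
        using that r m is_codeD(1)[OF c(1)] by (auto simp: rests_def mats_def dual_code_iff)
      ultimately have "D (nu N1 N2 (r # R)) = (if r \<in> C \<union> X then nu N1 N2 (r # R) else 0)"
        if "R \<in> rests m C" for R
        using D(2) that by simp
      then have "D (B r) = (\<Sum>R\<in>rests m C. if r \<in> C \<union> X then nu N1 N2 (r # R) else 0)"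
        unfolding B_def module_hom.sum[OF lin(1)] by (intro sum.cong) auto
      then show ?thesis by (simp add: B_def)
    qed
    have sub: "C \<union> X \<subseteq> dual_code N1 N2 C" using good_code_sub_dual[OF C] inX by auto
    have "finite (dual_code N1 N2 C)"
      by (rule finite_subset[of _ "F2vecs (N1 + N2)"]) (auto simp: dual_code_iff)
    then have "D (\<Sum>r\<in>dual_code N1 N2 C. B r) = (\<Sum>r\<in>C \<union> X. B r)"
      unfolding module_hom.sum[OF lin(1)] using sub DB
      by (intro sum.mono_neutral_cong_right) auto
    also have "\<dots> = (\<Sum>r\<in>C. B r) + (\<Sum>r\<in>X. B r)"
      using finX is_code_finite[OF c(1)] by (intro sum.union_disjoint) (auto simp: inX)
    also have "(\<Sum>r\<in>C. B r) = E C" by (simp add: E_def B_def ccwe_Cons[OF m])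
    finally have DC: "D (\<Sum>r\<in>dual_code N1 N2 C. B r) = E C + (\<Sum>r\<in>X. B r)" .
    have "(\<Sum>r\<in>X. B r) = cscale (1 / of_nat (card C)) (cscale (of_nat (card C)) (\<Sum>r\<in>X. B r))"
      using Cpos by simp
    also have "\<dots> = cscale (1 / of_nat (card C)) (\<Sum>x\<in>X. \<Sum>M\<in>class_mats C x ?e. nu N1 N2 M)"
      unfolding X_def B_def sum_ext_words[OF m C] ..
    finally have XB: "(\<Sum>r\<in>X. B r) = cscale (1 / of_nat (card C)) (\<Sum>x\<in>X. \<Sum>M\<in>class_mats C x ?e. nu N1 N2 M)" .
    have AvE: "Av (E C) = E C"
    proof -
      have "act m (g u) (E C) = E C" if "u \<in> ?U" for u
        unfolding E_def using act_colmap_ccwe[OF c(1,3) additive_affine[OF f(1,2)[OF that]]] g(2)[OF that] by blast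
      then have eq: "(\<Sum>u\<in>?U. act m (g u) (E C)) = (\<Sum>u\<in>?U. E C)" by (rule sum.cong[OF refl])
      have "finite ?U" "?U \<noteq> {}" using e by (simp, blast)
      then show ?thesis unfolding Av_def n_def eq by (rule average_const)
    qed
    \<comment> \<open>Moving class \<open>?e\<close> to every nonzero class collects all matrices
      with rows in \<open>adjoin C x\<close> but not all in \<open>C\<close>. This subtraction of
      \<open>E C\<close> is the source of the negative term in the eigenvalue.\<close>
    have AvM: "Av (\<Sum>M\<in>class_mats C x ?e. nu N1 N2 M) = cscale (1 / of_nat n) (E (adjoin C x) - E C)"
      if x: "x \<in> X" for x
    proof -
      have "act m (g u) (\<Sum>M\<in>class_mats C x ?e. nu N1 N2 M) = (\<Sum>M\<in>class_mats C x u. nu N1 N2 M)"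
        if u: "u \<in> ?U" for u
      proof -
        have "act m (g u) (\<Sum>M\<in>class_mats C x ?e. nu N1 N2 M)
            = (\<Sum>M\<in>class_mats C x ?e. nu N1 N2 (colmap m N1 N2 (f u) M))"
          unfolding module_hom.sum[OF linear_op_act]
          by (rule sum.cong) (use g(2)[OF u] in \<open>auto simp: class_mats_def\<close>)
        also have "\<dots> = (\<Sum>M\<in>class_mats C x (f u ?e). nu N1 N2 M)"
          by (rule sum_class_mats_colmap[OF c(1) inX(2,1)[OF x] f(1,2)[OF u]])
        finally show ?thesis by (simp only: f(3)[OF u])
      qed
      then have "(\<Sum>u\<in>?U. act m (g u) (\<Sum>M\<in>class_mats C x ?e. nu N1 N2 M)) = E (adjoin C x) - E C"
        unfolding E_def sum_class_mats[OF c(1) inX(2)[OF x], symmetric] by (rule sum.cong[OF refl])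
      then show ?thesis by (simp add: Av_def)
    qed
    \<comment> \<open>Combines the \<open>card C\<close> words of a coset with the average over the
      \<open>n\<close> nonzero vectors.\<close>
    define d where "d = real (card C) * real n"
    have d: "d > 0" using Cpos Upos unfolding d_def by (simp only: of_nat_0_less_iff mult_pos_pos)
    have "T (E C) = cscale (of_real k) (Av (E C) + Av (\<Sum>r\<in>X. B r))"
      unfolding T_def h module_hom.scale[OF lin(1)] DC module_hom.scale[OF lin(2)] module_hom.add[OF lin(2)] ..
    also have "Av (\<Sum>r\<in>X. B r) = cscale (1 / of_nat (card C))
        (\<Sum>x\<in>X. cscale (1 / of_nat n) (E (adjoin C x) - E C))"
      unfolding XB module_hom.scale[OF lin(2)] module_hom.sum[where S = X, OF lin(2)]
      by (intro arg_cong[of _ _ "cscale _"] sum.cong refl AvM)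
    also have "\<dots> = (\<Sum>x\<in>X. cscale (of_real (1 / d)) (E (adjoin C x) - E C))"
      by (simp add: cm.scale_sum_right d_def)
    also have "cscale (of_real k) (Av (E C) + (\<Sum>x\<in>X. cscale (of_real (1 / d)) (E (adjoin C x) - E C)))
      = cscale (of_real (k * (1 - card X / d))) (E C)
        + cscale (of_real (k / d)) (\<Sum>x\<in>X. E (adjoin C x))"
      unfolding AvE
      by (intro ext) (simp add: cscale_apply sum_fun_apply2 sum_subtractf algebra_simps flip: sum_divide_distrib)
    finally have TE: "T (E C) = cscale (of_real (k * (1 - card X / d))) (E C)
        + cscale (of_real (k / d)) (\<Sum>x\<in>X. E (adjoin C x))" .
    have y: "cscale (of_real (k / d)) (\<Sum>x\<in>X. E (adjoin C x))
      \<in> cspan (E ` {D. good_code N1 N2 D \<and> C \<subset> D})"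
    proof (intro cm.span_scale cm.span_sum cm.span_base imageI CollectI conjI)
      fix x assume x: "x \<in> X"
      show "good_code N1 N2 (adjoin C x)" using adjoin_good[OF C] inX[OF x] by blast
      have "card (adjoin C x) = 2 * card C" using card_adjoin[OF c(1)] inX[OF x] by blast
      then show "C \<subset> adjoin C x" using Cpos by (auto simp: adjoin_def)
    qed
    \<comment> \<open>Each extension lowers the eigenvalue by \<open>k / d\<close>, so
      \<open>k < 1\<close> already keeps it away from 1.\<close>
    have ne: "complex_of_real (k * (1 - card X / d)) \<noteq> 1" if "C \<noteq> dual_code N1 N2 C"
    proof -
      have "C \<subset> dual_code N1 N2 C" using that good_code_sub_dual[OF C] by auto
      then have "card C < card (dual_code N1 N2 C)"
        by (intro psubset_card_mono) (use \<open>finite (dual_code N1 N2 C)\<close> in auto)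
      then have "k\<^sup>2 < 1" unfolding k_def using sqrt_power_dual[OF c(1)] by simp
      moreover have "k \<ge> 0" by (simp add: k_def)
      ultimately have "k < 1" by (simp add: power_less_one_iff)
      moreover have "k * (1 - card X / d) \<le> k * 1"
        using \<open>k \<ge> 0\<close> d by (intro mult_left_mono) auto
      ultimately have "k * (1 - card X / d) \<noteq> 1" by linarith
      then show ?thesis by (metis of_real_eq_1_iff)
    qed
    show ?thesis using TE y ne unfolding E_def by blast
  qed
  then show ?thesis using that admT by blast
qed

section \<open>Eliminating codes that are not self-dual\<close>

text \<open>Taking duals reverses inclusions, so \<open>C\<close> lies in its dual and that in the
  dual of \<open>D\<close>, which is \<open>D\<close>. Self-dual codes are thus maximal among good
  codes, and none lies strictly below another good code.\<close>

lemma good_code_above_self_dual: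
  assumes "good_code N1 N2 C" "D = dual_code N1 N2 D" "D \<subseteq> C"
  shows "C = D"
proof -
  have "C \<subseteq> dual_code N1 N2 C" using assms(1) by (rule good_code_sub_dual)
  also have "\<dots> \<subseteq> dual_code N1 N2 D" using assms(3)
    by (intro subsetI) (simp add: dual_code_iff subset_eq)
  finally show ?thesis using assms by auto
qed

text \<open>\<open>X\<close> stays closed under passing to larger good codes, so its enumerators
  span a space stable under \<open>T\<close>; removing a minimal code that is not self-dual
  preserves this.\<close>

lemma invariant_reduce:
  assumes m: "m \<ge> 1" and p: "p \<in> invariant_space m N1 N2"
    and X: "X \<subseteq> {C. good_code N1 N2 C}"
    and up: "\<And>C D. C \<in> X \<Longrightarrow> good_code N1 N2 D \<Longrightarrow> C \<subseteq> D \<Longrightarrow> D \<in> X"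
    and pX: "p \<in> cspan (ccwe m N1 N2 ` X)"
  shows "p \<in> cspan (ccwe m N1 N2 ` DESD_codes N1 N2)"
  using X up pX
proof (induction "card X" arbitrary: X rule: less_induct)
  case less
  have finX: "finite X" using finite_good_codes less.prems(1) by (rule finite_subset[rotated])
  let ?Y = "{C \<in> X. C \<noteq> dual_code N1 N2 C}"
  show ?case
  proof (cases "?Y = {}")
    case True
    then have "X \<subseteq> DESD_codes N1 N2" using less.prems(1) by (auto simp: DESD_codes_iff)
    then show ?thesis using less.prems(3) cm.span_mono[OF image_mono] by blast
  next
    case False
    then obtain C where C: "C \<in> X" "C \<noteq> dual_code N1 N2 C"
      and min: "\<And>D. D \<in> X \<Longrightarrow> D \<noteq> dual_code N1 N2 D \<Longrightarrow> D \<subseteq> C \<Longrightarrow> D = C"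
      using finite_has_minimal[of ?Y] finX by auto
    have gC: "good_code N1 N2 C" using C less.prems(1) by auto
    let ?X = "X - {C}"
    \<comment> \<open>\<open>C\<close> cannot lie above a remaining \<open>E\<close>: if
      \<open>E\<close> is not self-dual this contradicts minimality of \<open>C\<close>, otherwise
      maximality of self-dual codes.\<close>
    have upX: "D \<in> ?X" if "E \<in> ?X" "good_code N1 N2 D" "E \<subseteq> D" for D E
    proof -
      have "D \<in> X" using less.prems(2) that by blast
      moreover have "D \<noteq> C"
      proof
        assume "D = C"
        then show False
          using that min[of E] good_code_above_self_dual[OF gC, of E] C by auto
      qed
      ultimately show ?thesis by simp
    qed
    let ?V = "cspan (ccwe m N1 N2 ` ?X)"
    obtain T where T: "adm m N1 N2 T"
      "\<And>C. good_code N1 N2 C \<Longrightarrow> \<exists>c y. T (ccwe m N1 N2 C) = cscale c (ccwe m N1 N2 C) + y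
        \<and> y \<in> cspan (ccwe m N1 N2 ` {D. good_code N1 N2 D \<and> C \<subset> D})
        \<and> (C \<noteq> dual_code N1 N2 C \<longrightarrow> c \<noteq> 1)"
      using triangular_operator[OF m] by blast
    have lin: "linear_op T" using T(1) by (simp add: adm_def)
    have above: "cspan (ccwe m N1 N2 ` {D. good_code N1 N2 D \<and> E \<subset> D}) \<subseteq> ?V" if E: "E \<in> X" for E
    proof (intro cm.span_mono image_mono subsetI)
      fix D assume "D \<in> {D. good_code N1 N2 D \<and> E \<subset> D}"
      then show "D \<in> ?X" using upX[of E D] less.prems(2)[OF E, of D] E by (cases "E = C") auto
    qed
    have TV: "T q \<in> ?V" if "q \<in> ?V" for q
    proof -
      have "T (ccwe m N1 N2 E) \<in> ?V" if E: "E \<in> ?X" for E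
      proof -
        obtain c y where "T (ccwe m N1 N2 E) = cscale c (ccwe m N1 N2 E) + y" "y \<in> ?V"
          using T(2)[of E] above[of E] E less.prems(1) by blast
        then show ?thesis using E by (auto intro: cm.span_add cm.span_scale cm.span_base)
      qed
      then have "cspan (T ` ccwe m N1 N2 ` ?X) \<subseteq> ?V"
        by (intro cm.span_minimal cm.subspace_span) auto
      then show ?thesis using that unfolding module_hom.span_image[OF lin] by blast
    qed
    obtain c y where cy: "T (ccwe m N1 N2 C) = cscale c (ccwe m N1 N2 C) + y" "y \<in> ?V" "c \<noteq> 1"
      using T(2)[OF gC] above[OF C(1)] C(2) by blast
    have "p \<in> cspan (insert (ccwe m N1 N2 C) (ccwe m N1 N2 ` ?X))"
      using less.prems(3) by (rule subsetD[OF cm.span_mono, rotated]) (use C in auto)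
    then obtain k where q: "p - cscale k (ccwe m N1 N2 C) \<in> ?V"
      using cm.span_breakdown_eq by blast
    define q where "q = p - cscale k (ccwe m N1 N2 C)"
    have pq: "p = cscale k (ccwe m N1 N2 C) + q" by (simp add: q_def)
    have "T p = p" using T(1) p by (simp add: adm_def)
    then have Tp: "p = cscale k (cscale c (ccwe m N1 N2 C) + y) + T q"
      unfolding pq by (simp add: module_hom.add[OF lin] module_hom.scale[OF lin] cy(1))
    \<comment> \<open>The enumerators may be dependent, so \<open>k = 0\<close> cannot be inferred.
      Subtracting \<open>c\<close> times the expansion \<open>pq\<close> from \<open>Tp\<close>
      cancels the enumerator of \<open>C\<close> and leaves \<open>(1 - c) p\<close> in
      \<open>?V\<close>.\<close>
    have eq: "p = cscale (1 / (1 - c)) (cscale k y + T q - cscale c q)"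
    proof (intro ext)
      fix a b
      have aux: "(1 - c) * P = k * y' + t - c * q'" if "P = k * (c * e + y') + t" "P = k * e + q'"
        for P e y' t q' :: complex
        using that by algebra
      have "p a b = k * (c * ccwe m N1 N2 C a b + y a b) + T q a b"
        by (subst Tp) (simp add: cscale_apply)
      moreover have "p a b = k * ccwe m N1 N2 C a b + q a b" by (subst pq) (simp add: cscale_apply)
      ultimately have "(1 - c) * p a b = k * y a b + T q a b - c * q a b" by (rule aux)
      then show "p a b = cscale (1 / (1 - c)) (cscale k y + T q - cscale c q) a b"
        using cy(3) by (simp add: cscale_apply eq_divide_eq mult.commute)
    qed
    have "cscale (1 / (1 - c)) (cscale k y + T q - cscale c q) \<in> ?V"
      using cy(2) TV q by (intro cm.span_scale cm.span_diff cm.span_add) (auto simp: q_def)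
    then have "p \<in> ?V" by (subst eq)
    moreover have "card ?X < card X" using finX C by (intro psubset_card_mono) auto
    moreover have "?X \<subseteq> {C. good_code N1 N2 C}" using less.prems(1) by auto
    ultimately show ?thesis using less.hyps[of ?X] upX by blast
  qed
qed

subsection \<open>Weight enumerators of self-dual codes are invariant\<close>

lemma ccwe_in_homog_space:
  assumes "is_code N1 N2 C"
  shows "ccwe m N1 N2 C \<in> homog_space m N1 N2"
  unfolding homog_space_eq ccwe_eq[OF assms] by (intro cm.span_sum cm.span_base) auto

text \<open>Off-diagonal terms of the phase pair up by symmetry of \<open>S\<close> into twice an
  even number, and diagonal terms are multiples of weights.\<close>

lemma act_diag_ccwe:
  assumes C: "good_code N1 N2 C" and S: "\<forall>i j. S i j = S j i"
    and g: "\<And>v w. length v = m \<Longrightarrow> length w = m \<Longrightarrow> g w v = (if w = v then \<i> powi qform m S v else 0)"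
  shows "act m g (ccwe m N1 N2 C) = ccwe m N1 N2 C"
proof -
  have c: "is_code N1 N2 C" "doubly_even N1 N2 C" using C by (auto simp: good_code_def)
  have "act m g (nu N1 N2 M) = nu N1 N2 M" if M: "M \<in> mats m N1 N2" "set M \<subseteq> C" for M
  proof -
    have MC: "M ! i \<in> C" if "i < m" for i using M that matsD(1)[OF M(1)] nth_mem by blast
    \<comment> \<open>Stated for every \<open>n \<le> m\<close> so that induction can split off the
      last row and column.\<close>
    have quad: "4 dvd (\<Sum>i<n. \<Sum>k<n. S i k * beta N1 N2 (M ! i) (M ! k))" if "n \<le> m" for n
      using that
    proof (induction n)
      case (Suc n)
      let ?b = "\<lambda>i k. S i k * beta N1 N2 (M ! i) (M ! k)"
      have "(\<Sum>i<Suc n. \<Sum>k<Suc n. ?b i k) = (\<Sum>i<n. \<Sum>k<n. ?b i k) + (\<Sum>i<n. ?b i n) + (\<Sum>k<n. ?b n k) + ?b n n"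
        by (simp add: sum.distrib)
      also have "(\<Sum>k<n. ?b n k) = (\<Sum>i<n. ?b i n)"
        using S by (intro sum.cong) (auto simp: beta_commute[of _ _ "M ! n"])
      finally have eq: "(\<Sum>i<Suc n. \<Sum>k<Suc n. ?b i k)
        = (\<Sum>i<n. \<Sum>k<n. ?b i k) + 2 * (\<Sum>i<n. ?b i n) + ?b n n" by simp
      have "4 dvd (\<Sum>i<n. \<Sum>k<n. ?b i k)" using Suc by simp
      moreover have "even (\<Sum>i<n. ?b i n)"
        using Suc.prems MC doubly_even_self_orth[OF c] by (intro dvd_sum) auto
      then have "4 dvd 2 * (\<Sum>i<n. ?b i n)" by presburger
      moreover have "4 dvd ?b n n"
        using Suc.prems MC[of n] c(2) by (auto simp: doubly_even_def simp flip: wt_eq_beta)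
      ultimately show ?case unfolding eq by (intro dvd_add)
    qed simp
    have "\<i> powi phase m N1 N2 S M = 1"
      using quad[of m] unfolding powi_i_eq phase_def[symmetric] by (simp add: dvd_eq_mod_eq_0)
    then show ?thesis using act_diag_matrix[where g = g and S = S, OF M(1)] g by simp
  qed
  then show ?thesis
    unfolding ccwe_eq[OF c(1)] module_hom.sum[OF linear_op_act] by (intro sum.cong) auto
qed

text \<open>For a self-dual code the factor in \<open>hadamard_ccwe\<close> is nonnegative with
  square 1, and the first row runs over \<open>C\<close> again.\<close>

lemma act_hadamard_ccwe:
  assumes m: "m \<ge> 1" and C: "C \<in> DESD_codes N1 N2"
    and g: "\<And>v w. length v = m \<Longrightarrow> length w = m \<Longrightarrow>
      g w v = (if tl w = tl v then hadamard (hd w) (hd v) else 0)"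
  shows "act m g (ccwe m N1 N2 C) = ccwe m N1 N2 C"
proof -
  have c: "is_code N1 N2 C" "C = dual_code N1 N2 C" "one_word (N1 + N2) \<in> C"
    using C by (auto simp: DESD_codes_iff good_code_def)
  have pos: "card C > 0" using is_code_finite[OF c(1)] c(3) by (auto simp: card_gt_0_iff)
  let ?k = "real (card C) / sqrt 2 ^ (N1 + N2)"
  have "?k\<^sup>2 = 1" using sqrt_power_dual[OF c(1)] pos by (simp flip: c(2))
  moreover have "?k \<ge> 0" by simp
  ultimately have "?k = 1" by (smt (verit) power2_eq_1_iff)
  then have "of_nat (card C) / of_real (sqrt 2) ^ (N1 + N2) = (1 :: complex)"
    by (metis of_real_1 of_real_divide of_real_of_nat_eq of_real_power)
  then show ?thesis
    using hadamard_ccwe[where g = g, OF m c(1)] g c(2) by (simp add: ccwe_Cons[OF m])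
qed

lemma clifford_restr: "g \<in> clifford_group m \<Longrightarrow> restr m g = g"
  by (induction rule: clifford_group.induct)
    (auto simp: gen_d_def gen_m_def gen_h_def mat_mult_def mat_adj_def restr_def fun_eq_iff)

text \<open>\<open>act\<close> also substitutes at indices outside \<open>F_2^m\<close>, where the
  product matrix is 0; vanishing of \<open>h\<close> there makes both sides agree.\<close>

lemma act_mult:
  assumes "\<And>w v. length v \<noteq> m \<Longrightarrow> h w v = 0"
  shows "act m (mat_mult m g h) p = act m g (act m h p)"
proof (intro ext)
  fix a b
  have 1: "(\<Sum>w\<in>F2vecs m. mat_mult m g h w v * a w) = (\<Sum>u\<in>F2vecs m. h u v * (\<Sum>w\<in>F2vecs m. g w u * a w))" for v
  proof (cases "length v = m")
    case True
    have "(\<Sum>w\<in>F2vecs m. mat_mult m g h w v * a w) = (\<Sum>w\<in>F2vecs m. \<Sum>u\<in>F2vecs m. h u v * (g w u * a w))"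
      using True by (intro sum.cong) (auto simp: mat_mult_def restr_def sum_distrib_right sum_distrib_left mult_ac)
    then show ?thesis by (subst (asm) sum.swap) (simp add: sum_distrib_left)
  qed (simp add: mat_mult_def restr_def assms)
  have 2: "(\<Sum>w\<in>F2vecs m. cnj (mat_mult m g h w v) * b w)
      = (\<Sum>u\<in>F2vecs m. cnj (h u v) * (\<Sum>w\<in>F2vecs m. cnj (g w u) * b w))" for v
  proof (cases "length v = m")
    case True
    have "(\<Sum>w\<in>F2vecs m. cnj (mat_mult m g h w v) * b w)
      = (\<Sum>w\<in>F2vecs m. \<Sum>u\<in>F2vecs m. cnj (h u v) * (cnj (g w u) * b w))"
      using True by (intro sum.cong) (auto simp: mat_mult_def restr_def sum_distrib_right sum_distrib_left mult_ac)
    then show ?thesis by (subst (asm) sum.swap) (simp add: sum_distrib_left)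
  qed (simp add: mat_mult_def restr_def assms)
  show "act m (mat_mult m g h) p a b = act m g (act m h p) a b"
    unfolding act_def 1 2 ..
qed

lemma adj_mult: "mat_adj m (mat_mult m g h) = mat_mult m (mat_adj m h) (mat_adj m g)"
  by (auto simp: mat_adj_def mat_mult_def restr_def fun_eq_iff mult.commute intro!: sum.cong)

lemma restr_zero:
  assumes "restr m g = g" "length w \<noteq> m \<or> length v \<noteq> m"
  shows "g w v = 0"
proof -
  have "restr m g w v = 0" using assms(2) by (auto simp: restr_def)
  then show ?thesis by (simp only: assms(1))
qed

lemma adj_adj:
  assumes "restr m g = g"
  shows "mat_adj m (mat_adj m g) = g"
  using restr_zero[OF assms] by (auto simp: mat_adj_def restr_def fun_eq_iff)

text \<open>Adjoints are carried through the induction so that the case \<open>inv\<close> needs no unitarity.\<close>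

lemma ccwe_clifford_invariant:
  assumes m: "m \<ge> 1" and C: "C \<in> DESD_codes N1 N2" and g: "g \<in> clifford_group m"
  shows "act m g (ccwe m N1 N2 C) = ccwe m N1 N2 C \<and> act m (mat_adj m g) (ccwe m N1 N2 C) = ccwe m N1 N2 C"
  using g
proof (induction rule: clifford_group.induct)
  have c: "good_code N1 N2 C" "is_code N1 N2 C" "one_word (N1 + N2) \<in> C"
    using C by (auto simp: DESD_codes_iff good_code_def)
  {
    case (gen_d S)
    have neg: "qform m (\<lambda>i j. - S i j) v = - qform m S v" for v
      by (simp add: qform_def sum_negf)
    have 1: "act m (Defs.gen_d m S) (ccwe m N1 N2 C) = ccwe m N1 N2 C"
      by (rule act_diag_ccwe[OF c(1) gen_d]) (simp add: gen_d_def restr_def)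
    have 2: "act m (mat_adj m (Defs.gen_d m S)) (ccwe m N1 N2 C) = ccwe m N1 N2 C"
    proof (rule act_diag_ccwe[OF c(1), of "\<lambda>i j. - S i j"])
      fix v w :: "bool list" assume "length v = m" "length w = m"
      then show "mat_adj m (Defs.gen_d m S) w v = (if w = v then \<i> powi qform m (\<lambda>i j. - S i j) v else 0)"
        by (auto simp: neg mat_adj_def gen_d_def restr_def power_int_minus simp flip: power_int_inverse)
    qed (use gen_d in auto)
    show ?case using 1 2 by blast
  next
    case (gen_m A v')
    obtain f where f: "f \<in> affine_perms m" "\<And>v. length v = m \<Longrightarrow> f v = vadd (f2matvec m A v) v'"
      using GL2_affine_perm[OF gen_m(1), of v'] gen_m(2) by auto
    have 1: "act m (Defs.gen_m m A v') (ccwe m N1 N2 C) = ccwe m N1 N2 C"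
      by (rule act_colmap_ccwe[OF c(2,3) f(1)], rule act_perm_matrix[OF _ f(1)])
        (auto simp: gen_m_def restr_def f(2))
    note p = affine_permsD(1)[OF f(1)]
    have 2: "act m (mat_adj m (Defs.gen_m m A v')) (ccwe m N1 N2 C) = ccwe m N1 N2 C"
    proof (rule act_colmap_ccwe[OF c(2,3) inv_affine[OF f(1)]], rule act_perm_matrix[OF _ inv_affine[OF f(1)]])
      fix v w :: "bool list" assume l: "length v = m" "length w = m"
      have "v = f w \<longleftrightarrow> w = inv f v" using permutes_inverses[OF p] by metis
      then show "mat_adj m (Defs.gen_m m A v') w v = (if w = inv f v then 1 else 0)"
        using l by (auto simp: mat_adj_def gen_m_def restr_def simp flip: f(2))
    qed
    show ?case using 1 2 by blast
  next
    case gen_h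
    have 1: "act m (Defs.gen_h m) (ccwe m N1 N2 C) = ccwe m N1 N2 C"
      by (rule act_hadamard_ccwe[OF m C]) (simp add: gen_h_def restr_def)
    have 2: "act m (mat_adj m (Defs.gen_h m)) (ccwe m N1 N2 C) = ccwe m N1 N2 C"
      by (rule act_hadamard_ccwe[OF m C])
        (auto simp: mat_adj_def gen_h_def restr_def hadamard_def)
    show ?case using 1 2 by blast
  next
    case (mult g h)
    have "h w v = 0" if "length v \<noteq> m" for w v
      using restr_zero[OF clifford_restr[OF mult(2)]] that by blast
    moreover have "mat_adj m g w v = 0" if "length v \<noteq> m" for w v
      using that by (auto simp: mat_adj_def restr_def)
    ultimately show ?case using mult.IH by (simp add: act_mult adj_mult)
  next
    case (inv g)
    then show ?case using adj_adj[OF clifford_restr[OF inv(1)]] by simp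
  }
qed

lemma invariant_space_span:
  assumes m: "m \<ge> 1"
  shows "invariant_space m N1 N2 = cspan (ccwe m N1 N2 ` DESD_codes N1 N2)"
proof
  show "invariant_space m N1 N2 \<subseteq> cspan (ccwe m N1 N2 ` DESD_codes N1 N2)"
    \<comment> \<open>The elimination starts from the set of all good codes, which is closed under
      larger good codes.\<close>
    using invariant_reduce[OF m _ _ _ invariant_in_good_span[OF m]] by blast
  have sub: "cm.subspace (invariant_space m N1 N2)"
    unfolding cm.subspace_def
  proof (intro conjI allI impI ballI)
    show "0 \<in> invariant_space m N1 N2"
      using cm.span_zero linear_op_zero[OF linear_op_act]
      by (simp add: invariant_space_def homog_space_def)
    show "x + y \<in> invariant_space m N1 N2" if "x \<in> invariant_space m N1 N2" "y \<in> invariant_space m N1 N2" for x y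
      using that cm.span_add by (auto simp: invariant_space_def homog_space_def module_hom.add[OF linear_op_act])
    show "cscale c x \<in> invariant_space m N1 N2" if "x \<in> invariant_space m N1 N2" for c x
      using that cm.span_scale by (auto simp: invariant_space_def homog_space_def module_hom.scale[OF linear_op_act])
  qed
  have "ccwe m N1 N2 C \<in> invariant_space m N1 N2" if "C \<in> DESD_codes N1 N2" for C
    using that ccwe_in_homog_space ccwe_clifford_invariant[OF m that]
    by (auto simp: invariant_space_def DESD_codes_iff good_code_def)
  then show "cspan (ccwe m N1 N2 ` DESD_codes N1 N2) \<subseteq> invariant_space m N1 N2"
    by (intro cm.span_minimal sub) auto
qed

end

subsection \<open>Extracting coefficients\<close>

lemma root_of_unity_sum:
  assumes "n > 0"
  shows "(\<Sum>t<n. (exp (2 * of_real pi * \<i> / of_nat n) ^ t) ^ a) = (if n dvd a then of_nat n else (0 :: complex))"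
proof -
  let ?z = "exp (2 * of_real pi * \<i> / of_nat n) ^ a :: complex"
  have z: "?z = exp (2 * of_real pi * \<i> * of_nat a / of_nat n)"
    by (simp flip: exp_of_nat_mult add: mult_ac)
  have "?z = 1 \<longleftrightarrow> n dvd a"
    using complex_root_unity_eq[of n a 0] assms by (simp add: z dvd_eq_mod_eq_0)
  moreover have "?z ^ n = 1"
  proof -
    have "exp (2 * of_real pi * \<i> / of_nat n) ^ n = (1 :: complex)"
      using assms by (simp flip: exp_of_nat_mult)
    then show ?thesis by (simp add: power_commutes_exp[of _ a n])
  qed
  ultimately have "(\<Sum>t<n. ?z ^ t) = (if n dvd a then of_nat n else 0)" by (simp add: sum_gp_strict)
  moreover have "(\<Sum>t<n. (exp (2 * of_real pi * \<i> / of_nat n) ^ t) ^ a) = (\<Sum>t<n. ?z ^ t)"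
    by (rule sum.cong) (simp_all flip: power_mult add: mult.commute)
  ultimately show ?thesis by simp
qed

text \<open>Monomials as characters of the torus of \<open>n\<close>-th roots of unity;
  \<open>n - k v\<close> stands for the inverse exponent, and exponents below \<open>n\<close> are
  determined modulo \<open>n\<close>.\<close>

lemma torus_orthogonality:
  fixes k l :: "'a \<Rightarrow> nat"
  assumes "finite V" "\<And>v. v \<in> V \<Longrightarrow> k v < n" "\<And>v. v \<in> V \<Longrightarrow> l v < n" "n > 0"
  defines "w \<equiv> exp (2 * of_real pi * \<i> / of_nat n) :: complex"
  shows "(\<Sum>t\<in>PiE V (\<lambda>_. {..<n}). (\<Prod>v\<in>V. (w ^ t v) ^ (n - k v)) * (\<Prod>v\<in>V. (w ^ t v) ^ l v))
    = (if \<forall>v\<in>V. l v = k v then of_nat n ^ card V else 0)"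
proof -
  have "(\<Sum>t\<in>PiE V (\<lambda>_. {..<n}). (\<Prod>v\<in>V. (w ^ t v) ^ (n - k v)) * (\<Prod>v\<in>V. (w ^ t v) ^ l v))
    = (\<Sum>t\<in>PiE V (\<lambda>_. {..<n}). \<Prod>v\<in>V. (w ^ t v) ^ (n - k v + l v))"
    by (simp add: prod.distrib power_add)
  also have "\<dots> = (\<Prod>v\<in>V. \<Sum>t<n. (w ^ t) ^ (n - k v + l v))"
    by (rule prod_sum_PiE[symmetric]) (use assms in auto)
  also have "\<dots> = (\<Prod>v\<in>V. if l v = k v then of_nat n else 0)"
  proof (rule prod.cong[OF refl])
    fix v assume v: "v \<in> V"
    have kl: "k v < n" "l v < n" using assms(2,3) v by auto
    have "n dvd n - k v + l v \<longleftrightarrow> l v = k v"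
    proof
      assume "n dvd n - k v + l v"
      then obtain q where q: "n - k v + l v = n * q" by (auto elim: dvdE)
      moreover have "0 < n - k v + l v" "n - k v + l v < n * 2" using kl by auto
      ultimately have "0 < q" "q < 2" by (auto intro: Nat.gr0I)
      then have "q = 1" by simp
      then show "l v = k v" using q kl by simp
    qed (use kl in simp)
    then show "(\<Sum>t<n. (w ^ t) ^ (n - k v + l v)) = (if l v = k v then of_nat n else 0)"
      unfolding w_def root_of_unity_sum[OF assms(4)] by simp
  qed
  also have "\<dots> = (if \<forall>v\<in>V. l v = k v then of_nat n ^ card V else 0)"
    using assms(1) by (auto simp: prod_zero_iff)
  finally show ?thesis .
qed

lemma codes_equivI:
  assumes "\<pi> permutes {..<N1 + N2}" "\<pi> ` {..<N1} = {..<N1}" "D = perm_word \<pi> ` C"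
  shows "codes_equiv N1 N2 C D"
  using assms by (auto simp: codes_equiv_def)

context
  fixes m N1 N2 :: nat
begin

definition exponents :: "nat set \<Rightarrow> bool list list \<Rightarrow> bool list \<Rightarrow> nat" where
  "exponents J M v = card {j \<in> J. col M j = v}"

lemma nu_exponents:
  assumes M: "M \<in> mats m N1 N2"
  shows "nu N1 N2 M a b = (\<Prod>v\<in>F2vecs m. a v ^ exponents {..<N1} M v)
    * (\<Prod>v\<in>F2vecs m. b v ^ exponents {N1..<N1 + N2} M v)"
proof -
  have *: "(\<Prod>j\<in>J. x (col M j)) = (\<Prod>v\<in>F2vecs m. x v ^ exponents J M v)"
    if J: "finite J" for J and x :: "bool list \<Rightarrow> complex"
  proof -
    have "(\<Prod>j\<in>J. x (col M j)) = (\<Prod>v\<in>F2vecs m. \<Prod>j\<in>{j\<in>J. col M j = v}. x (col M j))"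
      by (rule prod.group[symmetric]) (use J matsD(1)[OF M] in auto)
    also have "\<dots> = (\<Prod>v\<in>F2vecs m. x v ^ exponents J M v)"
    proof (rule prod.cong[OF refl])
      fix v
      have "(\<Prod>j\<in>{j\<in>J. col M j = v}. x (col M j)) = (\<Prod>j\<in>{j\<in>J. col M j = v}. x v)"
        by (rule prod.cong) auto
      then show "(\<Prod>j\<in>{j\<in>J. col M j = v}. x (col M j)) = x v ^ exponents J M v"
        by (simp add: exponents_def)
    qed
    finally show ?thesis .
  qed
  show ?thesis unfolding nu_def by (simp add: *)
qed

text \<open>Variables commute, so \<open>nu\<close> remembers only how often each vector occurs as a
  column within each block.\<close>

definition same_monomial :: "bool list list \<Rightarrow> bool list list \<Rightarrow> bool" where
  "same_monomial M M' \<longleftrightarrow> (\<forall>v\<in>F2vecs m. exponents {..<N1} M v = exponents {..<N1} M' v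
     \<and> exponents {N1..<N1 + N2} M v = exponents {N1..<N1 + N2} M' v)"

text \<open>Polynomials are functions here, so a coefficient is recovered from values: a discrete
  Fourier transform over independent roots of unity for the variables and for their
  conjugates.\<close>

lemma coefficient_functional:
  obtains L :: "cpoly \<Rightarrow> complex" and c where "module_hom cscale (*) L" "c \<noteq> 0"
    "\<And>M. M \<in> mats m N1 N2 \<Longrightarrow> L (nu N1 N2 M) = (if same_monomial M M0 then c else 0)"
proof -
  \<comment> \<open>The order exceeds every exponent, as at most \<open>N1 + N2\<close> columns can
    agree, so distinct monomials give distinct characters.\<close>
  let ?V = "F2vecs m" and ?n = "Suc (N1 + N2)"
  let ?P = "PiE ?V (\<lambda>_. {..<?n})"
  define w :: complex where "w = exp (2 * of_real pi * \<i> / of_nat ?n)"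
  let ?k = "exponents {..<N1} M0" and ?l = "exponents {N1..<N1 + N2} M0"
  define L where "L p = (\<Sum>t\<in>?P. \<Sum>s\<in>?P. (\<Prod>v\<in>?V. (w ^ t v) ^ (?n - ?k v)) * (\<Prod>v\<in>?V. (w ^ s v) ^ (?n - ?l v))
    * p (\<lambda>v. w ^ t v) (\<lambda>v. w ^ s v))" for p :: cpoly
  have "module_hom cscale (*) L"
    by unfold_locales
      (simp_all add: L_def cscale_apply algebra_simps sum.distrib sum_distrib_left)
  moreover have "(of_nat ?n ^ card ?V * of_nat ?n ^ card ?V :: complex) \<noteq> 0"
    by (simp del: of_nat_Suc)
  moreover have "L (nu N1 N2 M) = (if same_monomial M M0 then of_nat ?n ^ card ?V * of_nat ?n ^ card ?V else 0)"
    if M: "M \<in> mats m N1 N2" for M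
  proof -
    have bound: "exponents J M' v < ?n" if "J \<subseteq> {..<N1 + N2}" for J M' v
    proof -
      have "card {j \<in> J. col M' j = v} \<le> card {..<N1 + N2}" using that by (intro card_mono) auto
      then show ?thesis by (simp add: exponents_def)
    qed
    let ?A = "\<lambda>t. (\<Prod>v\<in>?V. (w ^ t v) ^ (?n - ?k v)) * (\<Prod>v\<in>?V. (w ^ t v) ^ exponents {..<N1} M v)"
    let ?B = "\<lambda>s. (\<Prod>v\<in>?V. (w ^ s v) ^ (?n - ?l v)) * (\<Prod>v\<in>?V. (w ^ s v) ^ exponents {N1..<N1 + N2} M v)"
    have "L (nu N1 N2 M) = (\<Sum>t\<in>?P. \<Sum>s\<in>?P. ?A t * ?B s)"
      unfolding L_def nu_exponents[OF M] by (intro sum.cong refl) (simp only: mult_ac)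
    also have "\<dots> = (\<Sum>t\<in>?P. ?A t) * (\<Sum>s\<in>?P. ?B s)" by (rule sum_product[symmetric])
    also have "(\<Sum>t\<in>?P. ?A t) = (if \<forall>v\<in>?V. exponents {..<N1} M v = ?k v then of_nat ?n ^ card ?V else 0)"
      unfolding w_def by (rule torus_orthogonality) (auto intro!: bound)
    also have "(\<Sum>s\<in>?P. ?B s) = (if \<forall>v\<in>?V. exponents {N1..<N1 + N2} M v = ?l v then of_nat ?n ^ card ?V else 0)"
      unfolding w_def by (rule torus_orthogonality) (auto intro!: bound)
    finally show ?thesis by (auto simp: same_monomial_def)
  qed
  ultimately show ?thesis by (rule that)
qed

subsection \<open>Equivalent codes\<close>

lemma length_perm_word [simp]: "length (perm_word \<pi> c) = length c"
  by (simp add: perm_word_def)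

lemma nth_perm_word: "j < length c \<Longrightarrow> perm_word \<pi> c ! j = c ! \<pi> j"
  by (simp add: perm_word_def)

text \<open>Equal exponents mean equal multisets of columns in each block, hence one permutation per
  block; they have disjoint supports and combine to \<open>\<pi>\<close>.\<close>

lemma same_monomial_permutation:
  assumes M: "M \<in> mats m N1 N2" "M' \<in> mats m N1 N2" and same: "same_monomial M M'"
  obtains \<pi> where "\<pi> permutes {..<N1 + N2}" "\<pi> ` {..<N1} = {..<N1}" "M = map (perm_word \<pi>) M'"
proof -
  have img: "image_mset (col M) (mset_set J) = image_mset (col M') (mset_set J)"
    if J: "finite J" "\<forall>v\<in>F2vecs m. exponents J M v = exponents J M' v" for J
  proof (rule multiset_eqI)
    fix v
    show "count (image_mset (col M) (mset_set J)) v = count (image_mset (col M') (mset_set J)) v"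
    proof (cases "v \<in> F2vecs m")
      case True
      then show ?thesis using J by (simp add: count_image_mset_eq_card_vimage exponents_def)
    next
      case False
      then have "{j \<in> J. col M j = v} = {}" "{j \<in> J. col M' j = v} = {}"
        using M matsD(1) by auto
      then show ?thesis unfolding count_image_mset_eq_card_vimage[OF J(1)] by (simp only:)
    qed
  qed
  obtain p where p: "p permutes {..<N1}" "\<forall>j\<in>{..<N1}. col M j = col M' (p j)"
    using image_mset_eq_implies_permutes[OF _ img] same by (auto simp: same_monomial_def)
  obtain q where q: "q permutes {N1..<N1 + N2}" "\<forall>j\<in>{N1..<N1 + N2}. col M j = col M' (q j)"
    using image_mset_eq_implies_permutes[OF _ img] same by (auto simp: same_monomial_def)
  define \<pi> where "\<pi> = p \<circ> q"
  have pi1: "\<pi> j = p j" if "j < N1" for j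
    using that permutes_not_in[OF q(1)] by (simp add: \<pi>_def)
  have pi2: "\<pi> j = q j" if "j \<in> {N1..<N1 + N2}" for j
    using permutes_in_image[OF q(1), of j] permutes_not_in[OF p(1), of "q j"] that by (simp add: \<pi>_def)
  have "p permutes {..<N1 + N2}" by (rule permutes_subset[OF p(1)]) auto
  moreover have "q permutes {..<N1 + N2}" by (rule permutes_subset[OF q(1)]) auto
  ultimately have perm: "\<pi> permutes {..<N1 + N2}" unfolding \<pi>_def by (rule permutes_compose[rotated])
  have "\<pi> ` {..<N1} = p ` {..<N1}" by (rule image_cong) (simp_all add: pi1)
  then have "\<pi> ` {..<N1} = {..<N1}" using permutes_image[OF p(1)] by simp
  moreover have "M = map (perm_word \<pi>) M'"
  proof (rule mats_eqI[OF M(1)])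
    show "map (perm_word \<pi>) M' \<in> mats m N1 N2" using M(2) by (auto simp: mats_def)
    fix j assume j: "j < N1 + N2"
    have "col M j = col M' (\<pi> j)"
      using p(2) q(2) pi1 pi2 j by (cases "j < N1") auto
    also have "\<dots> = col (map (perm_word \<pi>) M') j"
      using M(2) j by (auto simp: col_def mats_def nth_perm_word)
    finally show "col M j = col (map (perm_word \<pi>) M') j" .
  qed
  ultimately show ?thesis using that perm by blast
qed

lemma perm_word_inv:
  assumes "\<pi> permutes {..<N1 + N2}" "length c = N1 + N2"
  shows "perm_word (inv \<pi>) (perm_word \<pi> c) = c" "perm_word \<pi> (perm_word (inv \<pi>) c) = c"
proof -
  have lt: "inv \<pi> j < N1 + N2" "\<pi> j < N1 + N2" if "j < N1 + N2" for j
    using permutes_in_image[OF permutes_inv[OF assms(1)], of j] permutes_in_image[OF assms(1), of j] that by auto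
  show "perm_word (inv \<pi>) (perm_word \<pi> c) = c" "perm_word \<pi> (perm_word (inv \<pi>) c) = c"
    by (rule nth_equalityI;
      use assms lt permutes_inverses[OF assms(1)] in \<open>simp add: nth_perm_word\<close>)+
qed

text \<open>A permutation respecting the two blocks only reorders the factors of each
  product.\<close>

lemma nu_perm_word:
  assumes \<pi>: "\<pi> permutes {..<N1 + N2}" "\<pi> ` {..<N1} = {..<N1}" and M: "M \<in> mats m N1 N2"
  shows "nu N1 N2 (map (perm_word \<pi>) M) = nu N1 N2 M"
proof (intro ext)
  fix a b
  have mem: "\<pi> j < N1 \<longleftrightarrow> j < N1" for j
    using \<pi>(2) permutes_inj[OF \<pi>(1)] by (metis inj_image_mem_iff lessThan_iff)
  have col: "col (map (perm_word \<pi>) M) j = col M (\<pi> j)" if "j < N1 + N2" for j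
    using that M by (auto simp: col_def mats_def nth_perm_word)
  have "nu N1 N2 (map (perm_word \<pi>) M) a b = (\<Prod>j<(N1 + N2). (if \<pi> j < N1 then a else b) (col M (\<pi> j)))"
    unfolding nu_alt by (rule prod.cong) (auto simp: mem col)
  also have "\<dots> = nu N1 N2 M a b"
    unfolding nu_alt using prod.permute[OF \<pi>(1), of "\<lambda>j. (if j < N1 then a else b) (col M j)"]
    by (simp add: o_def)
  finally show "nu N1 N2 (map (perm_word \<pi>) M) a b = nu N1 N2 M a b" .
qed

lemma ccwe_equiv:
  assumes C: "is_code N1 N2 C" and D: "is_code N1 N2 D" and eq: "codes_equiv N1 N2 C D"
  shows "ccwe m N1 N2 D = ccwe m N1 N2 C"
proof -
  obtain \<pi> where \<pi>: "\<pi> permutes {..<N1 + N2}" "\<pi> ` {..<N1} = {..<N1}" "D = perm_word \<pi> ` C"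
    using eq by (auto simp: codes_equiv_def)
  note len = is_codeD(1)[OF C]
  let ?S = "\<lambda>C. {M \<in> mats m N1 N2. set M \<subseteq> C}"
  have "(\<Sum>M\<in>?S C. nu N1 N2 (map (perm_word \<pi>) M)) = (\<Sum>M\<in>?S D. nu N1 N2 M)"
  proof (rule sum.reindex_bij_witness[of _ "map (perm_word (inv \<pi>))" "map (perm_word \<pi>)"])
    fix M assume M: "M \<in> ?S C"
    have "map (perm_word (inv \<pi>) \<circ> perm_word \<pi>) M = M"
      by (rule map_idI) (use M perm_word_inv(1)[OF \<pi>(1)] in \<open>auto simp: mats_def\<close>)
    then show "map (perm_word (inv \<pi>)) (map (perm_word \<pi>) M) = M" by simp
    show "map (perm_word \<pi>) M \<in> ?S D" using M \<pi>(3) by (auto simp: mats_def)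
  next
    fix M assume M: "M \<in> ?S D"
    have "map (perm_word \<pi> \<circ> perm_word (inv \<pi>)) M = M"
      by (rule map_idI) (use M perm_word_inv(2)[OF \<pi>(1)] in \<open>auto simp: mats_def\<close>)
    then show "map (perm_word \<pi>) (map (perm_word (inv \<pi>)) M) = M" by simp
    have "perm_word (inv \<pi>) d \<in> C" if "d \<in> D" for d
      using that \<pi>(3) perm_word_inv(1)[OF \<pi>(1)] len by auto
    then show "map (perm_word (inv \<pi>)) M \<in> ?S C" using M by (auto simp: mats_def)
  qed simp
  moreover have "(\<Sum>M\<in>?S C. nu N1 N2 (map (perm_word \<pi>) M)) = (\<Sum>M\<in>?S C. nu N1 N2 M)"
    by (rule sum.cong) (use nu_perm_word[OF \<pi>(1,2)] in auto)
  ultimately show ?thesis by (simp add: ccwe_eq[OF C] ccwe_eq[OF D])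
qed

subsection \<open>Linear independence\<close>

text \<open>Each new row outside \<open>D\<close> doubles the code, so \<open>k\<close> rows bridge
  an index of at most \<open>2^k\<close>. Generation is expressed by quantifying over all codes
  \<open>E\<close> above \<open>D\<close>.\<close>

lemma generating_rows:
  assumes C: "is_code N1 N2 C"
  shows "is_code N1 N2 D \<Longrightarrow> D \<subseteq> C \<Longrightarrow> card C \<le> 2 ^ k * card D
    \<Longrightarrow> \<exists>M. length M = k \<and> set M \<subseteq> C \<and> (\<forall>E. is_code N1 N2 E \<longrightarrow> D \<subseteq> E \<longrightarrow> set M \<subseteq> E \<longrightarrow> C \<subseteq> E)"
proof (induction k arbitrary: D)
  case 0
  then have "D = C" using is_code_finite[OF C] by (intro card_seteq) auto
  then show ?case by auto
next
  case (Suc k)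
  show ?case
  proof (cases "D = C")
    \<comment> \<open>The list must have length \<open>k\<close> exactly, so it is padded with zero
      words.\<close>
    case True
    then show ?thesis
      using is_codeD(2)[OF C] by (intro exI[of _ "replicate (Suc k) (zero_word (N1 + N2))"]) auto
  next
    case False
    then obtain x where x: "x \<in> C" "x \<notin> D" using Suc.prems by auto
    have lx: "length x = N1 + N2" using x is_codeD(1)[OF C] by auto
    have sub: "adjoin D x \<subseteq> C" using x Suc.prems(2) is_codeD(3)[OF C] by (auto simp: adjoin_def)
    have "card C \<le> 2 ^ k * card (adjoin D x)"
      using Suc.prems(3) card_adjoin[OF Suc.prems(1) lx x(2)] by simp
    then obtain M where M: "length M = k" "set M \<subseteq> C"
      "\<forall>E. is_code N1 N2 E \<longrightarrow> adjoin D x \<subseteq> E \<longrightarrow> set M \<subseteq> E \<longrightarrow> C \<subseteq> E"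
      using Suc.IH[OF is_code_adjoin[OF Suc.prems(1) lx] sub] by blast
    have "adjoin D x \<subseteq> E" if "is_code N1 N2 E" "D \<subseteq> E" "x \<in> E" for E
      using that is_codeD(3) by (auto simp: adjoin_def)
    then show ?thesis using M x by (intro exI[of _ "x # M"]) auto
  qed
qed

lemma card_DESD:
  assumes "C \<in> DESD_codes N1 N2"
  shows "card C * card C = 2 ^ (N1 + N2)"
  using card_dual_code[of N1 N2 C] assms by (auto simp: DESD_codes_iff good_code_def)

text \<open>Origin of the bound on \<open>m\<close>: a self-dual code has dimension
  \<open>N/2\<close> with \<open>N = N1 + N2\<close>, the all-ones word supplies one generator, and
  the \<open>m\<close> rows must supply the remaining ones.\<close>

lemma generating_matrix:
  assumes C: "C \<in> DESD_codes N1 N2" and N: "2 * (m + 1) \<ge> N1 + N2"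
  obtains M where "M \<in> mats m N1 N2" "set M \<subseteq> C"
    "\<And>E. is_code N1 N2 E \<Longrightarrow> one_word (N1 + N2) \<in> E \<Longrightarrow> set M \<subseteq> E \<Longrightarrow> C \<subseteq> E"
proof -
  have c: "is_code N1 N2 C" "one_word (N1 + N2) \<in> C" using C by (auto simp: DESD_codes_iff good_code_def)
  have z: "is_code N1 N2 {zero_word (N1 + N2)}" by (auto simp: is_code_def)
  let ?D = "adjoin {zero_word (N1 + N2)} (one_word (N1 + N2))"
  have D: "?D = {zero_word (N1 + N2), one_word (N1 + N2)}" by (auto simp: adjoin_def)
  have "card C \<le> 2 ^ m * card ?D"
  proof (cases "(N1 + N2) = 0")
    \<comment> \<open>In length 0 the all-ones word is the zero word and supplies no generator;
      there the code is trivial.\<close>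
    case True
    then have "card C = 1" using card_DESD[OF C] by simp
    moreover have "card ?D > 0" unfolding card_gt_0_iff D by blast
    ultimately show ?thesis by simp
  next
    case False
    have "(2 :: nat) ^ (N1 + N2) \<le> 2 ^ ((m + 1) * 2)" using N by (intro power_increasing) auto
    then have "card C ^ 2 \<le> (2 ^ (m + 1)) ^ 2"
      by (simp only: power2_eq_square[of "card C"] card_DESD[OF C] power_mult)
    then have "card C \<le> 2 ^ (m + 1)" by (rule power2_le_imp_le) simp
    moreover have "one_word (N1 + N2) \<noteq> zero_word (N1 + N2)" using False by (cases "N1 + N2") auto
    then have "card ?D = 2" by (auto simp: D)
    ultimately show ?thesis by simp
  qed
  moreover have "is_code N1 N2 ?D" by (rule is_code_adjoin[OF z]) simp
  moreover have "?D \<subseteq> C" using c is_codeD(2) by (simp add: D)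
  ultimately obtain M where M: "length M = m" "set M \<subseteq> C"
    "\<forall>E. is_code N1 N2 E \<longrightarrow> ?D \<subseteq> E \<longrightarrow> set M \<subseteq> E \<longrightarrow> C \<subseteq> E"
    using generating_rows[OF c(1)] by blast
  show ?thesis
  proof (rule that)
    show "M \<in> mats m N1 N2" using M is_codeD(1)[OF c(1)] by (auto simp: mats_def)
    show "C \<subseteq> E" if "is_code N1 N2 E" "one_word (N1 + N2) \<in> E" "set M \<subseteq> E" for E
      using M(3) that is_codeD(2)[OF that(1)] by (simp add: D)
  qed (rule M(2))
qed

lemma separating_functional:
  assumes C: "C \<in> DESD_codes N1 N2" and N: "2 * (m + 1) \<ge> N1 + N2"
  obtains L :: "cpoly \<Rightarrow> complex" where "module_hom cscale (*) L" "L (ccwe m N1 N2 C) \<noteq> 0"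
    "\<And>D. D \<in> DESD_codes N1 N2 \<Longrightarrow> L (ccwe m N1 N2 D) \<noteq> 0 \<Longrightarrow> codes_equiv N1 N2 C D"
proof -
  obtain M0 where M0: "M0 \<in> mats m N1 N2" "set M0 \<subseteq> C"
    "\<And>E. is_code N1 N2 E \<Longrightarrow> one_word (N1 + N2) \<in> E \<Longrightarrow> set M0 \<subseteq> E \<Longrightarrow> C \<subseteq> E"
    using generating_matrix[OF C N] by blast
  obtain L c where L: "module_hom cscale (*) L" "c \<noteq> 0"
    "\<And>M. M \<in> mats m N1 N2 \<Longrightarrow> L (nu N1 N2 M) = (if same_monomial M M0 then c else 0)"
    using coefficient_functional[of M0] by blast
  let ?S = "\<lambda>D. {M \<in> mats m N1 N2. set M \<subseteq> D \<and> same_monomial M M0}"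
  \<comment> \<open>All coefficients of an enumerator are counts, so nothing cancels: a nonzero
    value yields an actual matrix with rows in \<open>D\<close>.\<close>
  have L_ccwe: "L (ccwe m N1 N2 D) = of_nat (card (?S D)) * c" if "is_code N1 N2 D" for D
  proof -
    let ?T = "{M \<in> mats m N1 N2. set M \<subseteq> D}"
    have "L (ccwe m N1 N2 D) = (\<Sum>M\<in>?T. if same_monomial M M0 then c else 0)"
      unfolding ccwe_eq[OF that] module_hom.sum[OF L(1)] by (rule sum.cong) (auto simp: L(3))
    also have "\<dots> = (\<Sum>M\<in>?T \<inter> {M. same_monomial M M0}. c)"
      by (subst sum.inter_restrict) (use finite_mats in auto)
    also have "?T \<inter> {M. same_monomial M M0} = ?S D" by auto
    finally show ?thesis by simp
  qed
  have code: "is_code N1 N2 D" "one_word (N1 + N2) \<in> D" if "D \<in> DESD_codes N1 N2" for D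
    using that by (auto simp: DESD_codes_iff good_code_def)
  have "M0 \<in> ?S C" using M0 by (simp add: same_monomial_def)
  moreover have fin: "finite (?S D)" for D using finite_mats by auto
  ultimately have "card (?S C) > 0" by (auto simp: card_gt_0_iff)
  then have "L (ccwe m N1 N2 C) \<noteq> 0" using L(2) L_ccwe[OF code(1)[OF C]] by simp
  moreover have "codes_equiv N1 N2 C D" if D: "D \<in> DESD_codes N1 N2" and ne: "L (ccwe m N1 N2 D) \<noteq> 0" for D
  proof -
    have "card (?S D) \<noteq> 0" using ne L_ccwe[OF code(1)[OF D]] by (metis mult_zero_left of_nat_0)
    then have "?S D \<noteq> {}" by (metis card.empty)
    then obtain M where M: "M \<in> mats m N1 N2" "set M \<subseteq> D" "same_monomial M M0" by blast
    obtain \<pi> where \<pi>: "\<pi> permutes {..<N1 + N2}" "\<pi> ` {..<N1} = {..<N1}" "M = map (perm_word \<pi>) M0"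
      using same_monomial_permutation[OF M(1) M0(1) M(3)] by blast
    \<comment> \<open>Pulling \<open>D\<close> back along \<open>\<pi>\<close> gives a code
      containing the all-ones word and the rows of \<open>M0\<close>, hence all of \<open>C\<close>;
      equality then follows because self-dual codes have the same size.\<close>
    let ?E = "{c \<in> F2vecs (N1 + N2). perm_word \<pi> c \<in> D}"
    have lt: "\<pi> j < N1 + N2" if "j < N1 + N2" for j using permutes_in_image[OF \<pi>(1), of j] that by simp
    have "is_code N1 N2 ?E"
      unfolding is_code_def
    proof (intro conjI ballI)
      have "perm_word \<pi> (zero_word (N1 + N2)) = zero_word (N1 + N2)"
        by (rule nth_equalityI) (auto simp: nth_perm_word lt)
      then show "zero_word (N1 + N2) \<in> ?E" using is_codeD(2)[OF code(1)[OF D]] by simp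
      fix u v assume uv: "u \<in> ?E" "v \<in> ?E"
      have "perm_word \<pi> (vadd u v) = vadd (perm_word \<pi> u) (perm_word \<pi> v)"
        by (rule nth_equalityI) (use uv lt in \<open>auto simp: nth_perm_word nth_vadd\<close>)
      then show "vadd u v \<in> ?E" using uv is_codeD(3)[OF code(1)[OF D]] by simp
    qed auto
    moreover have "perm_word \<pi> (one_word (N1 + N2)) = one_word (N1 + N2)"
      by (rule nth_equalityI) (auto simp: nth_perm_word lt)
    then have "one_word (N1 + N2) \<in> ?E" using code(2)[OF D] by simp
    moreover have "set M0 \<subseteq> ?E" using M(2) \<pi>(3) M0(1) by (auto simp: mats_def)
    ultimately have "C \<subseteq> ?E" by (rule M0(3))
    then have sub: "perm_word \<pi> ` C \<subseteq> D" by auto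
    have "inj_on (perm_word \<pi>) C"
      using perm_word_inv(1)[OF \<pi>(1)] is_codeD(1)[OF code(1)[OF C]] by (metis inj_on_inverseI)
    then have "card (perm_word \<pi> ` C) = card C" by (rule card_image)
    moreover have "card C = card D"
      using card_DESD[OF C] card_DESD[OF D] by (metis power2_eq_imp_eq power2_eq_square zero_le)
    ultimately have "perm_word \<pi> ` C = D"
      using sub is_code_finite[OF code(1)[OF D]] by (intro card_seteq) auto
    then show ?thesis using \<pi> by (intro codes_equivI) auto
  qed
  ultimately show ?thesis using that L(1) by blast
qed

text \<open>The functional separating \<open>C\<close> vanishes on the enumerators of all other
  members of \<open>R\<close>, so up to nonzero scalars these functionals form a dual
  family.\<close>

lemma ccwe_basis:
  assumes N: "2 * (m + 1) \<ge> N1 + N2" and R: "R \<subseteq> DESD_codes N1 N2"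
    and inequiv: "\<And>C D. C \<in> R \<Longrightarrow> D \<in> R \<Longrightarrow> codes_equiv N1 N2 C D \<Longrightarrow> C = D"
  shows "inj_on (ccwe m N1 N2) R" "cindependent (ccwe m N1 N2 ` R)"
proof -
  show inj: "inj_on (ccwe m N1 N2) R"
  proof (rule inj_onI)
    fix C D assume CD: "C \<in> R" "D \<in> R" "ccwe m N1 N2 C = ccwe m N1 N2 D"
    show "C = D"
      using separating_functional[of C] CD R N inequiv by (metis subsetD)
  qed
  show "cindependent (ccwe m N1 N2 ` R)"
  proof
    assume "cm.dependent (ccwe m N1 N2 ` R)"
    then obtain t u p where t: "finite t" "t \<subseteq> ccwe m N1 N2 ` R" "(\<Sum>v\<in>t. cscale (u v) v) = 0"
      and p: "p \<in> t" "u p \<noteq> 0"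
      unfolding cm.dependent_explicit by blast
    then obtain C where C: "ccwe m N1 N2 C \<in> t" "u (ccwe m N1 N2 C) \<noteq> 0" "C \<in> R" by auto
    obtain L :: "cpoly \<Rightarrow> complex" where L: "module_hom cscale (*) L" "L (ccwe m N1 N2 C) \<noteq> 0"
      "\<And>D. D \<in> DESD_codes N1 N2 \<Longrightarrow> L (ccwe m N1 N2 D) \<noteq> 0 \<Longrightarrow> codes_equiv N1 N2 C D"
      using separating_functional[of C] C(3) R N by blast
    have zero: "L v = 0" if v: "v \<in> t - {ccwe m N1 N2 C}" for v
    proof (rule ccontr)
      assume ne: "L v \<noteq> 0"
      obtain D where D: "D \<in> R" "v = ccwe m N1 N2 D" using v t(2) by blast
      then have "codes_equiv N1 N2 C D" using L(3) ne R by auto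
      then show False using inequiv[OF C(3) D(1)] D v by auto
    qed
    have "0 = L (\<Sum>v\<in>t. cscale (u v) v)" using t(3) module_hom.zero[OF L(1)] by simp
    also have "\<dots> = (\<Sum>v\<in>t. u v * L v)"
      by (simp add: module_hom.sum[OF L(1)] module_hom.scale[OF L(1)])
    also have "\<dots> = u (ccwe m N1 N2 C) * L (ccwe m N1 N2 C)"
      using t(1) C(1) zero by (subst sum.remove[of _ "ccwe m N1 N2 C"]) auto
    finally show False using C(2) L(2) by simp
  qed
qed

lemma ccwe_representatives:
  assumes R: "R \<subseteq> DESD_codes N1 N2" and all: "\<forall>C\<in>DESD_codes N1 N2. \<exists>D\<in>R. codes_equiv N1 N2 C D"
  shows "ccwe m N1 N2 ` R = ccwe m N1 N2 ` DESD_codes N1 N2"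
proof
  show "ccwe m N1 N2 ` DESD_codes N1 N2 \<subseteq> ccwe m N1 N2 ` R"
  proof (rule image_subsetI)
    fix C assume C: "C \<in> DESD_codes N1 N2"
    then obtain D where D: "D \<in> R" "codes_equiv N1 N2 C D" using all by blast
    then have "ccwe m N1 N2 D = ccwe m N1 N2 C"
      using C R by (intro ccwe_equiv) (auto simp: DESD_codes_def)
    then show "ccwe m N1 N2 C \<in> ccwe m N1 N2 ` R" using D(1) by (metis imageI)
  qed
qed (use R in blast)

end

theorem mainTheorem9:
  fixes m N1 N2 :: nat
  assumes "m \<ge> 1"
  shows "invariant_space m N1 N2 = cspan (ccwe m N1 N2 ` DESD_codes N1 N2)
    \<and> (2 * (m + 1) \<ge> N1 + N2 \<longrightarrow>
         (\<forall>R. R \<subseteq> DESD_codes N1 N2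
            \<and> (\<forall>C\<in>DESD_codes N1 N2. \<exists>D\<in>R. codes_equiv N1 N2 C D)
            \<and> (\<forall>C\<in>R. \<forall>D\<in>R. codes_equiv N1 N2 C D \<longrightarrow> C = D) \<longrightarrow>
            inj_on (ccwe m N1 N2) R \<and> cindependent (ccwe m N1 N2 ` R)
            \<and> cspan (ccwe m N1 N2 ` R) = invariant_space m N1 N2))"
proof (intro conjI impI allI)
  show span: "invariant_space m N1 N2 = cspan (ccwe m N1 N2 ` DESD_codes N1 N2)"
    by (rule invariant_space_span[OF assms])
  fix R
  assume N: "N1 + N2 \<le> 2 * (m + 1)" and R: "R \<subseteq> DESD_codes N1 N2
    \<and> (\<forall>C\<in>DESD_codes N1 N2. \<exists>D\<in>R. codes_equiv N1 N2 C D)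
    \<and> (\<forall>C\<in>R. \<forall>D\<in>R. codes_equiv N1 N2 C D \<longrightarrow> C = D)"
  have sub: "R \<subseteq> DESD_codes N1 N2" using R by simp
  have inequiv: "C = D" if "C \<in> R" "D \<in> R" "codes_equiv N1 N2 C D" for C D using R that by simp
  show "inj_on (ccwe m N1 N2) R" "cindependent (ccwe m N1 N2 ` R)"
    using ccwe_basis[OF N sub inequiv] by simp_all
  show "cspan (ccwe m N1 N2 ` R) = invariant_space m N1 N2"
    using ccwe_representatives[of R N1 N2 m] R span by simp
qed

end
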